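(* Assume that $W$ is $\lambda_W$-convex (in its second argument, for a.e. $x\in\Omega$) and $F$ is $\lambda_F$-convex (in its second argument, for a.e. $x\in\Omega$). Let $\lambda_1(\Omega)>0$ be the first eigenvalue of the Dirichlet Laplacian on $\Omega$. Let $p\ge 2$, let $u\in W^{1,p}_g(\Omega,D)$, and assume that there exists $\omega\in\partial\Phi(u\#\mathcal{L}_\Omega)$ such that $\omega$ can be extended to a $\lambda$-convex function on $\mathbb{R}^k$ with $$\lambda\ge-\lambda_W\lambda_1(\Omega)-\lambda_F,$$ and such that $\nabla\cdot DW(\nabla u)-DF(u)=(\nabla\omega)\circ u$ holds weakly, i.e. for all $v\in W^{1,p}_0(\Omega,\mathbb{R}^k)$, $$\int_\Omega\Big(\nabla v:DW(\nabla u)+v\cdot\big(DF(u)+(\nabla\omega)\circ u\big)\Big)\,\mathrm{d}\mathcal{L}_\Omega=0,$$ where $\nabla\omega$ can be any measurable selection of the subdifferential of the extended function $\omega$. Then $u$ is a minimizer over $W^{1,p}_g(\Omega,D)$ of the energy $$E(u)=\int_\Omega\big(W(\nabla u)+F(u)\big)\,\mathrm{d}\mathcal{L}_\Omega+\Phi(u\#\mathcal{L}_\Omega).$$ Moreover, if $\lambda>-\lambda_W\lambda_1(\Omega)-\lambda_F$, then $u$ is the unique minimizer of $E$ over $W^{1,p}_g(\Omega,D)$.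
   Context: Let $\Omega\subset\mathbb{R}^d$ and $D\subset\mathbb{R}^k$ be open bounded domains with Lipschitz boundaries; $\bar D = D\cup\partial D$. $\mathcal{L}_\Omega$, $\mathcal{L}_D$ are the Lebesgue measures restricted to $\Omega$, $D$. $\mathcal{M}(X)$ (resp. $\mathcal{M}_+(X)$) is the set of finite signed (resp. nonnegative) Radon measures on $X$, with the weak* topology. $T\#\alpha$ denotes the push-forward of the measure $\alpha$ by $T$. Norms are Euclidean/Frobenius and $A:B$ is the Frobenius inner product. A function $f$ on a Euclidean space is $\lambda$-convex ($\lambda\in\mathbb{R}$) if $y\mapsto f(y)-\frac{\lambda}{2}|y|^2$ is convex. Its subdifferential at $y$ is the set of vectors $q$ with $f(z)\ge f(y)+q\cdot(z-y)+\frac{\lambda}{2}|z-y|^2$ for all $z$. $W:\Omega\times\mathbb{R}^{k\times d}\to\mathbb{R}$ is a Carathéodory function (measurable in $x$, continuous in the second variable) such that for some $C>0$ (and the exponent $p$ of the claim): $\frac1C(|H|^p-1)\le W(x,H)\le C(|H|^p+1)$, and $H\mapsto W(x,H)$ is convex for a.e. $x\in\Omega$. $F:\Omega\times D\to\mathbb{R}$ is a Carathéodory function with $\int_\Omega |F(x,u(x))|\,\mathrm{d}x<+\infty$ for all (measurable) $u:\Omega\to D$, and $y\mapsto F(x,y)$ is convex. Convexity (resp. $\lambda_F$-convexity) of $F(x,\cdot)$ on $D$ means that for a.e. $x$ it is the restriction to $D$ of a convex (resp. $\lambda_F$-convex) function on $\mathbb{R}^k$. $W$ and $F$ are differentiable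 in their second argument, with differentials $DW$ and $DF$. The dependence on $x$ is suppressed: $W(\nabla u)$ means $W(x,\nabla u(x))$, $F(u)$ means $F(x,u(x))$, and similarly for $DW$, $DF$. The boundary datum $g:\partial\Omega\to\partial D$ extends to a function on $\Omega$ with $g(\Omega)=D$. $W^{1,p}_g(\Omega,D)$ is the set of $u\in W^{1,p}(\Omega,\mathbb{R}^k)$ with trace $g$ on $\partial\Omega$ and with range in $D$. $\Phi:\mathcal{M}_+(\bar D)\to\mathbb{R}\cup\{+\infty\}$ is convex, bounded below and weak* lower semicontinuous (extended by $+\infty$ to $\mathcal{M}(\bar D)\setminus\mathcal{M}_+(\bar D)$). For $\omega\in C(\bar D)$, $\Phi^*(\omega)=\sup_{\mu\in\mathcal{M}(\bar D)}\left(\int\omega\,\mathrm{d}\mu-\Phi(\mu)\right)$. One writes $\omega\in\partial\Phi(\mu)$ if $\omega\in C(\bar D)$, $\Phi(\mu)<+\infty$ and $\Phi^*(\omega)=\int\omega\,\mathrm{d}\mu-\Phi(\mu)$. In the weak Euler--Lagrange equation, it is understood that the integral is well defined for every test function $v$. *)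

theory Defs
  imports "HOL-Analysis.Analysis"
begin

text \<open>
  Conventions.  The spaces are \<open>real^'d\<close> (containing \<open>\<Omega>\<close>) and \<open>real^'k\<close> (containing \<open>D\<close>);
  a k-by-d matrix has type \<open>real^'d^'k\<close>, whose library norm and inner product are the Frobenius
  ones.  The restricted Lebesgue measure is \<open>lebesgue_on \<Omega>\<close>.  Functions on \<open>\<Omega>\<close> are total functions
  whose values off \<open>\<Omega>\<close> are irrelevant; Sobolev functions are not quotiented by equality almost
  everywhere.
\<close>

text \<open>Near each boundary point the set is the strict epigraph, in some unit direction \<open>n\<close>, of a
  Lipschitz function of the component orthogonal to \<open>n\<close>.\<close>

definition lipschitz_boundary :: "(real^'n) set \<Rightarrow> bool" where
  "lipschitz_boundary S \<longleftrightarrow>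
    (\<forall>x\<in>frontier S. \<exists>r>0. \<exists>n L \<gamma>. norm n = 1 \<and> L-lipschitz_on UNIV \<gamma> \<and>
       S \<inter> ball x r = {y \<in> ball x r. \<gamma> (y - (y \<bullet> n) *\<^sub>R n) < y \<bullet> n})"

definition lipschitz_domain :: "(real^'n) set \<Rightarrow> bool" where
  "lipschitz_domain S \<longleftrightarrow>
    open S \<and> bounded S \<and> connected S \<and> S \<noteq> {} \<and> lipschitz_boundary S"

definition hausdorff_outer :: "nat \<Rightarrow> 'a::metric_space set \<Rightarrow> ennreal" where
  "hausdorff_outer s A =
    (SUP \<delta>\<in>{0::real<..}.
       INF C\<in>{C :: nat \<Rightarrow> 'a set. A \<subseteq> (\<Union>i. C i) \<and> (\<forall>i. bounded (C i) \<and> diameter (C i) \<le> \<delta>)}.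
         \<Sum>i. if C i = {} then 0
              else ennreal (unit_ball_vol (real s) * (diameter (C i) / 2) ^ s))"

text \<open>The set function above is a metric outer measure, hence countably additive on Borel sets, so
  that \<open>measure_of\<close> does not fall back to its zero default.\<close>

definition hausdorff_measure :: "nat \<Rightarrow> 'a::metric_space measure" where
  "hausdorff_measure s = measure_of UNIV (sets borel) (hausdorff_outer s)"

definition surface_measure :: "(real^'d) set \<Rightarrow> (real^'d) measure" where
  "surface_measure \<Omega> =
    completion (restrict_space (hausdorff_measure (CARD('d) - 1)) (frontier \<Omega>))"

definition partial_deriv :: "'d \<Rightarrow> (real^'d \<Rightarrow> real) \<Rightarrow> real^'d \<Rightarrow> real" where
  "partial_deriv j f x = frechet_derivative f (at x) (axis j 1)"

fun Ck :: "nat \<Rightarrow> (real^'d \<Rightarrow> real) \<Rightarrow> bool" where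
  "Ck 0 f \<longleftrightarrow> continuous_on UNIV f"
| "Ck (Suc n) f \<longleftrightarrow> f differentiable_on UNIV \<and> (\<forall>j. Ck n (partial_deriv j f))"

definition smooth :: "(real^'d \<Rightarrow> real^'k) \<Rightarrow> bool" where
  "smooth f \<longleftrightarrow> (\<forall>n i. Ck n (\<lambda>x. f x $ i))"

definition test_functions :: "(real^'d) set \<Rightarrow> (real^'d \<Rightarrow> real) set" where
  "test_functions \<Omega> =
    {\<phi>. (\<forall>n. Ck n \<phi>) \<and> compact (closure {x. \<phi> x \<noteq> 0}) \<and> closure {x. \<phi> x \<noteq> 0} \<subseteq> \<Omega>}"

definition has_weak_gradient ::
    "(real^'d) set \<Rightarrow> (real^'d \<Rightarrow> real^'k) \<Rightarrow> (real^'d \<Rightarrow> real^'d^'k) \<Rightarrow> bool" where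
  "has_weak_gradient \<Omega> u G \<longleftrightarrow>
    (\<forall>K. compact K \<and> K \<subseteq> \<Omega> \<longrightarrow> integrable (lebesgue_on K) u \<and> integrable (lebesgue_on K) G) \<and>
    (\<forall>\<phi>\<in>test_functions \<Omega>. \<forall>i j.
       (LINT x|lebesgue_on \<Omega>. u x $ i * partial_deriv j \<phi> x)
         = - (LINT x|lebesgue_on \<Omega>. G x $ i $ j * \<phi> x))"

text \<open>The weak gradient is unique up to null sets; one representative is chosen.\<close>

definition weak_grad ::
    "(real^'d) set \<Rightarrow> (real^'d \<Rightarrow> real^'k) \<Rightarrow> real^'d \<Rightarrow> real^'d^'k" where
  "weak_grad \<Omega> u = (SOME G. has_weak_gradient \<Omega> u G)"

definition Lp_on :: "(real^'d) set \<Rightarrow> real \<Rightarrow> (real^'d \<Rightarrow> 'b::euclidean_space) \<Rightarrow> bool" where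
  "Lp_on \<Omega> p f \<longleftrightarrow>
    f \<in> borel_measurable (lebesgue_on \<Omega>) \<and>
    integrable (lebesgue_on \<Omega>) (\<lambda>x. norm (f x) powr p)"

definition sobolev :: "(real^'d) set \<Rightarrow> real \<Rightarrow> (real^'d \<Rightarrow> real^'k) set" where
  "sobolev \<Omega> p = {u. Lp_on \<Omega> p u \<and> (\<exists>G. has_weak_gradient \<Omega> u G \<and> Lp_on \<Omega> p G)}"

text \<open>The trace operator is the continuous extension to the Sobolev space of the restriction of
  smooth functions to the boundary, with values in the Lebesgue space of the surface measure.\<close>

definition has_trace ::
    "(real^'d) set \<Rightarrow> real \<Rightarrow> (real^'d \<Rightarrow> real^'k) \<Rightarrow> (real^'d \<Rightarrow> real^'k) \<Rightarrow> bool" where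
  "has_trace \<Omega> p u g \<longleftrightarrow>
    g \<in> borel_measurable (surface_measure \<Omega>) \<and>
    (\<exists>\<phi> :: nat \<Rightarrow> real^'d \<Rightarrow> real^'k. (\<forall>n. smooth (\<phi> n)) \<and>
      (\<lambda>n. \<integral>\<^sup>+x. ennreal (norm (\<phi> n x - u x) powr p) \<partial>lebesgue_on \<Omega>) \<longlonglongrightarrow> 0 \<and>
      (\<lambda>n. \<integral>\<^sup>+x. ennreal (norm (jacobian (\<phi> n) (at x) - weak_grad \<Omega> u x) powr p)
             \<partial>lebesgue_on \<Omega>) \<longlonglongrightarrow> 0 \<and>
      (\<lambda>n. \<integral>\<^sup>+x. ennreal (norm (\<phi> n x - g x) powr p) \<partial>surface_measure \<Omega>) \<longlonglongrightarrow> 0)"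

definition sobolev_trace ::
    "(real^'d) set \<Rightarrow> real \<Rightarrow> (real^'d \<Rightarrow> real^'k) \<Rightarrow> (real^'d \<Rightarrow> real^'k) set" where
  "sobolev_trace \<Omega> p g = {u \<in> sobolev \<Omega> p. has_trace \<Omega> p u g}"

text \<open>Zero boundary values mean zero trace; on a bounded Lipschitz domain these functions form the
  closure of the compactly supported smooth functions.\<close>

abbreviation sobolev_zero :: "(real^'d) set \<Rightarrow> real \<Rightarrow> (real^'d \<Rightarrow> real^'k) set" where
  "sobolev_zero \<Omega> p \<equiv> sobolev_trace \<Omega> p (\<lambda>_. 0)"

definition sobolev_trace_into ::
    "(real^'d) set \<Rightarrow> (real^'k) set \<Rightarrow> real \<Rightarrow> (real^'d \<Rightarrow> real^'k) \<Rightarrow> (real^'d \<Rightarrow> real^'k) set" where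
  "sobolev_trace_into \<Omega> D p g = {u \<in> sobolev_trace \<Omega> p g. u ` \<Omega> \<subseteq> D}"

text \<open>Scalar functions are represented with values in \<open>real^1\<close>.\<close>

definition dirichlet_eigenvalue :: "(real^'d) set \<Rightarrow> real \<Rightarrow> bool" where
  "dirichlet_eigenvalue \<Omega> l \<longleftrightarrow>
    (\<exists>e :: real^'d \<Rightarrow> real^1. e \<in> sobolev_zero \<Omega> 2 \<and> \<not> (AE x in lebesgue_on \<Omega>. e x = 0) \<and>
      (\<forall>v \<in> sobolev_zero \<Omega> 2.
        (LINT x|lebesgue_on \<Omega>. weak_grad \<Omega> e x \<bullet> weak_grad \<Omega> v x)
          = l * (LINT x|lebesgue_on \<Omega>. e x \<bullet> v x)))"

definition first_dirichlet_eigenvalue :: "(real^'d) set \<Rightarrow> real" where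
  "first_dirichlet_eigenvalue \<Omega> = (LEAST l. dirichlet_eigenvalue \<Omega> l)"

definition lambda_convex :: "real \<Rightarrow> ('a::real_inner \<Rightarrow> real) \<Rightarrow> bool" where
  "lambda_convex l f \<longleftrightarrow> convex_on UNIV (\<lambda>y. f y - l / 2 * (norm y)\<^sup>2)"

definition lambda_subdiff :: "real \<Rightarrow> ('a::real_inner \<Rightarrow> real) \<Rightarrow> 'a \<Rightarrow> 'a set" where
  "lambda_subdiff l f y =
    {q. \<forall>z. f z \<ge> f y + q \<bullet> (z - y) + l / 2 * (norm (z - y))\<^sup>2}"

text \<open>On a compact set every finite Borel measure is Radon.\<close>

definition radon_pos :: "'a::euclidean_space set \<Rightarrow> 'a measure set" where
  "radon_pos X = {\<mu>. sets \<mu> = sets (restrict_space borel X) \<and> finite_measure \<mu>}"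

definition weak_star :: "'a::euclidean_space set \<Rightarrow> 'a measure topology" where
  "weak_star X = topology_generated_by
    {{\<mu> \<in> radon_pos X. (LINT y|\<mu>. \<omega> y) \<in> U} | \<omega> U. continuous_on X \<omega> \<and> open (U :: real set)}"

definition measure_convex :: "'a::euclidean_space set \<Rightarrow> ('a measure \<Rightarrow> ereal) \<Rightarrow> bool" where
  "measure_convex X \<Phi> \<longleftrightarrow>
    (\<forall>\<mu>\<in>radon_pos X. \<forall>\<nu>\<in>radon_pos X. \<forall>\<sigma>\<in>radon_pos X. \<forall>t\<in>{0..1::real}.
      (\<forall>A\<in>sets \<sigma>. measure \<sigma> A = t * measure \<mu> A + (1 - t) * measure \<nu> A) \<longrightarrow>
      \<Phi> \<sigma> \<le> ereal t * \<Phi> \<mu> + ereal (1 - t) * \<Phi> \<nu>)"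

definition weak_star_lsc :: "'a::euclidean_space set \<Rightarrow> ('a measure \<Rightarrow> ereal) \<Rightarrow> bool" where
  "weak_star_lsc X \<Phi> \<longleftrightarrow>
    (\<forall>a::real. openin (weak_star X) {\<mu> \<in> radon_pos X. ereal a < \<Phi> \<mu>})"

text \<open>The functionals are extended by \<open>\<infinity>\<close> to the signed measures that are not nonnegative.  These
  contribute only \<open>-\<infinity>\<close> to the supremum below, which is therefore taken over nonnegative measures.\<close>

definition conjugate :: "'a::euclidean_space set \<Rightarrow> ('a measure \<Rightarrow> ereal) \<Rightarrow> ('a \<Rightarrow> real) \<Rightarrow> ereal"
  where "conjugate X \<Phi> \<omega> = (SUP \<mu>\<in>radon_pos X. ereal (LINT y|\<mu>. \<omega> y) - \<Phi> \<mu>)"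

definition measure_subdiff ::
    "'a::euclidean_space set \<Rightarrow> ('a measure \<Rightarrow> ereal) \<Rightarrow> 'a measure \<Rightarrow> ('a \<Rightarrow> real) set" where
  "measure_subdiff X \<Phi> \<mu> =
    {\<omega>. continuous_on X \<omega> \<and> \<mu> \<in> radon_pos X \<and> \<Phi> \<mu> < \<infinity> \<and>
        conjugate X \<Phi> \<omega> = ereal (LINT y|\<mu>. \<omega> y) - \<Phi> \<mu>}"

definition push_forward ::
    "(real^'d) set \<Rightarrow> (real^'k) set \<Rightarrow> (real^'d \<Rightarrow> real^'k) \<Rightarrow> (real^'k) measure" where
  "push_forward \<Omega> D u = distr (lebesgue_on \<Omega>) (restrict_space borel (closure D)) u"

definition energy ::
    "(real^'d) set \<Rightarrow> (real^'k) set \<Rightarrow> (real^'d \<Rightarrow> real^'d^'k \<Rightarrow> real) \<Rightarrow>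
     (real^'d \<Rightarrow> real^'k \<Rightarrow> real) \<Rightarrow> ((real^'k) measure \<Rightarrow> ereal) \<Rightarrow>
     (real^'d \<Rightarrow> real^'k) \<Rightarrow> ereal" where
  "energy \<Omega> D W F \<Phi> u =
    ereal (LINT x|lebesgue_on \<Omega>. W x (weak_grad \<Omega> u x) + F x (u x)) + \<Phi> (push_forward \<Omega> D u)"

definition minimizer_over :: "'a set \<Rightarrow> ('a \<Rightarrow> ereal) \<Rightarrow> 'a \<Rightarrow> bool" where
  "minimizer_over S E u \<longleftrightarrow> u \<in> S \<and> (\<forall>w\<in>S. E u \<le> E w)"

end

theory Submission
  imports Defs "HOL-Library.Diagonal_Subsequence"
begin

text \<open>
  Let \<open>w\<close> be a competitor and \<open>v = w - u\<close>, which has zero trace.  The lower quadratic bounds that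
  \<open>\<kappa>\<^sub>W\<close>-convexity of \<open>W\<close>, \<open>\<kappa>\<^sub>F\<close>-convexity of \<open>F\<close> and \<open>\<kappa>\<close>-convexity of the extension of \<open>\<omega>\<close> give
  between \<open>u\<close> and \<open>w\<close> add up to the first variation of the Euler--Lagrange equation, whose integral
  vanishes, plus the integral of \<open>\<kappa>\<^sub>W / 2 |\<nabla>v|\<^sup>2 + (\<kappa>\<^sub>F + \<kappa>) / 2 |v|\<^sup>2\<close>.  Since \<open>\<omega>\<close> is a subgradient of
  \<open>\<Phi>\<close>, the change of \<open>\<Phi>\<close> is at least the change of the integral of \<open>\<omega>\<close> (\<open>measure_subdiff_inequality\<close>).
  With the Poincare inequality for the first Dirichlet eigenvalue, \<open>\<lambda>\<^sub>1 \<integral>|v|\<^sup>2 \<le> \<integral>|\<nabla>v|\<^sup>2\<close>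
  (\<open>dirichlet_poincare_sobolev_zero\<close>), the energy of \<open>w\<close> exceeds that of \<open>u\<close> by at least
  \<open>(\<kappa>\<^sub>W \<lambda>\<^sub>1 + \<kappa>\<^sub>F + \<kappa>) / 2 \<integral>|v|\<^sup>2\<close>, from which both claims can be read off.  If \<open>\<kappa>\<^sub>W\<close> is negative, the
  gradient term is bounded below by \<open>0\<close> instead, because \<open>W\<close> is convex, and \<open>\<lambda>\<^sub>1 \<ge> 0\<close> is enough.

  Most of the work is the Poincare inequality.  The eigenvalue \<open>\<lambda>\<^sub>1\<close> is the least number for which
  the eigenvalue equation has a nonzero solution, so the infimum of the Rayleigh quotient has to be
  shown to be attained (\<open>rayleigh_minimizer\<close>).  The parallelogram identity turns a minimizing
  sequence that is Cauchy in \<open>L\<^sup>2\<close> into one whose gradients are Cauchy as well, so that everything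
  rests on Rellich compactness (\<open>rellich\<close>).  Functions with a trace are limits of functions smooth
  on the whole space, and it is enough to prove compactness for the latter.  Near a boundary point
  the domain lies above a Lipschitz graph; moving by \<open>t\<close> away from the graph leads into a compact
  subset of the domain and changes a function by at most \<open>t\<close> times the norm of its gradient
  (\<open>boundary_reduction_exists\<close>).  On a compact subset a function is close to its local averages,
  and these are controlled by finitely many linear functionals (\<open>interior_finite_rank_bound\<close>).
  Together this is an Ehrling inequality, and a diagonal sequence finishes the argument.  Zero
  trace is preserved in the limit by choosing the smooth approximations along the diagonal.

  Three further facts connect this with the Sobolev spaces of the statement.  Smooth bumps show
  that weak gradients are unique (\<open>weak_gradient_unique\<close>), so that \<open>weak_grad\<close> is additive almost
  everywhere.  Smooth functions have their classical gradient as weak gradient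
  (\<open>smooth_integration_by_parts\<close>).  Finally, a zero trace in the sense of \<open>L\<^sup>p\<close> is one in the sense of
  \<open>L\<^sup>2\<close> because the surface measure of a compact Lipschitz boundary is finite, which follows from a
  packing argument (\<open>finite_measure_surface_measure\<close>).
\<close>
section \<open>Smooth functions and smooth bumps\<close>

definition Cinf :: "(real^'d \<Rightarrow> real) \<Rightarrow> bool" where
  "Cinf f \<longleftrightarrow> (\<forall>n. Ck n f)"

definition grad :: "(real^'d \<Rightarrow> real) \<Rightarrow> real^'d \<Rightarrow> real^'d" where
  "grad f x = (\<chi> j. partial_deriv j f x)"

lemma partial_deriv_eqI:
  assumes "(f has_derivative f') (at x)"
  shows "partial_deriv j f x = f' (axis j 1)"
  using frechet_derivative_at[OF assms] by (simp add: partial_deriv_def)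

lemma Cinf_iff: "Cinf f \<longleftrightarrow> f differentiable_on UNIV \<and> (\<forall>j. Cinf (partial_deriv j f))"
proof
  assume "Cinf f"
  then have "Ck (Suc n) f" for n by (auto simp: Cinf_def)
  then show "f differentiable_on UNIV \<and> (\<forall>j. Cinf (partial_deriv j f))"
    by (auto simp: Cinf_def)
next
  assume R: "f differentiable_on UNIV \<and> (\<forall>j. Cinf (partial_deriv j f))"
  show "Cinf f" unfolding Cinf_def
  proof
    fix n show "Ck n f"
      using R by (cases n) (auto simp: Cinf_def differentiable_imp_continuous_on)
  qed
qed

text \<open>Smoothness is a greatest fixed point: it holds for every class of differentiable functions that
  is closed under partial derivatives.\<close>

lemma Cinf_coinduct:
  assumes "P f"
    and step: "\<And>f. P f \<Longrightarrow> f differentiable_on UNIV \<and> (\<forall>j. P (partial_deriv j f))"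
  shows "Cinf f"
proof -
  have "P f \<Longrightarrow> Ck n f" for n f
  proof (induction n arbitrary: f)
    case 0
    then show ?case using step[OF 0] by (simp add: differentiable_imp_continuous_on)
  next
    case (Suc n)
    then show ?case using step[OF Suc.prems] by simp
  qed
  then show ?thesis using assms(1) by (simp add: Cinf_def)
qed

lemma Cinf_continuous: "Cinf f \<Longrightarrow> continuous_on A f"
  using Cinf_iff continuous_on_subset differentiable_imp_continuous_on by blast

lemma has_derivative_grad:
  assumes "f differentiable_on UNIV"
  shows "(f has_derivative (\<lambda>h. grad f x \<bullet> h)) (at x)"
proof -
  have d: "(f has_derivative frechet_derivative f (at x)) (at x)"
    using assms by (simp add: differentiable_on_def frechet_derivative_works)
  then have lin: "linear (frechet_derivative f (at x))"
    by (rule has_derivative_linear)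
  have "frechet_derivative f (at x) h = grad f x \<bullet> h" for h
  proof -
    have "frechet_derivative f (at x) h
        = frechet_derivative f (at x) (\<Sum>j\<in>UNIV. (h $ j) *\<^sub>R axis j 1)"
      using basis_expansion[of h] by (simp add: scalar_mult_eq_scaleR)
    also have "\<dots> = grad f x \<bullet> h"
      by (simp add: linear_sum[OF lin] linear_scale[OF lin] inner_vec_def grad_def
          partial_deriv_def mult.commute)
    finally show ?thesis .
  qed
  then have "frechet_derivative f (at x) = (\<lambda>h. grad f x \<bullet> h)" by auto
  with d show ?thesis by simp
qed

lemma Cinf_grad: "Cinf f \<Longrightarrow> (f has_derivative (\<lambda>h. grad f x \<bullet> h)) (at x)"
  using Cinf_iff has_derivative_grad by blast

lemma continuous_grad: "Cinf f \<Longrightarrow> continuous_on A (grad f)"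
  unfolding grad_def by (intro continuous_intros) (meson Cinf_continuous Cinf_iff)

lemma partial_deriv_lincomb:
  assumes "f differentiable_on UNIV" "g differentiable_on UNIV"
  shows "partial_deriv j (\<lambda>x. a * f x + b * g x) =
           (\<lambda>x. a * partial_deriv j f x + b * partial_deriv j g x)"
proof
  fix x
  have "((\<lambda>x. a * f x + b * g x) has_derivative (\<lambda>h. a * (grad f x \<bullet> h) + b * (grad g x \<bullet> h))) (at x)"
    by (intro has_derivative_add has_derivative_mult_right has_derivative_grad assms)
  from partial_deriv_eqI[OF this] show
    "partial_deriv j (\<lambda>x. a * f x + b * g x) x = a * partial_deriv j f x + b * partial_deriv j g x"
    by (simp add: inner_axis grad_def)
qed

lemma Cinf_lincomb:
  assumes "Cinf f" "Cinf g" shows "Cinf (\<lambda>x. a * f x + b * g x)"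
proof (rule Cinf_coinduct[where P="\<lambda>h. \<exists>f g. Cinf f \<and> Cinf g \<and> h = (\<lambda>x. a * f x + b * g x)"])
  show "\<exists>f' g'. Cinf f' \<and> Cinf g' \<and> (\<lambda>x. a * f x + b * g x) = (\<lambda>x. a * f' x + b * g' x)"
    using assms by blast
next
  fix h :: "real^'d \<Rightarrow> real" assume "\<exists>f g. Cinf f \<and> Cinf g \<and> h = (\<lambda>x. a * f x + b * g x)"
  then obtain f g where fg: "Cinf f" "Cinf g" "h = (\<lambda>x. a * f x + b * g x)" by blast
  have d: "f differentiable_on UNIV" "g differentiable_on UNIV"
    using fg Cinf_iff by blast+
  then have "h differentiable_on UNIV"
    unfolding fg differentiable_on_def by (auto intro!: derivative_intros)
  moreover have "\<exists>f g. Cinf f \<and> Cinf g \<and> partial_deriv j h = (\<lambda>x. a * f x + b * g x)" for j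
    using partial_deriv_lincomb[OF d] fg Cinf_iff by blast
  ultimately show "h differentiable_on UNIV \<and>
     (\<forall>j. \<exists>f g. Cinf f \<and> Cinf g \<and> partial_deriv j h = (\<lambda>x. a * f x + b * g x))" by blast
qed

lemma grad_lincomb:
  assumes "Cinf f" "Cinf g"
  shows "grad (\<lambda>x. a * f x + b * g x) x = a *\<^sub>R grad f x + b *\<^sub>R grad g x"
  using assms partial_deriv_lincomb[of f g] by (simp add: vec_eq_iff grad_def Cinf_iff[of f] Cinf_iff[of g])

text \<open>The functions \<open>t\<^sup>-\<^sup>k e\<^sup>-\<^sup>1\<^sup>/\<^sup>t\<close>, extended by \<open>0\<close> to \<open>t \<le> 0\<close>.  All \<open>k\<close> are needed since differentiation
  raises the power of \<open>1 / t\<close>.\<close>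

definition flat :: "nat \<Rightarrow> real \<Rightarrow> real" where
  "flat k t = (if t > 0 then inverse t ^ k * exp (- inverse t) else 0)"

lemma flat_has_derivative:
  "(flat k has_real_derivative flat (k+2) t - k * flat (k+1) t) (at t)"
proof (cases t "0::real" rule: linorder_cases)
  case less
  have "((\<lambda>t. 0) has_real_derivative 0) (at t)" by simp
  then have "(flat k has_real_derivative 0) (at t)"
    by (rule has_field_derivative_transform_within_open[where S="{..<0}"]) (use less in \<open>auto simp: flat_def\<close>)
  then show ?thesis using less by (simp add: flat_def)
next
  case greater
  have "((\<lambda>t. inverse t ^ k * exp (- inverse t)) has_real_derivative
      flat (k+2) t - k * flat (k+1) t) (at t)"
  proof -
    define r where "r = inverse t"
    have I: "(inverse has_real_derivative - (r ^ 2)) (at t)"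
      using DERIV_inverse[of t UNIV] greater by (simp add: r_def power2_eq_square)
    have "((\<lambda>t. inverse t ^ k * exp (- inverse t)) has_real_derivative
        (of_nat k * (- (r ^ 2) * r ^ (k - Suc 0))) * exp (- r) + (exp (- r) * (- (- (r ^ 2)))) * r ^ k) (at t)"
      using DERIV_mult[OF DERIV_power[OF I, of k] DERIV_fun_exp[OF DERIV_minus[OF I]]]
      by (simp add: r_def)
    moreover have "(of_nat k * (- (r ^ 2) * r ^ (k - Suc 0))) * exp (- r) + (exp (- r) * (- (- (r ^ 2)))) * r ^ k
        = flat (k+2) t - k * flat (k+1) t"
      using greater by (cases k) (simp_all add: flat_def r_def power2_eq_square algebra_simps)
    ultimately show ?thesis by simp
  qed
  then show ?thesis
    by (rule has_field_derivative_transform_within_open[where S="{0<..}"]) (use greater in \<open>auto simp: flat_def\<close>)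
next
  case equal
  have "((\<lambda>h. flat k h / h) \<longlongrightarrow> 0) (at 0)"
  proof (rule filterlim_split_at)
    show "((\<lambda>h. flat k h / h) \<longlongrightarrow> 0) (at_left 0)"
      by (rule tendsto_eventually) (auto simp: flat_def eventually_at_filter)
    have "((\<lambda>h. inverse h ^ (Suc k) / exp (inverse h)) \<longlongrightarrow> 0) (at_right (0::real))"
      by (rule filterlim_compose[OF tendsto_power_div_exp_0 filterlim_inverse_at_top_right])
    then show "((\<lambda>h. flat k h / h) \<longlongrightarrow> 0) (at_right 0)"
      by (rule Lim_transform_eventually)
        (auto simp: flat_def eventually_at_filter exp_minus field_simps)
  qed
  then show ?thesis using equal by (simp add: DERIV_def flat_def)
qed

lemma flat_0_limit: assumes "t > 0" shows "(\<lambda>m. flat 0 (real (Suc m) * t)) \<longlonglongrightarrow> 1"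
proof -
  have "(\<lambda>m. exp (- (inverse (real (Suc m)) * inverse t))) \<longlonglongrightarrow> exp (- (0 * inverse t))"
    by (intro tendsto_intros LIMSEQ_inverse_real_of_nat)
  then show ?thesis using assms by (simp add: flat_def field_simps zero_less_mult_iff add_pos_nonneg)
qed

text \<open>The algebra generated by the functions \<open>flat k\<close> of affine functions of one coordinate.  It is
  closed under partial derivatives, hence consists of smooth functions.\<close>

inductive flat_alg :: "(real^'d \<Rightarrow> real) \<Rightarrow> bool" where
  const: "flat_alg (\<lambda>x. c)"
| gen: "flat_alg (\<lambda>x. flat k (c * x $ i + d))"
| add: "flat_alg f \<Longrightarrow> flat_alg g \<Longrightarrow> flat_alg (\<lambda>x. f x + g x)"
| mult: "flat_alg f \<Longrightarrow> flat_alg g \<Longrightarrow> flat_alg (\<lambda>x. f x * g x)"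

lemma flat_alg_partial_deriv:
  fixes f :: "real^'d \<Rightarrow> real"
  assumes "flat_alg f"
  shows "f differentiable_on UNIV \<and> (\<forall>j. flat_alg (partial_deriv j f))"
  using assms
proof (induction rule: flat_alg.induct)
  case (const c)
  have "partial_deriv j (\<lambda>x. c) = (\<lambda>x. 0)" for j :: 'd
    by (rule ext, rule partial_deriv_eqI) (rule derivative_intros)
  then show ?case by (auto intro: flat_alg.const)
next
  case (gen k c i d)
  let ?D = "\<lambda>x::real^'d. flat (k+2) (c * x $ i + d) - k * flat (k+1) (c * x $ i + d)"
  have D: "((\<lambda>x. flat k (c * x $ i + d)) has_derivative (\<lambda>h. ?D x * (c * h $ i))) (at x)" for x
  proof -
    have "((\<lambda>x. c * x $ i + d) has_derivative (\<lambda>h. c * h $ i)) (at x)"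
      by (intro has_derivative_add_const has_derivative_mult_right bounded_linear_imp_has_derivative
          bounded_linear_vec_nth)
    from DERIV_compose_FDERIV[OF flat_has_derivative this] show ?thesis
      by (simp add: mult.commute)
  qed
  have "partial_deriv j (\<lambda>x. flat k (c * x $ i + d)) =
      (\<lambda>x. (flat (k+2) (c * x $ i + d) + (- real k) * flat (k+1) (c * x $ i + d)) * (c * axis j 1 $ i))" for j
    by (rule ext) (simp add: partial_deriv_eqI[OF D])
  then have "flat_alg (partial_deriv j (\<lambda>x. flat k (c * x $ i + d)))" for j
    by (simp only:) (intro flat_alg.intros)
  moreover have "(\<lambda>x. flat k (c * x $ i + d)) differentiable_on UNIV"
    using D differentiableI unfolding differentiable_on_def by blast
  ultimately show ?case by blast
next
  case (add f g)
  then have "partial_deriv j (\<lambda>x. f x + g x) = (\<lambda>x. partial_deriv j f x + partial_deriv j g x)" for j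
    using partial_deriv_lincomb[of f g j 1 1] by simp
  with add show ?case by (auto intro!: flat_alg.add derivative_intros)
next
  case (mult f g)
  have "((\<lambda>x. f x * g x) has_derivative (\<lambda>h. f x * (grad g x \<bullet> h) + (grad f x \<bullet> h) * g x)) (at x)" for x
    using mult by (intro has_derivative_mult has_derivative_grad) auto
  from partial_deriv_eqI[OF this]
  have "partial_deriv j (\<lambda>x. f x * g x) = (\<lambda>x. f x * partial_deriv j g x + partial_deriv j f x * g x)" for j
    by (auto simp: inner_axis grad_def)
  with mult show ?case by (auto intro!: flat_alg.add flat_alg.mult derivative_intros)
qed

lemma flat_alg_Cinf: "flat_alg f \<Longrightarrow> Cinf f"
  by (rule Cinf_coinduct[where P = flat_alg]) (auto simp: flat_alg_partial_deriv)

lemma flat_alg_prod: "finite A \<Longrightarrow> (\<And>i. i \<in> A \<Longrightarrow> flat_alg (f i)) \<Longrightarrow> flat_alg (\<lambda>x. \<Prod>i\<in>A. f i x)"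
  by (induction A rule: finite_induct) (auto intro: flat_alg.intros)

text \<open>As \<open>flat 0\<close> is positive exactly on the positive reals and tends to \<open>1\<close> at infinity, these bumps
  are positive exactly on the open box and tend to its indicator function as \<open>m\<close> grows.\<close>

definition box_bump :: "real^'d \<Rightarrow> real^'d \<Rightarrow> nat \<Rightarrow> real^'d \<Rightarrow> real" where
  "box_bump a b m x =
    (\<Prod>i\<in>UNIV. flat 0 (real (Suc m) * (x $ i - a $ i)) * flat 0 (real (Suc m) * (b $ i - x $ i)))"

lemma flat_0_bounds: "0 \<le> flat 0 t" "flat 0 t \<le> 1"
  by (auto simp: flat_def)

lemma Cinf_box_bump: "Cinf (box_bump a b m)"
proof -
  have "flat_alg (\<lambda>x. flat 0 (real (Suc m) * (x $ i - a $ i)) * flat 0 (real (Suc m) * (b $ i - x $ i)))" for i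
    using flat_alg.mult[OF flat_alg.gen[of 0 "real (Suc m)" i "- real (Suc m) * a $ i"]
        flat_alg.gen[of 0 "- real (Suc m)" i "real (Suc m) * b $ i"]]
    by (simp only: algebra_simps mult_minus_left mult_minus_right add_uminus_conv_diff) 
  then have "flat_alg (\<lambda>x. box_bump a b m x)"
    unfolding box_bump_def by (intro flat_alg_prod) auto
  then show ?thesis by (simp add: flat_alg_Cinf)
qed

lemma box_bump_bounds: "0 \<le> box_bump a b m x" "box_bump a b m x \<le> 1"
  unfolding box_bump_def
  by (auto intro!: prod_nonneg prod_le_1 mult_nonneg_nonneg mult_le_one flat_0_bounds)

lemma box_bump_outside:
  assumes "x \<notin> box a b" shows "box_bump a b m x = 0"
proof -
  obtain i where "\<not> (a $ i < x $ i \<and> x $ i < b $ i)"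
    using assms by (auto simp: mem_box_cart)
  then have "flat 0 (real (Suc m) * (x $ i - a $ i)) * flat 0 (real (Suc m) * (b $ i - x $ i)) = 0"
    by (auto simp: flat_def zero_less_mult_iff)
  then show ?thesis unfolding box_bump_def by (intro prod_zero) auto
qed

lemma box_bump_limit: "(\<lambda>m. box_bump a b m x) \<longlonglongrightarrow> indicator (box a b) x"
proof (cases "x \<in> box a b")
  case True
  have "(\<lambda>m. box_bump a b m x) \<longlonglongrightarrow> (\<Prod>i\<in>(UNIV::'a set). 1 * 1)"
    unfolding box_bump_def using True
    by (intro tendsto_prod tendsto_mult flat_0_limit) (auto simp: mem_box_cart)
  then show ?thesis using True by simp
next
  case False
  then show ?thesis by (simp add: box_bump_outside)
qed

lemma box_bump_test_function:
  assumes "box a b \<subseteq> box a' b'" "cbox a' b' \<subseteq> \<Omega>"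
  shows "box_bump a b m \<in> test_functions \<Omega>"
proof -
  have "{x. box_bump a b m x \<noteq> 0} \<subseteq> box a b"
    using box_bump_outside by blast
  also have "\<dots> \<subseteq> cbox a' b'"
    using assms(1) box_subset_cbox by blast
  finally have *: "closure {x. box_bump a b m x \<noteq> 0} \<subseteq> cbox a' b'"
    by (rule closure_minimal) (rule closed_cbox)
  then have "compact (closure {x. box_bump a b m x \<noteq> 0})"
    by (meson bounded_cbox bounded_subset closed_closure compact_eq_bounded_closed)
  then show ?thesis
    using * assms(2) Cinf_box_bump[of a b m] by (auto simp: test_functions_def Cinf_def)
qed

lemma continuous_measurable_lebesgue:
  fixes f :: "'a::euclidean_space \<Rightarrow> 'b::euclidean_space"
  shows "continuous_on UNIV f \<Longrightarrow> f \<in> borel_measurable lebesgue"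
  by (intro measurable_completion) (simp add: borel_measurable_continuous_onI)

lemma sigma_finite_lebesgue: "sigma_finite_measure lebesgue"
proof (unfold sigma_finite_measure_def, rule exI, intro conjI ballI)
  let ?A = "range (\<lambda>n::nat. box (- (real n *\<^sub>R One)) (real n *\<^sub>R One)) :: 'a::euclidean_space set set"
  show "countable ?A" by (rule countable_image) simp
  show "?A \<subseteq> sets lebesgue" by auto
  show "\<Union>?A = space lebesgue" unfolding UN_box_eq_UNIV by simp
  show "emeasure lebesgue a \<noteq> \<infinity>" if "a \<in> ?A" for a
    using that by (auto simp: emeasure_lborel_box_finite less_top[symmetric])
qed

text \<open>The bumps of a box \<open>B\<close> tend boundedly to the indicator of \<open>B\<close>, so the integral of \<open>h\<close> over every
  subbox vanishes.  Boxes are stable under intersection and generate the Borel sets, so the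
  integral over every measurable subset vanishes too.\<close>

lemma fundamental_lemma_box:
  fixes h :: "real^'d \<Rightarrow> real"
  assumes op: "open \<Omega>" and ab: "cbox a b \<subseteq> \<Omega>"
    and int: "integrable (lebesgue_on (cbox a b)) h"
    and zero: "\<And>\<phi>. \<phi> \<in> test_functions \<Omega> \<Longrightarrow> (LINT x|lebesgue_on \<Omega>. h x * \<phi> x) = 0"
  shows "AE x in lebesgue. x \<in> box a b \<longrightarrow> h x = 0"
proof -
  define f where "f x = indicator (box a b) x * h x" for x
  have "integrable lebesgue (\<lambda>x. indicator (cbox a b) x * h x)"
    using int by (simp add: integrable_restrict_space)
  then have "integrable lebesgue (\<lambda>x. indicator (box a b) x *\<^sub>R (indicator (cbox a b) x * h x))"
    by (rule integrable_mult_indicator[rotated]) simp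
  moreover have "indicator (box a b) x *\<^sub>R (indicator (cbox a b) x * h x) = f x" for x
    using box_subset_cbox[of a b] by (auto simp: f_def indicator_def)
  ultimately have f: "integrable lebesgue f" by simp
  have box0: "(LINT x|lebesgue. indicator (box c d) x * f x) = 0" for c d
  proof -
    obtain c' d' where cd: "box c d \<inter> box a b = box c' d'"
      by (metis (no_types) box_Int_box)
    have "(\<lambda>m. LINT x|lebesgue. box_bump c' d' m x * f x) \<longlonglongrightarrow> (LINT x|lebesgue. indicator (box c' d') x * f x)"
    proof (rule integral_dominated_convergence)
      have "box_bump c' d' m \<in> borel_measurable lebesgue" for m
        by (intro continuous_measurable_lebesgue Cinf_continuous Cinf_box_bump)
      then show "(\<lambda>x. box_bump c' d' m x * f x) \<in> borel_measurable lebesgue" for m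
        using f by auto
      show "(\<lambda>x. indicator (box c' d') x * f x) \<in> borel_measurable lebesgue"
        using f by (intro borel_measurable_times borel_measurable_indicator) auto
      show "integrable lebesgue (\<lambda>x. \<bar>f x\<bar>)" using f by auto
      show "AE x in lebesgue. (\<lambda>m. box_bump c' d' m x * f x) \<longlonglongrightarrow> indicator (box c' d') x * f x"
        by (intro AE_I2 tendsto_mult box_bump_limit tendsto_const)
      show "AE x in lebesgue. norm (box_bump c' d' m x * f x) \<le> \<bar>f x\<bar>" for m
        using box_bump_bounds[of c' d' m] by (auto simp: abs_mult mult_left_le_one_le)
    qed
    moreover have "(LINT x|lebesgue. box_bump c' d' m x * f x) = 0" for m
    proof -
      have "box_bump c' d' m \<in> test_functions \<Omega>"
        by (rule box_bump_test_function[OF _ ab]) (use cd in blast)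
      from zero[OF this] have "(LINT x|lebesgue. indicator \<Omega> x *\<^sub>R (h x * box_bump c' d' m x)) = 0"
        using op by (simp add: integral_restrict_space)
      moreover have "indicator \<Omega> x *\<^sub>R (h x * box_bump c' d' m x) = box_bump c' d' m x * f x" for x
        using box_bump_outside[of x c' d' m] cd ab box_subset_cbox[of a b]
        by (cases "x \<in> box c' d'") (auto simp: f_def indicator_def)
      ultimately show ?thesis by (simp only:)
    qed
    ultimately have "(LINT x|lebesgue. indicator (box c' d') x * f x) = 0"
      by (simp add: LIMSEQ_const_iff)
    moreover have "indicator (box c' d') x * f x = indicator (box c d) x * f x" for x
      using cd by (auto simp: f_def indicator_def)
    ultimately show ?thesis by simp
  qed
  have "AE x in lebesgue. f x = 0"
  proof (rule sigma_finite_measure.density_zero[OF sigma_finite_lebesgue f])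
    have borel: "(LINT x|lebesgue. indicator A x * f x) = 0" if "A \<in> sets borel" for A
    proof -
      have "Int_stable (range (\<lambda>(a, b). box a b :: (real^'d) set))"
        by (auto simp: Int_stable_def box_Int_box)
      moreover have "range (\<lambda>(a, b). box a b :: (real^'d) set) \<subseteq> Pow UNIV" by simp
      moreover have "A \<in> sigma_sets UNIV (range (\<lambda>(a,b). box a b))"
        using that by (simp add: borel_eq_box)
      ultimately show ?thesis
      proof (induction rule: sigma_sets_induct_disjoint)
        case (basic A) then show ?case using box0 by auto
      next
        case empty show ?case by simp
      next
        case (compl A)
        then have A: "A \<in> sets lebesgue" by (simp add: borel_eq_box)
        have "(LINT x|lebesgue. indicator (UNIV - A) x * f x) =
            (LINT x|lebesgue. indicator (box a b) x * f x - indicator A x * f x)"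
          by (rule Bochner_Integration.integral_cong) (auto simp: f_def indicator_def)
        also have "\<dots> = (LINT x|lebesgue. indicator (box a b) x * f x) - (LINT x|lebesgue. indicator A x * f x)"
          using integrable_mult_indicator[OF _ f] A by (intro Bochner_Integration.integral_diff) auto
        finally show ?case using compl box0 by simp
      next
        case (union A)
        have "A i \<in> sets borel" for i
          using union(2) unfolding borel_eq_box by auto
        then have A: "A i \<in> sets lebesgue" for i by auto
        have "set_integrable lebesgue (\<Union>i. A i) f"
          using A integrable_mult_indicator[OF _ f] by (auto simp: set_integrable_def)
        then have "(LINT x:(\<Union>i. A i)|lebesgue. f x) = (\<Sum>i. LINT x:A i|lebesgue. f x)"
          using union A by (intro lebesgue_integral_countable_add) (auto simp: disjoint_family_on_def)
        also have "\<dots> = 0" using union by (simp add: set_lebesgue_integral_def)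
        finally show ?case by (simp add: set_lebesgue_integral_def)
      qed
    qed
    fix A :: "(real^'d) set" assume "A \<in> sets lebesgue"
    then obtain S N N' where A: "A = S \<union> N" "N \<subseteq> N'" "N' \<in> null_sets lborel" "S \<in> sets lborel"
      by (rule sets_completionE)
    have "AE x in lebesgue. x \<notin> N'"
      using A(3) AE_not_in null_sets_completionI by blast
    then have "AE x in lebesgue. indicator A x *\<^sub>R f x = indicator S x * f x"
      by eventually_elim (use A in \<open>auto simp: indicator_def\<close>)
    moreover have "(\<lambda>x. indicator A x *\<^sub>R f x) \<in> borel_measurable lebesgue"
      using f \<open>A \<in> sets lebesgue\<close> by auto
    moreover have "(\<lambda>x. indicator S x * f x) \<in> borel_measurable lebesgue"
      using f A(4) by (intro borel_measurable_times borel_measurable_indicator) auto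
    ultimately have "(LINT x|lebesgue. indicator A x *\<^sub>R f x) = (LINT x|lebesgue. indicator S x * f x)"
      by (intro integral_cong_AE) auto
    then show "(LINT x:A|lebesgue. f x) = 0"
      using borel[of S] A by (simp add: set_lebesgue_integral_def)
  qed
  then show ?thesis by eventually_elim (auto simp: f_def)
qed

text \<open>The fundamental lemma of the calculus of variations.  An open set is a countable union of
  boxes, and their boundaries are null sets.\<close>

lemma fundamental_lemma:
  fixes h :: "real^'d \<Rightarrow> real"
  assumes op: "open \<Omega>"
    and int: "\<And>K. compact K \<Longrightarrow> K \<subseteq> \<Omega> \<Longrightarrow> integrable (lebesgue_on K) h"
    and zero: "\<And>\<phi>. \<phi> \<in> test_functions \<Omega> \<Longrightarrow> (LINT x|lebesgue_on \<Omega>. h x * \<phi> x) = 0"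
  shows "AE x in lebesgue_on \<Omega>. h x = 0"
proof -
  obtain \<D> where D: "countable \<D>" "\<D> \<subseteq> Pow \<Omega>"
      "\<And>X. X \<in> \<D> \<Longrightarrow> \<exists>a b. X = cbox a b" "\<Union>\<D> = \<Omega>"
    using open_countable_Union_open_cbox[OF op] by blast
  have "AE x in lebesgue. \<forall>X\<in>\<D>. x \<in> X \<longrightarrow> h x = 0"
  proof (subst AE_ball_countable[OF D(1)], intro ballI)
    fix X assume "X \<in> \<D>"
    then obtain a b where X: "X = cbox a b" "cbox a b \<subseteq> \<Omega>" using D(2,3) by blast
    have "AE x in lebesgue. x \<notin> cbox a b - box a b"
      using negligible_frontier_interval[of a b] by (intro AE_not_in) (simp add: negligible_iff_null_sets)
    moreover have "AE x in lebesgue. x \<in> box a b \<longrightarrow> h x = 0"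
      using X(2) by (intro fundamental_lemma_box[OF op _ int zero]) auto
    ultimately show "AE x in lebesgue. x \<in> X \<longrightarrow> h x = 0"
      unfolding X by eventually_elim auto
  qed
  then have "AE x in lebesgue. x \<in> \<Omega> \<longrightarrow> h x = 0"
    by eventually_elim (use D(4) in blast)
  then show ?thesis using op by (simp add: AE_restrict_space_iff)
qed

section \<open>Weak gradients\<close>

lemma integrable_mult_compact_support:
  fixes h \<psi> :: "real^'d \<Rightarrow> real"
  assumes \<Omega>: "open \<Omega>" and K: "compact K" "K \<subseteq> \<Omega>" and h: "integrable (lebesgue_on K) h"
    and \<psi>: "continuous_on UNIV \<psi>" "\<And>x. x \<notin> K \<Longrightarrow> \<psi> x = 0"
  shows "integrable (lebesgue_on \<Omega>) (\<lambda>x. h x * \<psi> x)"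
proof -
  have "bounded (\<psi> ` K)"
    using compact_continuous_image[OF continuous_on_subset[OF \<psi>(1) subset_UNIV] K(1)]
    by (rule compact_imp_bounded)
  then obtain B where B: "\<And>x. x \<in> K \<Longrightarrow> \<bar>\<psi> x\<bar> \<le> B" by (auto simp: bounded_iff)
  have m: "\<psi> \<in> borel_measurable lebesgue"
    using \<psi>(1) by (rule continuous_measurable_lebesgue)
  have "integrable (lebesgue_on K) (\<lambda>x. h x * \<psi> x)"
  proof (rule Bochner_Integration.integrable_bound)
    show "integrable (lebesgue_on K) (\<lambda>x. B * h x)" using h by simp
    show "(\<lambda>x. h x * \<psi> x) \<in> borel_measurable (lebesgue_on K)"
      using borel_measurable_integrable[OF h] measurable_restrict_space1[OF m]
      by (rule borel_measurable_times)
    show "AE x in lebesgue_on K. norm (h x * \<psi> x) \<le> norm (B * h x)"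
    proof (rule AE_I2)
      fix x assume "x \<in> space (lebesgue_on K)"
      then have "\<bar>\<psi> x\<bar> \<le> \<bar>B\<bar>" using B[of x] by auto
      then show "norm (h x * \<psi> x) \<le> norm (B * h x)"
        by (simp add: abs_mult mult.commute mult_right_mono)
    qed
  qed
  moreover have "closed K" using K(1) compact_imp_closed by blast
  ultimately have "integrable lebesgue (\<lambda>x. indicator K x *\<^sub>R (h x * \<psi> x))"
    by (simp add: integrable_restrict_space)
  moreover have "indicator K x *\<^sub>R (h x * \<psi> x) = indicator \<Omega> x *\<^sub>R (h x * \<psi> x)" for x
    using K(2) \<psi>(2)[of x] by (cases "x \<in> K") (auto simp: indicator_def)
  ultimately have "integrable lebesgue (\<lambda>x. indicator \<Omega> x *\<^sub>R (h x * \<psi> x))" by (simp only:)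
  then show ?thesis using \<Omega> by (simp add: integrable_restrict_space)
qed

definition supp :: "(real^'d \<Rightarrow> real) \<Rightarrow> (real^'d) set" where
  "supp \<phi> = closure {x. \<phi> x \<noteq> 0}"

lemma test_function_support:
  assumes "\<phi> \<in> test_functions \<Omega>"
  shows "compact (supp \<phi>)" "supp \<phi> \<subseteq> \<Omega>"
  using assms unfolding test_functions_def supp_def by simp_all

lemma outside_support: assumes "x \<notin> supp \<phi>" shows "\<phi> x = 0"
proof (rule ccontr)
  assume "\<phi> x \<noteq> 0"
  then have "x \<in> {x. \<phi> x \<noteq> 0}" by simp
  with closure_subset have "x \<in> supp \<phi>" unfolding supp_def by (rule subsetD)
  with assms show False by contradiction
qed

lemma partial_deriv_outside_support:
  assumes "x \<notin> supp \<phi>" shows "partial_deriv j \<phi> x = 0"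
proof -
  have "((\<lambda>x. 0) has_derivative (\<lambda>h. 0)) (at x)" by simp
  then have "(\<phi> has_derivative (\<lambda>h. 0)) (at x)"
  proof (rule has_derivative_transform_within_open)
    show "open (- supp \<phi>)" unfolding supp_def by (rule open_Compl) (rule closed_closure)
    show "x \<in> - supp \<phi>" using assms by simp
    show "0 = \<phi> y" if "y \<in> - supp \<phi>" for y using outside_support[of y \<phi>] that by simp
  qed
  from partial_deriv_eqI[OF this] show ?thesis .
qed

lemma test_function_Cinf: "\<phi> \<in> test_functions \<Omega> \<Longrightarrow> Cinf \<phi>"
  by (auto simp: test_functions_def Cinf_def)

lemma has_weak_gradient_test:
  assumes "has_weak_gradient \<Omega> u G" "\<phi> \<in> test_functions \<Omega>"
  shows "(LINT x|lebesgue_on \<Omega>. u x $ i * partial_deriv j \<phi> x) = - (LINT x|lebesgue_on \<Omega>. G x $ i $ j * \<phi> x)"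
  using assms(1)[unfolded has_weak_gradient_def, THEN conjunct2, rule_format, OF assms(2)] .

text \<open>The integrals of an entry against test functions are fixed by the function alone, so the
  fundamental lemma applies to the entries of the difference.\<close>

lemma weak_gradient_unique:
  fixes G G' :: "real^'d \<Rightarrow> real^'d^'k"
  assumes op: "open \<Omega>" and G: "has_weak_gradient \<Omega> u G" and G': "has_weak_gradient \<Omega> u G'"
  shows "AE x in lebesgue_on \<Omega>. G x = G' x"
proof -
  have "AE x in lebesgue_on \<Omega>. G x $ i $ j - G' x $ i $ j = 0" for i j
  proof (rule fundamental_lemma[OF op])
    fix K assume K: "compact K" "K \<subseteq> \<Omega>"
    then have "integrable (lebesgue_on K) (\<lambda>x. (G x - G' x) \<bullet> axis i (axis j 1))"
      using G G' unfolding has_weak_gradient_def by (intro integrable_inner_left Bochner_Integration.integrable_diff) auto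
    then show "integrable (lebesgue_on K) (\<lambda>x. G x $ i $ j - G' x $ i $ j)"
      by (simp add: inner_axis)
  next
    fix \<phi> assume \<phi>: "\<phi> \<in> test_functions \<Omega>"
    show "(LINT x|lebesgue_on \<Omega>. (G x $ i $ j - G' x $ i $ j) * \<phi> x) = 0"
    proof -
      define K where "K = supp \<phi>"
      note K = test_function_support[OF \<phi>, folded K_def] outside_support[of _ \<phi>, folded K_def]
      have "integrable (lebesgue_on K) (\<lambda>x. H x $ i $ j)" if "has_weak_gradient \<Omega> u H" for H
      proof -
        have "integrable (lebesgue_on K) (\<lambda>x. H x \<bullet> axis i (axis j 1))"
          using that K unfolding has_weak_gradient_def by (intro integrable_inner_left) auto
        then show ?thesis by (simp add: inner_axis)
      qed
      then have *: "integrable (lebesgue_on \<Omega>) (\<lambda>x. H x $ i $ j * \<phi> x)" if "has_weak_gradient \<Omega> u H" for H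
        using that K op test_function_Cinf[OF \<phi>]
        by (intro integrable_mult_compact_support[where K=K] Cinf_continuous) auto
      have "(LINT x|lebesgue_on \<Omega>. G x $ i $ j * \<phi> x) = (LINT x|lebesgue_on \<Omega>. G' x $ i $ j * \<phi> x)"
        using has_weak_gradient_test[OF G \<phi>, of i j] has_weak_gradient_test[OF G' \<phi>, of i j] by simp
      then show ?thesis
        using *[OF G] *[OF G'] by (simp add: left_diff_distrib)
    qed
  qed
  then have "AE x in lebesgue_on \<Omega>. \<forall>i j. G x $ i $ j - G' x $ i $ j = 0"
    by (simp add: AE_all_countable)
  then show ?thesis by eventually_elim (simp add: vec_eq_iff)
qed

lemma line_derivative:
  assumes "\<And>x. (f has_derivative (\<lambda>h. G x \<bullet> h)) (at x)"
  shows "((\<lambda>t. f (x + t *\<^sub>R y)) has_real_derivative (G (x + t *\<^sub>R y) \<bullet> y)) (at t)"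
proof -
  have "((\<lambda>t. x + t *\<^sub>R y) has_derivative (\<lambda>s. s *\<^sub>R y)) (at t)"
    by (auto intro!: derivative_eq_intros)
  from has_derivative_compose[OF this assms] show ?thesis
    unfolding has_field_derivative_def by (rule has_derivative_eq_rhs) (simp add: fun_eq_iff)
qed

lemma integrable_continuous_compact_support:
  fixes f :: "'a::euclidean_space \<Rightarrow> real"
  assumes "continuous_on UNIV f" "compact K" "\<And>x. x \<notin> K \<Longrightarrow> f x = 0"
  shows "integrable lborel f"
proof -
  have "integrable lborel (\<lambda>x. indicator K x *\<^sub>R f x)"
    using assms(2) continuous_on_subset[OF assms(1) subset_UNIV] by (rule borel_integrable_compact)
  moreover have "(\<lambda>x. indicator K x *\<^sub>R f x) = f"
    using assms(3) by (auto simp: indicator_def fun_eq_iff)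
  ultimately show ?thesis by (simp only:)
qed

lemma lborel_integral_translate:
  fixes f :: "'a::euclidean_space \<Rightarrow> real"
  assumes "f \<in> borel_measurable borel"
  shows "(LINT x|lborel. f (c + x)) = (LINT x|lborel. f x)"
proof -
  have "(LINT x|distr lborel borel ((+) c). f x) = (LINT x|lborel. f (c + x))"
    using assms by (intro integral_distr) simp_all
  then show ?thesis by (simp only: lborel_distr_plus)
qed

text \<open>Translation invariance makes the integral of every difference quotient vanish, and for a
  compactly supported function of class \<open>C\<^sup>1\<close> these converge dominatedly to the partial derivative.\<close>

lemma integral_gradient_compact_support:
  fixes f :: "real^'d \<Rightarrow> real"
  assumes f: "\<And>x. (f has_derivative (\<lambda>h. G x \<bullet> h)) (at x)" and G: "continuous_on UNIV G"
    and K: "compact K" "\<And>x. x \<notin> K \<Longrightarrow> f x = 0" "\<And>x. x \<notin> K \<Longrightarrow> G x = 0"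
  shows "(LINT x|lborel. G x \<bullet> e) = 0"
proof -
  have cf: "continuous_on UNIV f"
    by (intro continuous_at_imp_continuous_on ballI has_derivative_continuous[OF f])
  have mf: "f \<in> borel_measurable borel" by (rule borel_measurable_continuous_onI[OF cf])
  have intf: "integrable lborel f"
    by (rule integrable_continuous_compact_support[OF cf K(1,2)])
  have "bounded (G ` K)"
    using compact_continuous_image[OF continuous_on_subset[OF G subset_UNIV] K(1)] by (rule compact_imp_bounded)
  then obtain M0 where M0: "\<And>x. x \<in> K \<Longrightarrow> norm (G x) \<le> M0" by (auto simp: bounded_iff)
  define M where "M = \<bar>M0\<bar> * norm e"
  have M: "\<bar>G x \<bullet> e\<bar> \<le> M" for x
  proof (cases "x \<in> K")
    case True
    have "\<bar>G x \<bullet> e\<bar> \<le> norm (G x) * norm e" by (rule Cauchy_Schwarz_ineq2)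
    also have "\<dots> \<le> M" unfolding M_def using M0[OF True] by (intro mult_right_mono) auto
    finally show ?thesis .
  next
    case False then show ?thesis by (simp add: K M_def)
  qed
  obtain R where R: "\<And>x. x \<in> K \<Longrightarrow> norm x \<le> R"
    using compact_imp_bounded[OF K(1)] by (auto simp: bounded_iff)
  \<comment> \<open>The difference quotients of step \<open>1 / (n + 1)\<close>: by the mean value theorem they are bounded by \<open>M\<close>,
    and they vanish outside a ball whose radius exceeds that of the support by \<open>norm e\<close>.\<close>
  define D where "D n x = (f (inverse (real (Suc n)) *\<^sub>R e + x) - f x) * real (Suc n)" for n x
  have "(\<lambda>n. LINT x|lborel. D n x) \<longlonglongrightarrow> (LINT x|lborel. G x \<bullet> e)"
  proof (rule integral_dominated_convergence)
    show "(\<lambda>x. G x \<bullet> e) \<in> borel_measurable lborel"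
    proof -
      have "continuous_on UNIV (\<lambda>x. G x \<bullet> e)" by (intro continuous_intros G)
      from borel_measurable_continuous_onI[OF this] show ?thesis by simp
    qed
    show "D n \<in> borel_measurable lborel" for n
      unfolding D_def using mf by measurable
    show "integrable lborel (\<lambda>x. indicator (cball 0 (R + norm e)) x *\<^sub>R M)"
      by (rule borel_integrable_compact) auto
    show "AE x in lborel. (\<lambda>n. D n x) \<longlonglongrightarrow> G x \<bullet> e"
    proof (rule AE_I2)
      fix x
      have "((\<lambda>h. (f (x + h *\<^sub>R e) - f x) / h) \<longlongrightarrow> G x \<bullet> e) (at 0)"
        using line_derivative[OF f, of x e 0] by (simp add: DERIV_def)
      then have "(\<lambda>n. (f (x + inverse (real (Suc n)) *\<^sub>R e) - f x) / inverse (real (Suc n))) \<longlonglongrightarrow> G x \<bullet> e"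
      proof (rule filterlim_compose, intro filterlim_atI)
        show "(\<lambda>n. inverse (real (Suc n))) \<longlonglongrightarrow> 0" by (rule LIMSEQ_inverse_real_of_nat)
      qed simp
      then show "(\<lambda>n. D n x) \<longlonglongrightarrow> G x \<bullet> e"
        by (simp add: D_def divide_inverse add.commute)
    qed
    show "AE x in lborel. norm (D n x) \<le> indicator (cball 0 (R + norm e)) x *\<^sub>R M" for n
    proof (rule AE_I2)
      fix x
      define h where "h = inverse (real (Suc n))"
      have h: "0 < h" "h \<le> 1" by (auto simp: h_def field_simps)
      have "\<exists>t>0. t < h \<and> f (x + h *\<^sub>R e) - f (x + 0 *\<^sub>R e) = (h - 0) * (G (x + t *\<^sub>R e) \<bullet> e)"
        using MVT2[OF h(1), of "\<lambda>t. f (x + t *\<^sub>R e)" "\<lambda>t. G (x + t *\<^sub>R e) \<bullet> e"] line_derivative[OF f] by blast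
      then obtain t where t: "0 < t" "t < h" "f (x + h *\<^sub>R e) - f x = h * (G (x + t *\<^sub>R e) \<bullet> e)"
        by auto
      then have D: "D n x = G (x + t *\<^sub>R e) \<bullet> e"
        using h by (simp add: D_def h_def add.commute)
      show "norm (D n x) \<le> indicator (cball 0 (R + norm e)) x *\<^sub>R M"
      proof (cases "x \<in> cball 0 (R + norm e)")
        case True then show ?thesis using M D by simp
      next
        case False
        have "x + t *\<^sub>R e \<notin> K"
        proof
          assume "x + t *\<^sub>R e \<in> K"
          then have "norm (x + t *\<^sub>R e) \<le> R" by (rule R)
          moreover have "norm x \<le> norm (x + t *\<^sub>R e) + norm (t *\<^sub>R e)"
            by (metis add_diff_cancel_right' norm_triangle_ineq4)
          moreover have "norm (t *\<^sub>R e) \<le> norm e" using t h by (simp add: mult_left_le_one_le)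
          ultimately show False using False by simp
        qed
        then show ?thesis using D K(3) False by simp
      qed
    qed
  qed
  moreover have "(LINT x|lborel. D n x) = 0" for n
  proof -
    have "integrable lborel (\<lambda>x. f (inverse (real (Suc n)) *\<^sub>R e + x))"
      using integrable_distr_eq[of "(+) (inverse (real (Suc n)) *\<^sub>R e)" lborel borel f] mf intf
      by (simp add: lborel_distr_plus)
    then show ?thesis using intf
      by (simp add: D_def lborel_integral_translate[OF mf])
  qed
  ultimately show ?thesis by (simp add: LIMSEQ_const_iff)
qed

lemma integral_lebesgue_on_compact_support:
  fixes f :: "real^'d \<Rightarrow> real"
  assumes "open \<Omega>" "K \<subseteq> \<Omega>" "continuous_on UNIV f" "\<And>x. x \<notin> K \<Longrightarrow> f x = 0"
  shows "(LINT x|lebesgue_on \<Omega>. f x) = (LINT x|lborel. f x)"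
proof -
  have "(LINT x|lebesgue_on \<Omega>. f x) = (LINT x|lebesgue. indicator \<Omega> x *\<^sub>R f x)"
    using assms(1) by (simp add: integral_restrict_space)
  also have "(\<lambda>x. indicator \<Omega> x *\<^sub>R f x) = f"
    using assms(2,4) by (auto simp: fun_eq_iff indicator_def)
  also have "(LINT x|lebesgue. f x) = (LINT x|lborel. f x)"
    using borel_measurable_continuous_onI[OF assms(3)] by (intro integral_completion) simp
  finally show ?thesis .
qed

text \<open>The product of a smooth function and a test function has compact support, so its gradient
  integrates to zero.\<close>

lemma smooth_integration_by_parts:
  assumes \<Omega>: "open \<Omega>" and f: "Cinf f" and \<phi>: "\<phi> \<in> test_functions \<Omega>"
  shows "(LINT x|lebesgue_on \<Omega>. f x * partial_deriv j \<phi> x) = - (LINT x|lebesgue_on \<Omega>. grad f x $ j * \<phi> x)"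
proof -
  define K where "K = supp \<phi>"
  note K = test_function_support[OF \<phi>, folded K_def] outside_support[of _ \<phi>, folded K_def]
    partial_deriv_outside_support[of _ \<phi>, folded K_def]
  have \<phi>': "Cinf \<phi>" using \<phi> by (rule test_function_Cinf)
  note cont = Cinf_continuous[OF f] Cinf_continuous[OF \<phi>'] continuous_grad[OF f] continuous_grad[OF \<phi>']
  have gr: "partial_deriv j \<phi> x = grad \<phi> x $ j" for x by (simp add: grad_def)
  have g0: "grad \<phi> x = 0" if "x \<notin> K" for x using K(4)[OF that] by (simp add: grad_def vec_eq_iff)
  let ?G = "\<lambda>x. f x *\<^sub>R grad \<phi> x + \<phi> x *\<^sub>R grad f x"
  have "(LINT x|lborel. ?G x \<bullet> axis j 1) = 0"
  proof (rule integral_gradient_compact_support[OF _ _ K(1)])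
    show "((\<lambda>x. f x * \<phi> x) has_derivative (\<lambda>h. ?G x \<bullet> h)) (at x)" for x
      using has_derivative_mult[OF Cinf_grad[OF f] Cinf_grad[OF \<phi>']]
      by (rule has_derivative_eq_rhs) (auto simp: inner_add_left algebra_simps)
    show "continuous_on UNIV ?G" by (intro continuous_intros cont)
  qed (use K g0 in auto)
  moreover have "integrable lborel (\<lambda>x. f x * grad \<phi> x $ j)" "integrable lborel (\<lambda>x. grad f x $ j * \<phi> x)"
    using K(3) g0 by (auto intro!: integrable_continuous_compact_support[OF _ K(1)] continuous_intros cont)
  ultimately have "(LINT x|lborel. f x * grad \<phi> x $ j) + (LINT x|lborel. grad f x $ j * \<phi> x) = 0"
    by (simp add: inner_axis mult.commute)
  moreover have "(LINT x|lebesgue_on \<Omega>. f x * grad \<phi> x $ j) = (LINT x|lborel. f x * grad \<phi> x $ j)"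
    using g0 by (intro integral_lebesgue_on_compact_support[OF \<Omega> K(2)] continuous_intros cont) auto
  moreover have "(LINT x|lebesgue_on \<Omega>. grad f x $ j * \<phi> x) = (LINT x|lborel. grad f x $ j * \<phi> x)"
    using K(3) by (intro integral_lebesgue_on_compact_support[OF \<Omega> K(2)] continuous_intros cont) auto
  ultimately show ?thesis unfolding gr by linarith
qed

section \<open>Square integrable functions\<close>

definition L2 :: "'a measure \<Rightarrow> ('a \<Rightarrow> 'b::euclidean_space) \<Rightarrow> bool" where
  "L2 M f \<longleftrightarrow> f \<in> borel_measurable M \<and> integrable M (\<lambda>x. (norm (f x))\<^sup>2)"

definition nsq :: "'a measure \<Rightarrow> ('a \<Rightarrow> 'b::euclidean_space) \<Rightarrow> real" where
  "nsq M f = (LINT x|M. (norm (f x))\<^sup>2)"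

definition L2_lim :: "'a measure \<Rightarrow> (nat \<Rightarrow> 'a \<Rightarrow> 'b::euclidean_space) \<Rightarrow> ('a \<Rightarrow> 'b) \<Rightarrow> bool" where
  "L2_lim M f F \<longleftrightarrow> (\<forall>n. L2 M (f n)) \<and> L2 M F \<and> (\<lambda>n. nsq M (\<lambda>x. f n x - F x)) \<longlonglongrightarrow> 0"

definition L2_Cauchy :: "'a measure \<Rightarrow> (nat \<Rightarrow> 'a \<Rightarrow> 'b::euclidean_space) \<Rightarrow> bool" where
  "L2_Cauchy M f \<longleftrightarrow> (\<forall>e>0. \<exists>N. \<forall>m\<ge>N. \<forall>n\<ge>N. nsq M (\<lambda>x. f m x - f n x) < e)"

lemma norm_add_squared_le:
  fixes a b :: "'a::real_inner"
  shows "(norm (a + b))\<^sup>2 \<le> 2 * (norm a)\<^sup>2 + 2 * (norm b)\<^sup>2"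
  using zero_le_power2[of "norm (a - b)"]
  by (simp add: power2_norm_eq_inner algebra_simps inner_commute)

lemma L2_measurable: "L2 M f \<Longrightarrow> f \<in> borel_measurable M"
  by (simp add: L2_def)

lemma L2_integrable: "L2 M f \<Longrightarrow> integrable M (\<lambda>x. (norm (f x))\<^sup>2)"
  by (simp add: L2_def)

lemma L2_inner_integrable:
  assumes "L2 M f" "L2 M g" shows "integrable M (\<lambda>x. f x \<bullet> g x)"
proof (rule Bochner_Integration.integrable_bound)
  show "integrable M (\<lambda>x. (norm (f x))\<^sup>2 + (norm (g x))\<^sup>2)"
    using assms by (simp add: L2_def)
  show "(\<lambda>x. f x \<bullet> g x) \<in> borel_measurable M"
    by (intro borel_measurable_inner L2_measurable assms)
  show "AE x in M. norm (f x \<bullet> g x) \<le> norm ((norm (f x))\<^sup>2 + (norm (g x))\<^sup>2)"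
  proof (rule AE_I2)
    fix x
    have "\<bar>f x \<bullet> g x\<bar> \<le> norm (f x) * norm (g x)" by (rule Cauchy_Schwarz_ineq2)
    also have "\<dots> \<le> (norm (f x))\<^sup>2 + (norm (g x))\<^sup>2"
    proof -
      have "0 \<le> norm (f x) * norm (g x)" by simp
      then show ?thesis using sum_squares_bound[of "norm (f x)" "norm (g x)"] by linarith
    qed
    finally show "norm (f x \<bullet> g x) \<le> norm ((norm (f x))\<^sup>2 + (norm (g x))\<^sup>2)" by simp
  qed
qed

lemma L2_scaleR: "L2 M f \<Longrightarrow> L2 M (\<lambda>x. c *\<^sub>R f x)"
  unfolding L2_def
  by (intro conjI borel_measurable_scaleR) (simp_all add: power_mult_distrib)

lemma L2_add: assumes "L2 M f" "L2 M g" shows "L2 M (\<lambda>x. f x + g x)"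
  unfolding L2_def
proof
  show "(\<lambda>x. f x + g x) \<in> borel_measurable M" by (intro borel_measurable_add L2_measurable assms)
  have "integrable M (\<lambda>x. f x \<bullet> f x + 2 * (f x \<bullet> g x) + g x \<bullet> g x)"
    using assms by (intro Bochner_Integration.integrable_add integrable_mult_right L2_inner_integrable)
  then show "integrable M (\<lambda>x. (norm (f x + g x))\<^sup>2)"
    by (rule back_subst[of "integrable M"])
      (simp add: fun_eq_iff power2_norm_eq_inner inner_add_left inner_add_right inner_commute)
qed

lemma L2_diff: "L2 M f \<Longrightarrow> L2 M g \<Longrightarrow> L2 M (\<lambda>x. f x - g x)"
  using L2_add[of M f "\<lambda>x. (-1) *\<^sub>R g x", OF _ L2_scaleR] by simp

lemma nsq_nonneg [simp]: "0 \<le> nsq M f" by (simp add: nsq_def)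

lemma nsq_inner: "nsq M f = (LINT x|M. f x \<bullet> f x)"
  by (simp add: nsq_def power2_norm_eq_inner)

lemma nsq_add:
  assumes "L2 M f" "L2 M g"
  shows "nsq M (\<lambda>x. f x + g x) = nsq M f + 2 * (LINT x|M. f x \<bullet> g x) + nsq M g"
proof -
  have "nsq M (\<lambda>x. f x + g x) = (LINT x|M. f x \<bullet> f x + 2 * (f x \<bullet> g x) + g x \<bullet> g x)"
    unfolding nsq_inner
    by (simp add: inner_add_left inner_add_right inner_commute algebra_simps)
  then show ?thesis using L2_inner_integrable[OF assms] L2_inner_integrable[OF assms(1,1)]
      L2_inner_integrable[OF assms(2,2)] by (simp add: nsq_inner)
qed

lemma nsq_scaleR: "nsq M (\<lambda>x. c *\<^sub>R f x) = c\<^sup>2 * nsq M f"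
  by (simp add: nsq_def power_mult_distrib)

lemma nsq_add_le:
  assumes "L2 M f" "L2 M g" shows "nsq M (\<lambda>x. f x + g x) \<le> 2 * nsq M f + 2 * nsq M g"
proof -
  have "nsq M (\<lambda>x. f x + g x) \<le> (LINT x|M. 2 * (norm (f x))\<^sup>2 + 2 * (norm (g x))\<^sup>2)"
    unfolding nsq_def using assms L2_add[OF assms] norm_add_squared_le
    by (intro integral_mono) (auto simp: L2_def)
  then show ?thesis using assms by (simp add: nsq_def L2_def)
qed

lemma nsq_diff_commute: "nsq M (\<lambda>x. f x - g x) = nsq M (\<lambda>x. g x - f x)"
  by (simp add: nsq_def norm_minus_commute)

lemma nsq_diff_le:
  assumes "L2 M f" "L2 M g" shows "nsq M (\<lambda>x. f x - g x) \<le> 2 * nsq M f + 2 * nsq M g"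
  using nsq_add_le[OF assms(1) L2_scaleR[OF assms(2), of "-1"]] nsq_scaleR[of M "-1" g] by simp

lemma nsq_triangle:
  assumes "L2 M f" "L2 M g" "L2 M h"
  shows "nsq M (\<lambda>x. f x - h x) \<le> 2 * nsq M (\<lambda>x. f x - g x) + 2 * nsq M (\<lambda>x. g x - h x)"
  using nsq_add_le[OF L2_diff[OF assms(1,2)] L2_diff[OF assms(2,3)]] by simp

text \<open>Used twice: for the Cauchy--Schwarz inequality, and with \<open>a = 0\<close> to derive the Euler--Lagrange
  equation of the Rayleigh quotient, where it says that a linear term vanishes.\<close>

lemma quadratic_nonneg_discriminant:
  fixes a b c :: real
  assumes "\<And>t. 0 \<le> a + 2 * t * b + t\<^sup>2 * c"
  shows "b\<^sup>2 \<le> a * c"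
proof (cases "c = 0")
  case True
  have "b = 0"
  proof (rule ccontr)
    assume "b \<noteq> 0"
    then show False using assms[of "- (a + 1) / (2 * b)"] True by (simp add: field_simps)
  qed
  then show ?thesis using True by simp
next
  case False
  have "c \<ge> 0"
  proof (rule ccontr)
    assume c: "\<not> c \<ge> 0"
    \<comment> \<open>If \<open>c < 0\<close>, the quadratic is negative for this large \<open>t\<close>.\<close>
    define t where "t = (\<bar>a\<bar> + 2 * \<bar>b\<bar> + 1) / (- c) + 1"
    have "0 \<le> (\<bar>a\<bar> + 2 * \<bar>b\<bar> + 1) / (- c)" using c by (intro divide_nonneg_pos) auto
    then have t: "t \<ge> 1" unfolding t_def by simp
    have "t * (- c) \<ge> \<bar>a\<bar> + 2 * \<bar>b\<bar> + 1"
      using c by (simp add: t_def field_simps)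
    then have "t * (t * (- c)) \<ge> t * (\<bar>a\<bar> + 2 * \<bar>b\<bar> + 1)" using t by (intro mult_left_mono) auto
    moreover have "t * \<bar>a\<bar> \<ge> a" using t mult_right_mono[of 1 t "\<bar>a\<bar>"] by simp
    moreover have "t * \<bar>b\<bar> \<ge> t * b" using t by (intro mult_left_mono) auto
    moreover have "t * (\<bar>a\<bar> + 2 * \<bar>b\<bar> + 1) = t * \<bar>a\<bar> + 2 * (t * \<bar>b\<bar>) + t" by (simp add: algebra_simps)
    ultimately have "a + 2 * (t * b) - t * (t * (- c)) < 0" using t by linarith
    then have "a + 2 * t * b + t\<^sup>2 * c < 0" by (simp add: power2_eq_square algebra_simps)
    then show False using assms[of t] by simp
  qed
  then have "c > 0" using False by simp
  then show ?thesis using assms[of "- b / c"] by (simp add: field_simps power2_eq_square)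
qed

lemma integral_cauchy_schwarz:
  assumes "L2 M f" "L2 M g" shows "(LINT x|M. f x \<bullet> g x)\<^sup>2 \<le> nsq M f * nsq M g"
proof (rule quadratic_nonneg_discriminant)
  fix t :: real
  have "0 \<le> nsq M (\<lambda>x. f x + t *\<^sub>R g x)" by simp
  also have "\<dots> = nsq M f + 2 * t * (LINT x|M. f x \<bullet> g x) + t\<^sup>2 * nsq M g"
    using nsq_add[OF assms(1) L2_scaleR[OF assms(2)], of t] by (simp add: nsq_scaleR)
  finally show "0 \<le> nsq M f + 2 * t * (LINT x|M. f x \<bullet> g x) + t\<^sup>2 * nsq M g" .
qed

lemma nsq_eq_0: assumes "L2 M f" "nsq M f = 0" shows "AE x in M. f x = 0"
proof -
  have "AE x in M. (norm (f x))\<^sup>2 = 0"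
    using assms(2) L2_integrable[OF assms(1)] unfolding nsq_def
    by (subst (asm) integral_nonneg_eq_0_iff_AE) auto
  then show ?thesis by eventually_elim simp
qed

lemma nn_integral_powr_2:
  assumes "L2 M f" shows "(\<integral>\<^sup>+x. ennreal (norm (f x) powr 2) \<partial>M) = ennreal (nsq M f)"
proof -
  have "(\<integral>\<^sup>+x. ennreal (norm (f x) powr 2) \<partial>M) = (\<integral>\<^sup>+x. ennreal ((norm (f x))\<^sup>2) \<partial>M)"
    by (intro nn_integral_cong arg_cong[where f=ennreal] powr_numeral) simp
  also have "\<dots> = ennreal (nsq M f)"
    unfolding nsq_def using L2_integrable[OF assms] by (intro nn_integral_eq_integral) auto
  finally show ?thesis .
qed

lemma L2_limD: "L2_lim M f F \<Longrightarrow> L2 M (f n)" "L2_lim M f F \<Longrightarrow> L2 M F"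
    "L2_lim M f F \<Longrightarrow> (\<lambda>n. nsq M (\<lambda>x. f n x - F x)) \<longlonglongrightarrow> 0"
  by (auto simp: L2_lim_def)

lemma L2_lim_inner:
  assumes "L2_lim M f F" "L2 M h"
  shows "(\<lambda>n. LINT x|M. f n x \<bullet> h x) \<longlonglongrightarrow> (LINT x|M. F x \<bullet> h x)"
proof -
  have "(\<lambda>n. nsq M (\<lambda>x. f n x - F x) * nsq M h) \<longlonglongrightarrow> 0 * nsq M h"
    by (intro tendsto_intros L2_limD[OF assms(1)])
  then have "(\<lambda>n. (LINT x|M. (f n x - F x) \<bullet> h x)\<^sup>2) \<longlonglongrightarrow> 0"
    by (rule Lim_null_comparison[rotated, OF tendsto_eq_rhs])
      (auto intro!: always_eventually integral_cauchy_schwarz L2_diff L2_limD[OF assms(1)] assms(2))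
  then have "(\<lambda>n. sqrt ((LINT x|M. (f n x - F x) \<bullet> h x)\<^sup>2)) \<longlonglongrightarrow> sqrt 0"
    by (rule tendsto_real_sqrt)
  then have "(\<lambda>n. LINT x|M. (f n x - F x) \<bullet> h x) \<longlonglongrightarrow> 0"
    by (simp add: tendsto_rabs_zero_iff)
  moreover have "(LINT x|M. (f n x - F x) \<bullet> h x) = (LINT x|M. f n x \<bullet> h x) - (LINT x|M. F x \<bullet> h x)" for n
    using L2_inner_integrable[OF L2_limD(1)[OF assms(1)] assms(2)] L2_inner_integrable[OF L2_limD(2)[OF assms(1)] assms(2)]
    by (simp add: inner_diff_left)
  ultimately show ?thesis by (simp add: LIM_zero_iff)
qed

lemma L2_lim_nsq:
  assumes "L2_lim M f F" shows "(\<lambda>n. nsq M (f n)) \<longlonglongrightarrow> nsq M F"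
proof -
  have "nsq M (f n) = nsq M (\<lambda>x. f n x - F x) + 2 * (LINT x|M. f n x \<bullet> F x) - nsq M F" for n
    using nsq_add[OF L2_limD(1)[OF assms, of n] L2_scaleR[OF L2_limD(2)[OF assms], of "-1"]]
      nsq_scaleR[of M "-1" F] by simp
  moreover have "(\<lambda>n. nsq M (\<lambda>x. f n x - F x) + 2 * (LINT x|M. f n x \<bullet> F x) - nsq M F)
      \<longlonglongrightarrow> 0 + 2 * (LINT x|M. F x \<bullet> F x) - nsq M F"
    by (intro tendsto_intros L2_limD[OF assms] L2_lim_inner[OF assms])
  ultimately show ?thesis by (simp add: nsq_inner[of M F])
qed

lemma L2_lim_add:
  assumes "L2_lim M f F" "L2_lim M g G"
  shows "L2_lim M (\<lambda>n x. f n x + g n x) (\<lambda>x. F x + G x)"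
proof -
  have "(\<lambda>n. 2 * nsq M (\<lambda>x. f n x - F x) + 2 * nsq M (\<lambda>x. g n x - G x)) \<longlonglongrightarrow> 2 * 0 + 2 * 0"
    by (intro tendsto_intros L2_limD[OF assms(1)] L2_limD[OF assms(2)])
  then have T: "(\<lambda>n. 2 * nsq M (\<lambda>x. f n x - F x) + 2 * nsq M (\<lambda>x. g n x - G x)) \<longlonglongrightarrow> 0" by simp
  have B: "nsq M (\<lambda>x. (f n x + g n x) - (F x + G x)) \<le> 2 * nsq M (\<lambda>x. f n x - F x) + 2 * nsq M (\<lambda>x. g n x - G x)" for n
    using nsq_add_le[OF L2_diff[OF L2_limD(1,2)[OF assms(1)], of n] L2_diff[OF L2_limD(1,2)[OF assms(2)], of n]]
    by (simp add: algebra_simps)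
  have "(\<lambda>n. nsq M (\<lambda>x. (f n x + g n x) - (F x + G x))) \<longlonglongrightarrow> 0"
    by (rule tendsto_sandwich[OF _ _ tendsto_const T]) (simp_all add: B)
  then show ?thesis using assms by (simp add: L2_lim_def L2_add)
qed

lemma L2_lim_scaleR:
  assumes "L2_lim M f F" shows "L2_lim M (\<lambda>n x. c *\<^sub>R f n x) (\<lambda>x. c *\<^sub>R F x)"
proof -
  have "(\<lambda>n. c\<^sup>2 * nsq M (\<lambda>x. f n x - F x)) \<longlonglongrightarrow> c\<^sup>2 * 0"
    by (intro tendsto_intros L2_limD[OF assms(1)])
  moreover have "nsq M (\<lambda>x. c *\<^sub>R f n x - c *\<^sub>R F x) = c\<^sup>2 * nsq M (\<lambda>x. f n x - F x)" for n
    by (simp only: scaleR_diff_right[symmetric] nsq_scaleR)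
  ultimately show ?thesis using assms by (simp add: L2_lim_def L2_scaleR)
qed

text \<open>From \<open>2 r \<le> c r\<^sup>2 + 1 / c\<close>.  The parameter \<open>c\<close> is what allows a geometric choice in the
  completeness proof below.\<close>

lemma integrable_norm_L2:
  assumes "finite_measure M" "L2 M f" "c > 0"
  shows "integrable M (\<lambda>x. norm (f x))" (is ?A)
    and "2 * (LINT x|M. norm (f x)) \<le> c * nsq M f + measure M (space M) / c" (is ?B)
proof -
  interpret finite_measure M by fact
  have *: "2 * norm (f x) \<le> c * (norm (f x))\<^sup>2 + 1 / c" for x
  proof -
    have "0 \<le> (c * norm (f x) - 1)\<^sup>2 / c" using assms by simp
    then show ?thesis using assms(3) by (simp add: power2_eq_square field_simps)
  qed
  have I: "integrable M (\<lambda>x. c * (norm (f x))\<^sup>2 + 1 / c)" using assms(2) by (simp add: L2_def)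
  show ?A
    by (rule Bochner_Integration.integrable_bound[OF I]) (use assms(2) * in \<open>auto simp: L2_def intro!: AE_I2 order_trans[OF _ abs_ge_self] order_trans[OF _ *]\<close>)
  then have "(LINT x|M. 2 * norm (f x)) \<le> (LINT x|M. c * (norm (f x))\<^sup>2 + 1 / c)"
    using I * by (intro integral_mono) auto
  then show ?B using assms(2) by (simp add: L2_def nsq_def)
qed

text \<open>The Riesz--Fischer argument.  Along a subsequence with squared distances below \<open>4\<^sup>-\<^sup>k\<close> the
  increments are summable in \<open>L\<^sup>1\<close>, hence almost everywhere, which gives a pointwise limit; Fatou's
  lemma shows that it is a limit in \<open>L\<^sup>2\<close> of the whole sequence.\<close>

lemma L2_complete:
  fixes f :: "nat \<Rightarrow> 'a \<Rightarrow> 'b::euclidean_space"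
  assumes fin: "finite_measure M" and f: "\<And>n. L2 M (f n)"
    and Cauchy: "L2_Cauchy M f"
  shows "\<exists>F. L2_lim M f F"
proof -
  interpret finite_measure M by fact
  note f_meas[measurable] = f[THEN L2_measurable]
  have "\<forall>k. \<exists>N. \<forall>m\<ge>N. \<forall>n\<ge>N. nsq M (\<lambda>x. f m x - f n x) < (1/4) ^ k"
    using Cauchy unfolding L2_Cauchy_def by simp
  then obtain N where N: "\<And>k m n. m \<ge> N k \<Longrightarrow> n \<ge> N k \<Longrightarrow> nsq M (\<lambda>x. f m x - f n x) < (1/4) ^ k"
    by (auto dest!: choice)
  define r where "r k = (\<Sum>i\<le>k. N i) + k" for k
  have rN: "r k \<ge> N k" for k unfolding r_def by (rule trans_le_add1) (rule member_le_sum, auto)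
  have r_mono: "strict_mono r" by (simp add: strict_mono_Suc_iff r_def)
  have step: "nsq M (\<lambda>x. f (r (Suc k)) x - f (r k) x) < (1/4) ^ k" for k
    using N[of k "r (Suc k)" "r k"] rN[of k] strict_mono_less_eq[OF r_mono, of k "Suc k"] by simp
  define d where "d k x = norm (f (r (Suc k)) x - f (r k) x)" for k x
  have d: "integrable M (d k)" "(LINT x|M. d k x) \<le> (1/2) ^ k * ((1 + measure M (space M)) / 2)" for k
  proof -
    \<comment> \<open>The choice \<open>c = 2\<^sup>k\<close> balances \<open>2\<^sup>k 4\<^sup>-\<^sup>k\<close> against \<open>2\<^sup>-\<^sup>k\<close>.\<close>
    note * = integrable_norm_L2[OF fin L2_diff[OF f f], of "2 ^ k" "r (Suc k)" "r k"]
    show "integrable M (d k)" unfolding d_def using * by simp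
    have "2 * (LINT x|M. d k x) \<le> 2 ^ k * (1/4) ^ k + measure M (space M) / 2 ^ k"
    proof -
      have "2 ^ k * nsq M (\<lambda>x. f (r (Suc k)) x - f (r k) x) \<le> 2 ^ k * (1/4) ^ k"
        by (intro mult_left_mono less_imp_le[OF step]) simp
      moreover have "0 < (2::real) ^ k" by simp
      ultimately show ?thesis using *(2) unfolding d_def by linarith
    qed
    also have "2 ^ k * (1/4) ^ k = (1/2::real) ^ k" by (simp add: power_mult_distrib[symmetric])
    finally show "(LINT x|M. d k x) \<le> (1/2) ^ k * ((1 + measure M (space M)) / 2)"
      by (simp add: field_simps power_one_over)
  qed
  have d_nn: "0 \<le> d k x" for k x by (simp add: d_def)
  have [measurable]: "d k \<in> borel_measurable M" for k unfolding d_def by measurable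
  have sumI: "summable (\<lambda>k. LINT x|M. d k x)"
  proof (rule summable_comparison_test')
    show "summable (\<lambda>k. (1/2::real) ^ k * ((1 + measure M (space M)) / 2))"
      by (intro summable_mult2 summable_geometric) simp
    show "norm (LINT x|M. d k x) \<le> (1/2) ^ k * ((1 + measure M (space M)) / 2)" if "k \<ge> 0" for k
    proof -
      have "0 \<le> (LINT x|M. d k x)" by (intro integral_nonneg_AE AE_I2 d_nn)
      then show ?thesis using d(2)[of k] by simp
    qed
  qed
  have "(\<integral>\<^sup>+x. (\<Sum>k. ennreal (d k x)) \<partial>M) = (\<Sum>k. ennreal (LINT x|M. d k x))"
    using d_nn d(1) by (subst nn_integral_suminf) (auto simp: nn_integral_eq_integral)
  also have "\<dots> = ennreal (\<Sum>k. LINT x|M. d k x)"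
    using sumI d_nn by (intro suminf_ennreal2) (auto intro: integral_nonneg_AE)
  finally have "(\<integral>\<^sup>+x. (\<Sum>k. ennreal (d k x)) \<partial>M) \<noteq> \<infinity>" by simp
  then have "AE x in M. (\<Sum>k. ennreal (d k x)) \<noteq> \<infinity>"
    by (intro nn_integral_PInf_AE) auto
  then have conv: "AE x in M. (\<lambda>k. f (r k) x) \<longlonglongrightarrow> lim (\<lambda>k. f (r k) x)"
  proof eventually_elim
    case (elim x)
    then have "summable (\<lambda>k. d k x)" using d_nn by (intro summable_suminf_not_top) auto
    then have "summable (\<lambda>k. f (r (Suc k)) x - f (r k) x)" unfolding d_def by (rule summable_norm_cancel)
    then have "convergent (\<lambda>n. \<Sum>k<n. f (r (Suc k)) x - f (r k) x)" by (simp add: summable_iff_convergent)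
    then have "convergent (\<lambda>n. f (r n) x - f (r 0) x)" by (simp only: sum_lessThan_telescope[of "\<lambda>k. f (r k) x"])
    then have "convergent (\<lambda>n. (f (r n) x - f (r 0) x) + f (r 0) x)" by (intro convergent_add convergent_const)
    then show ?case by (simp add: convergent_LIMSEQ_iff)
  qed
  define F where "F x = lim (\<lambda>k. f (r k) x)" for x
  have F_meas[measurable]: "F \<in> borel_measurable M" unfolding F_def by (rule borel_measurable_lim_metric) measurable
  have fatou: "(\<integral>\<^sup>+x. ennreal ((norm (f m x - F x))\<^sup>2) \<partial>M) \<le> ennreal ((1/4) ^ K)" if "m \<ge> N K" for m K
  proof -
    have "(\<integral>\<^sup>+x. ennreal ((norm (f m x - F x))\<^sup>2) \<partial>M) = (\<integral>\<^sup>+x. liminf (\<lambda>k. ennreal ((norm (f m x - f (r k) x))\<^sup>2)) \<partial>M)"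
    proof (rule nn_integral_cong_AE)
      show "AE x in M. ennreal ((norm (f m x - F x))\<^sup>2) = liminf (\<lambda>k. ennreal ((norm (f m x - f (r k) x))\<^sup>2))"
        using conv
      proof eventually_elim
        case (elim x)
        have "(\<lambda>k. ennreal ((norm (f m x - f (r k) x))\<^sup>2)) \<longlonglongrightarrow> ennreal ((norm (f m x - F x))\<^sup>2)"
          unfolding F_def by (intro tendsto_intros elim)
        then show ?case by (metis lim_imp_Liminf trivial_limit_sequentially)
      qed
    qed
    also have "\<dots> \<le> liminf (\<lambda>k. \<integral>\<^sup>+x. ennreal ((norm (f m x - f (r k) x))\<^sup>2) \<partial>M)"
      by (rule nn_integral_liminf) measurable
    also have "\<dots> \<le> ennreal ((1/4) ^ K)"
    proof (rule Liminf_le)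
      show "\<forall>\<^sub>F k in sequentially. (\<integral>\<^sup>+x. ennreal ((norm (f m x - f (r k) x))\<^sup>2) \<partial>M) \<le> ennreal ((1/4) ^ K)"
      proof (rule eventually_sequentiallyI[of "N K"])
        fix k assume "k \<ge> N K"
        then have "r k \<ge> N K" using seq_suble[OF r_mono, of k] by simp
        then have "nsq M (\<lambda>x. f m x - f (r k) x) \<le> (1/4) ^ K" using N[OF that] by (simp add: less_imp_le)
        then show "(\<integral>\<^sup>+x. ennreal ((norm (f m x - f (r k) x))\<^sup>2) \<partial>M) \<le> ennreal ((1/4) ^ K)"
          using L2_integrable[OF L2_diff[OF f f], of m "r k"]
          by (subst nn_integral_eq_integral) (auto simp: nsq_def ennreal_leI)
      qed
    qed simp
    finally show ?thesis .
  qed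
  have L2d: "L2 M (\<lambda>x. f (N 0) x - F x)"
    unfolding L2_def
  proof
    show "integrable M (\<lambda>x. (norm (f (N 0) x - F x))\<^sup>2)"
      using fatou[of 0 "N 0"] by (intro integrableI_nonneg) (auto simp: less_top[symmetric] top_unique)
  qed measurable
  have L2F: "L2 M F" using L2_diff[OF f[of "N 0"] L2d] by simp
  have "(\<lambda>n. nsq M (\<lambda>x. f n x - F x)) \<longlonglongrightarrow> 0"
  proof (rule LIMSEQ_I)
    fix e :: real assume "e > 0"
    then obtain K where K: "(1/4) ^ K < e" using real_arch_pow_inv[of e "1/4"] by auto
    have "norm (nsq M (\<lambda>x. f n x - F x) - 0) < e" if "n \<ge> N K" for n
    proof -
      have "ennreal (nsq M (\<lambda>x. f n x - F x)) \<le> ennreal ((1/4) ^ K)"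
        using fatou[OF that] L2_integrable[OF L2_diff[OF f L2F]]
        by (subst (asm) nn_integral_eq_integral) (auto simp: nsq_def)
      then have "nsq M (\<lambda>x. f n x - F x) \<le> (1/4) ^ K" by (subst (asm) ennreal_le_iff) auto
      then show ?thesis using K by simp
    qed
    then show "\<exists>no. \<forall>n\<ge>no. norm (nsq M (\<lambda>x. f n x - F x) - 0) < e" by blast
  qed
  then have "L2_lim M f F" using f L2F by (simp add: L2_lim_def)
  then show ?thesis by blast
qed

section \<open>Translation estimates\<close>

text \<open>Integrals over subsets are taken with values in \<open>[0, \<infinity>]\<close>, which makes Tonelli's theorem and
  translations available without integrability side conditions.\<close>

definition nnint :: "'a::euclidean_space set \<Rightarrow> ('a \<Rightarrow> real) \<Rightarrow> ennreal" where
  "nnint A h = (\<integral>\<^sup>+x. ennreal (h x) * indicator A x \<partial>lborel)"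

lemma finite_measure_lebesgue_on_bounded:
  "open \<Omega> \<Longrightarrow> bounded \<Omega> \<Longrightarrow> finite_measure (lebesgue_on (\<Omega>::'a::euclidean_space set))"
  by (intro finite_measure_lebesgue_on bounded_set_imp_lmeasurable) auto

lemma continuous_measurable_lebesgue_on:
  fixes f :: "'a::euclidean_space \<Rightarrow> 'b::euclidean_space"
  shows "continuous_on UNIV f \<Longrightarrow> f \<in> borel_measurable (lebesgue_on S)"
  by (intro measurable_restrict_space1 continuous_measurable_lebesgue)

lemma continuous_bounded_on_bounded:
  fixes f :: "'a::euclidean_space \<Rightarrow> 'b::euclidean_space"
  assumes "continuous_on UNIV f" "bounded \<Omega>"
  obtains B where "\<And>x. x \<in> \<Omega> \<Longrightarrow> norm (f x) \<le> B"
proof -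
  have "compact (closure \<Omega>)" using assms(2) by simp
  then have "bounded (f ` closure \<Omega>)"
    using compact_continuous_image[OF continuous_on_subset[OF assms(1) subset_UNIV]] compact_imp_bounded by blast
  then obtain B where "\<And>x. x \<in> closure \<Omega> \<Longrightarrow> norm (f x) \<le> B" by (auto simp: bounded_iff)
  then have "\<And>x. x \<in> \<Omega> \<Longrightarrow> norm (f x) \<le> B" using closure_subset[of \<Omega>] by (simp add: subset_eq)
  then show ?thesis by (rule that)
qed

lemma continuous_L2:
  fixes f :: "'a::euclidean_space \<Rightarrow> 'b::euclidean_space"
  assumes "continuous_on UNIV f" "open \<Omega>" "bounded \<Omega>"
  shows "L2 (lebesgue_on \<Omega>) f"
proof -
  interpret finite_measure "lebesgue_on \<Omega>" using assms by (intro finite_measure_lebesgue_on_bounded)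
  obtain B where B: "\<And>x. x \<in> \<Omega> \<Longrightarrow> norm (f x) \<le> B" 
    using continuous_bounded_on_bounded[OF assms(1,3)] by blast
  have "continuous_on UNIV (\<lambda>x. (norm (f x))\<^sup>2)" by (intro continuous_intros assms)
  then have "integrable (lebesgue_on \<Omega>) (\<lambda>x. (norm (f x))\<^sup>2)"
    using B by (intro integrable_const_bound[where B="B\<^sup>2"] AE_I2 continuous_measurable_lebesgue_on)
      (auto intro: power_mono)
  then show ?thesis using continuous_measurable_lebesgue_on[OF assms(1)] by (simp add: L2_def)
qed

lemma ennreal_nsq_eq_nnint:
  fixes f :: "'a::euclidean_space \<Rightarrow> 'b::euclidean_space"
  assumes f: "continuous_on UNIV f" and \<Omega>: "open \<Omega>" "bounded \<Omega>"
  shows "ennreal (nsq (lebesgue_on \<Omega>) f) = nnint \<Omega> (\<lambda>x. (norm (f x))\<^sup>2)"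
proof -
  have "ennreal (nsq (lebesgue_on \<Omega>) f) = (\<integral>\<^sup>+x. ennreal ((norm (f x))\<^sup>2) \<partial>lebesgue_on \<Omega>)"
    unfolding nsq_def using L2_integrable[OF continuous_L2[OF assms]]
    by (intro nn_integral_eq_integral[symmetric]) auto
  also have "\<dots> = (\<integral>\<^sup>+x. ennreal ((norm (f x))\<^sup>2) * indicator \<Omega> x \<partial>lebesgue)"
    using \<Omega> by (intro nn_integral_restrict_space) simp
  also have "\<dots> = nnint \<Omega> (\<lambda>x. (norm (f x))\<^sup>2)"
    unfolding nnint_def by (rule nn_integral_completion)
  finally show ?thesis .
qed

lemma nn_integral_lborel_translate:
  fixes h :: "'a::euclidean_space \<Rightarrow> ennreal"
  assumes "h \<in> borel_measurable borel"
  shows "(\<integral>\<^sup>+x. h (c + x) \<partial>lborel) = (\<integral>\<^sup>+x. h x \<partial>lborel)"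
proof -
  have "(\<integral>\<^sup>+x. h x \<partial>distr lborel borel ((+) c)) = (\<integral>\<^sup>+x. h (c + x) \<partial>lborel)"
    using assms by (intro nn_integral_distr) simp_all
  then show ?thesis by (simp only: lborel_distr_plus)
qed

lemma nnint_translate_le:
  fixes h :: "'a::euclidean_space \<Rightarrow> real"
  assumes [measurable]: "h \<in> borel_measurable borel" "B \<in> sets borel" and "\<And>x. x \<in> A \<Longrightarrow> x + c \<in> B"
  shows "nnint A (\<lambda>x. h (x + c)) \<le> nnint B h"
proof -
  have "nnint A (\<lambda>x. h (x + c)) \<le> (\<integral>\<^sup>+x. ennreal (h (c + x)) * indicator B (c + x) \<partial>lborel)"
    unfolding nnint_def using assms(3) by (intro nn_integral_mono) (auto simp: indicator_def add.commute)
  also have "\<dots> = nnint B h"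
    unfolding nnint_def by (rule nn_integral_lborel_translate) measurable
  finally show ?thesis .
qed

text \<open>Cauchy--Schwarz on the unit interval after the fundamental theorem of calculus.\<close>

lemma square_increment_le:
  fixes g :: "real \<Rightarrow> real"
  assumes g: "\<And>t. (g has_real_derivative g' t) (at t)" and g': "continuous_on UNIV g'"
  shows "ennreal ((g 1 - g 0)\<^sup>2) \<le> (\<integral>\<^sup>+s. ennreal ((g' s)\<^sup>2) * indicator {0..1} s \<partial>lborel)"
proof -
  let ?M = "restrict_space lborel {0..1::real}"
  have sp: "{0..1} \<inter> space lborel \<in> sets (lborel :: real measure)" by simp
  have c: "continuous_on {0..1} g'" using g' continuous_on_subset by blast
  have i1: "integrable ?M g'"
    using borel_integrable_compact[OF _ c] by (simp add: integrable_restrict_space)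
  have i2: "integrable ?M (\<lambda>s. (g' s)\<^sup>2)"
    using borel_integrable_compact[OF _ continuous_on_power[OF c]] by (simp add: integrable_restrict_space)
  have i3: "integrable ?M (\<lambda>s. (1::real)\<^sup>2)"
    using borel_integrable_compact[of "{0..1::real}" "\<lambda>_. (1::real)\<^sup>2"] by (simp add: integrable_restrict_space)
  have L: "L2 ?M g'" "L2 ?M (\<lambda>s. 1::real)"
    using i1 i2 i3 by (auto simp: L2_def)
  have "(LINT s|?M. g' s) = (LINT s|lborel. indicator {0..1} s *\<^sub>R g' s)"
    by (simp add: integral_restrict_space)
  also have "\<dots> = g 1 - g 0"
    using integral_FTC_Icc_real[of 0 1 g g'] g c
    by (simp add: mult.commute continuous_on_eq_continuous_within g'[unfolded continuous_on_eq_continuous_at[OF open_UNIV]])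
  finally have "(g 1 - g 0)\<^sup>2 \<le> nsq ?M (\<lambda>s. 1::real) * nsq ?M g'"
    using integral_cauchy_schwarz[OF L(2,1)] by simp
  moreover have "nsq ?M (\<lambda>s. 1::real) = 1"
    by (simp add: nsq_def measure_restrict_space)
  ultimately have "ennreal ((g 1 - g 0)\<^sup>2) \<le> ennreal (nsq ?M g')" by (simp add: ennreal_leI)
  also have "\<dots> = (\<integral>\<^sup>+s. ennreal ((g' s)\<^sup>2) \<partial>?M)"
    using i2 unfolding nsq_def by (simp add: nn_integral_eq_integral)
  also have "\<dots> = (\<integral>\<^sup>+s. ennreal ((g' s)\<^sup>2) * indicator {0..1} s \<partial>lborel)"
    by (rule nn_integral_restrict_space[OF sp])
  finally show ?thesis .
qed

text \<open>The fundamental theorem of calculus along the segments in direction \<open>y\<close>, averaged over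
  the base points.\<close>

lemma translation_estimate:
  fixes f :: "real^'d \<Rightarrow> real"
  assumes f: "Cinf f" and [measurable]: "V \<in> sets borel" "\<Omega> \<in> sets borel"
    and seg: "\<And>x s. x \<in> V \<Longrightarrow> 0 \<le> s \<Longrightarrow> s \<le> 1 \<Longrightarrow> x + s *\<^sub>R y \<in> \<Omega>"
  shows "nnint V (\<lambda>x. (f (x + y) - f x)\<^sup>2) \<le> ennreal ((norm y)\<^sup>2) * nnint \<Omega> (\<lambda>x. (norm (grad f x))\<^sup>2)"
proof -
  have cg: "continuous_on UNIV (grad f)" by (rule continuous_grad[OF f])
  have [measurable]: "grad f \<in> borel_measurable borel" by (rule borel_measurable_continuous_onI[OF cg])
  let ?G = "\<lambda>x. ennreal ((norm y)\<^sup>2 * (norm (grad f x))\<^sup>2)"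
  have pt: "ennreal ((f (x + y) - f x)\<^sup>2) \<le> (\<integral>\<^sup>+s. ?G (x + s *\<^sub>R y) * indicator {0..1} s \<partial>lborel)" for x
  proof -
    have "ennreal ((f (x + 1 *\<^sub>R y) - f (x + 0 *\<^sub>R y))\<^sup>2)
        \<le> (\<integral>\<^sup>+s. ennreal ((grad f (x + s *\<^sub>R y) \<bullet> y)\<^sup>2) * indicator {0..1} s \<partial>lborel)"
      by (rule square_increment_le[OF line_derivative[OF Cinf_grad[OF f]]])
        (intro continuous_intros continuous_on_compose2[OF cg], auto)
    also have "\<dots> \<le> (\<integral>\<^sup>+s. ?G (x + s *\<^sub>R y) * indicator {0..1} s \<partial>lborel)"
    proof (intro nn_integral_mono mult_right_mono ennreal_leI)
      fix s
      have "\<bar>grad f (x + s *\<^sub>R y) \<bullet> y\<bar>\<^sup>2 \<le> (norm (grad f (x + s *\<^sub>R y)) * norm y)\<^sup>2"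
        by (intro power_mono Cauchy_Schwarz_ineq2) simp
      then show "(grad f (x + s *\<^sub>R y) \<bullet> y)\<^sup>2 \<le> (norm y)\<^sup>2 * (norm (grad f (x + s *\<^sub>R y)))\<^sup>2"
        by (simp add: power_mult_distrib mult.commute)
    qed simp
    finally show ?thesis by simp
  qed
  have "nnint V (\<lambda>x. (f (x + y) - f x)\<^sup>2)
      \<le> (\<integral>\<^sup>+x. (\<integral>\<^sup>+s. ?G (x + s *\<^sub>R y) * indicator {0..1} s * indicator V x \<partial>lborel) \<partial>lborel)"
    unfolding nnint_def
    by (intro nn_integral_mono) (auto simp: nn_integral_multc intro!: mult_right_mono pt)
  also have "\<dots> = (\<integral>\<^sup>+s. (\<integral>\<^sup>+x. ?G (x + s *\<^sub>R y) * indicator {0..1} s * indicator V x \<partial>lborel) \<partial>lborel)"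
    by (rule lborel_pair.Fubini'[symmetric]) measurable
  also have "\<dots> \<le> (\<integral>\<^sup>+s. (\<integral>\<^sup>+x. ?G x * indicator \<Omega> x \<partial>lborel) * indicator {0..1::real} s \<partial>lborel)"
  proof (rule nn_integral_mono)
    fix s :: real
    show "(\<integral>\<^sup>+x. ?G (x + s *\<^sub>R y) * indicator {0..1} s * indicator V x \<partial>lborel)
        \<le> (\<integral>\<^sup>+x. ?G x * indicator \<Omega> x \<partial>lborel) * indicator {0..1} s"
    proof (cases "s \<in> {0..1}")
      case True
      have "(\<integral>\<^sup>+x. ?G (x + s *\<^sub>R y) * indicator V x \<partial>lborel) \<le> (\<integral>\<^sup>+x. ?G x * indicator \<Omega> x \<partial>lborel)"
        using nnint_translate_le[of "\<lambda>x. (norm y)\<^sup>2 * (norm (grad f x))\<^sup>2" \<Omega> V "s *\<^sub>R y"] seg True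
        unfolding nnint_def by auto
      then show ?thesis using True by simp
    qed simp
  qed
  also have "\<dots> = (\<integral>\<^sup>+x. ?G x * indicator \<Omega> x \<partial>lborel)"
    by (subst nn_integral_cmult) auto
  also have "\<dots> = ennreal ((norm y)\<^sup>2) * nnint \<Omega> (\<lambda>x. (norm (grad f x))\<^sup>2)"
    unfolding nnint_def by (subst nn_integral_cmult[symmetric]) (auto simp: ennreal_mult mult.assoc)
  finally show ?thesis .
qed

lemma square_le_shift:
  fixes a b :: real shows "a\<^sup>2 \<le> 2 * b\<^sup>2 + 2 * (b - a)\<^sup>2"
  using zero_le_power2[of "2 * b - a"] by (simp add: power2_eq_square algebra_simps)

lemma nnint_shift_estimate:
  fixes f :: "real^'d \<Rightarrow> real"
  assumes f: "Cinf f" and [measurable]: "V \<in> sets borel" "\<Omega> \<in> sets borel" "K \<in> sets borel"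
    and seg: "\<And>x s. x \<in> V \<Longrightarrow> 0 \<le> s \<Longrightarrow> s \<le> 1 \<Longrightarrow> x + s *\<^sub>R y \<in> \<Omega>"
    and K: "\<And>x. x \<in> V \<Longrightarrow> x + y \<in> K"
  shows "nnint V (\<lambda>x. (f x)\<^sup>2) \<le> 2 * nnint K (\<lambda>x. (f x)\<^sup>2)
      + 2 * (ennreal ((norm y)\<^sup>2) * nnint \<Omega> (\<lambda>x. (norm (grad f x))\<^sup>2))"
proof -
  have [measurable]: "f \<in> borel_measurable borel" by (rule borel_measurable_continuous_onI[OF Cinf_continuous[OF f]])
  have "nnint V (\<lambda>x. (f x)\<^sup>2) \<le> (\<integral>\<^sup>+x. 2 * (ennreal ((f (x + y))\<^sup>2) * indicator V x)
      + 2 * (ennreal ((f (x + y) - f x)\<^sup>2) * indicator V x) \<partial>lborel)"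
    unfolding nnint_def
  proof (rule nn_integral_mono)
    fix x
    have "ennreal ((f x)\<^sup>2) \<le> ennreal (2 * (f (x + y))\<^sup>2 + 2 * (f (x + y) - f x)\<^sup>2)"
      by (intro ennreal_leI square_le_shift)
    also have "\<dots> = 2 * ennreal ((f (x + y))\<^sup>2) + 2 * ennreal ((f (x + y) - f x)\<^sup>2)"
      by (simp add: ennreal_plus ennreal_mult)
    finally show "ennreal ((f x)\<^sup>2) * indicator V x \<le> 2 * (ennreal ((f (x + y))\<^sup>2) * indicator V x)
      + 2 * (ennreal ((f (x + y) - f x)\<^sup>2) * indicator V x)"
      by (auto simp: indicator_def)
  qed
  also have "\<dots> = 2 * nnint V (\<lambda>x. (f (x + y))\<^sup>2) + 2 * nnint V (\<lambda>x. (f (x + y) - f x)\<^sup>2)"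
    unfolding nnint_def by (subst nn_integral_add) (auto simp: nn_integral_cmult)
  also have "\<dots> \<le> 2 * nnint K (\<lambda>x. (f x)\<^sup>2)
      + 2 * (ennreal ((norm y)\<^sup>2) * nnint \<Omega> (\<lambda>x. (norm (grad f x))\<^sup>2))"
    using K by (intro add_mono mult_left_mono translation_estimate[OF f] nnint_translate_le seg) auto
  finally show ?thesis .
qed

text \<open>Shifting the part of the domain in \<open>ball x (r / 2)\<close> by a small multiple of \<open>n\<close> leads into a compact
  subset, along segments that stay in the domain.  These two properties are all that is needed of
  a Lipschitz boundary for compactness.\<close>

definition inward_patch :: "'a::euclidean_space set \<Rightarrow> 'a \<Rightarrow> real \<Rightarrow> 'a \<Rightarrow> bool" where
  "inward_patch \<Omega> x r n \<longleftrightarrow> r > 0 \<and> norm n = 1 \<and>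
    (\<forall>t. 0 < t \<longrightarrow> t < r / 2 \<longrightarrow>
      (\<exists>K. compact K \<and> K \<subseteq> \<Omega> \<and> (\<forall>y\<in>\<Omega> \<inter> ball x (r / 2). y + t *\<^sub>R n \<in> K))) \<and>
    (\<forall>t y s. 0 < t \<longrightarrow> t < r / 2 \<longrightarrow> y \<in> \<Omega> \<inter> ball x (r / 2) \<longrightarrow> 0 \<le> s \<longrightarrow> s \<le> 1 \<longrightarrow>
      y + s *\<^sub>R (t *\<^sub>R n) \<in> \<Omega>)"

text \<open>In the coordinates of the boundary chart, points moved up by \<open>t\<close> lie at least \<open>t\<close> above the
  graph.  This closed condition, intersected with a closed ball inside the chart, describes the
  compact set.\<close>

lemma boundary_patch:
  assumes lip: "lipschitz_boundary \<Omega>" and x: "x \<in> frontier \<Omega>"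
  shows "\<exists>r n. inward_patch \<Omega> x r n"
proof -
  obtain r n L \<gamma> where r: "r > 0" and n: "norm n = 1" and \<gamma>: "L-lipschitz_on UNIV \<gamma>"
    and eq: "\<Omega> \<inter> ball x r = {y \<in> ball x r. \<gamma> (y - (y \<bullet> n) *\<^sub>R n) < y \<bullet> n}"
    using bspec[OF lip[unfolded lipschitz_boundary_def] x] by blast
  have nn: "n \<bullet> n = 1" using n by (simp add: norm_eq_1)
  have proj: "(y + c *\<^sub>R n) - ((y + c *\<^sub>R n) \<bullet> n) *\<^sub>R n = y - (y \<bullet> n) *\<^sub>R n" for y c
    by (simp add: inner_add_left nn algebra_simps)
  have dist_le: "dist x (y + c *\<^sub>R n) \<le> dist x y + \<bar>c\<bar>" for y c
    using norm_triangle_ineq4[of "x - y" "c *\<^sub>R n"] n by (simp add: dist_norm algebra_simps)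
  have "inward_patch \<Omega> x r n"
    unfolding inward_patch_def
  proof (intro conjI allI impI r n)
    fix t :: real assume t: "0 < t" "t < r / 2"
    define K where "K = cball x (r / 2 + t) \<inter> {z. \<gamma> (z - (z \<bullet> n) *\<^sub>R n) + t \<le> z \<bullet> n}"
    have "continuous_on UNIV (\<lambda>z. \<gamma> (z - (z \<bullet> n) *\<^sub>R n))"
      by (rule continuous_on_compose2[OF lipschitz_on_continuous_on[OF \<gamma>]]) (auto intro!: continuous_intros)
    then have "closed {z. \<gamma> (z - (z \<bullet> n) *\<^sub>R n) + t \<le> z \<bullet> n}"
      by (intro closed_Collect_le continuous_intros)
    then have "compact K" unfolding K_def by (intro compact_Int_closed) auto
    moreover have "K \<subseteq> \<Omega>"
    proof
      fix z assume z: "z \<in> K"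
      have "z \<in> ball x r" using z t by (simp add: K_def)
      moreover have "\<gamma> (z - (z \<bullet> n) *\<^sub>R n) < z \<bullet> n" using z t by (simp add: K_def)
      ultimately have "z \<in> \<Omega> \<inter> ball x r" unfolding eq by simp
      then show "z \<in> \<Omega>" by simp
    qed
    moreover have "y + t *\<^sub>R n \<in> K" if y: "y \<in> \<Omega> \<inter> ball x (r / 2)" for y
    proof -
      have "y \<in> \<Omega> \<inter> ball x r" using y r by auto
      then have "\<gamma> (y - (y \<bullet> n) *\<^sub>R n) < y \<bullet> n" unfolding eq by simp
      moreover have "dist x (y + t *\<^sub>R n) \<le> r / 2 + t" using dist_le[of y t] y t by simp
      ultimately show ?thesis by (simp add: K_def proj) (simp add: inner_add_left nn)
    qed
    ultimately show "\<exists>K. compact K \<and> K \<subseteq> \<Omega> \<and> (\<forall>y\<in>\<Omega> \<inter> ball x (r / 2). y + t *\<^sub>R n \<in> K)" by blast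
  next
    fix t y s assume t: "0 < t" "t < r / 2" and y: "y \<in> \<Omega> \<inter> ball x (r / 2)" and s: "0 \<le> s" "s \<le> (1::real)"
    have "y \<in> \<Omega> \<inter> ball x r" using y r by auto
    then have "\<gamma> (y - (y \<bullet> n) *\<^sub>R n) < y \<bullet> n" unfolding eq by simp
    also have "y \<bullet> n \<le> (y + (s * t) *\<^sub>R n) \<bullet> n" using s t by (simp add: inner_add_left nn)
    finally have g: "\<gamma> ((y + (s * t) *\<^sub>R n) - ((y + (s * t) *\<^sub>R n) \<bullet> n) *\<^sub>R n) < (y + (s * t) *\<^sub>R n) \<bullet> n"
      unfolding proj .
    have "\<bar>s * t\<bar> \<le> t" using s t by (simp add: abs_mult mult_left_le_one_le)
    then have "y + (s * t) *\<^sub>R n \<in> ball x r" using dist_le[of y "s * t"] y t by simp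
    with g have "y + (s * t) *\<^sub>R n \<in> \<Omega> \<inter> ball x r" unfolding eq by simp
    then show "y + s *\<^sub>R (t *\<^sub>R n) \<in> \<Omega>" by simp
  qed
  then show ?thesis by blast
qed

text \<open>The mass of \<open>f\<close> is controlled by its mass on \<open>K\<close>, up to \<open>t\<^sup>2\<close> times the Dirichlet integral.  What
  matters below is that \<open>N\<close> does not depend on \<open>t\<close>.\<close>

definition boundary_reduction :: "(real^'d) set \<Rightarrow> nat \<Rightarrow> real \<Rightarrow> (real^'d) set \<Rightarrow> bool" where
  "boundary_reduction \<Omega> N t K \<longleftrightarrow> compact K \<and> K \<subseteq> \<Omega> \<and> (\<forall>f. Cinf f \<longrightarrow>
     nnint \<Omega> (\<lambda>x. (f x)\<^sup>2) \<le> of_nat N * (nnint K (\<lambda>x. (f x)\<^sup>2)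
       + ennreal (t\<^sup>2) * nnint \<Omega> (\<lambda>x. (norm (grad f x))\<^sup>2)))"

text \<open>The finitely many patches that cover the compact boundary are chosen before \<open>t\<close>; the rest of
  the domain is contained in a compact subset of it.\<close>

lemma boundary_reduction_exists:
  fixes \<Omega> :: "(real^'d) set"
  assumes \<Omega>: "open \<Omega>" "bounded \<Omega>" and lip: "lipschitz_boundary \<Omega>"
  shows "\<exists>N. \<exists>t0>0. \<forall>t. 0 < t \<longrightarrow> t < t0 \<longrightarrow> (\<exists>K. boundary_reduction \<Omega> N t K)"
proof -
  have "\<forall>x\<in>frontier \<Omega>. \<exists>r n. inward_patch \<Omega> x r n" using boundary_patch[OF lip] by blast
  then obtain r n where rn: "\<And>x. x \<in> frontier \<Omega> \<Longrightarrow> inward_patch \<Omega> x (r x) (n x)" by metis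
  have r_pos: "r x > 0" and n_norm: "norm (n x) = 1" if "x \<in> frontier \<Omega>" for x
    using rn[OF that] unfolding inward_patch_def by simp_all
  have shifted: "\<exists>K. compact K \<and> K \<subseteq> \<Omega> \<and> (\<forall>y\<in>\<Omega> \<inter> ball x (r x / 2). y + t *\<^sub>R n x \<in> K)"
    if "x \<in> frontier \<Omega>" "0 < t" "t < r x / 2" for x t
    using rn[OF that(1)] that(2,3) unfolding inward_patch_def by simp
  have segment: "y + s *\<^sub>R (t *\<^sub>R n x) \<in> \<Omega>"
    if "x \<in> frontier \<Omega>" "0 < t" "t < r x / 2" "y \<in> \<Omega> \<inter> ball x (r x / 2)" "0 \<le> s" "s \<le> 1" for x t y s
    using rn[OF that(1)] that(2-) unfolding inward_patch_def by simp
  have "compact (frontier \<Omega>)" using \<Omega> by (simp add: compact_frontier_bounded)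
  then obtain X where X: "X \<subseteq> frontier \<Omega>" "finite X" "frontier \<Omega> \<subseteq> (\<Union>x\<in>X. ball x (r x / 2))"
  proof (rule compactE_image[of _ "frontier \<Omega>" "\<lambda>x. ball x (r x / 2)"])
    show "frontier \<Omega> \<subseteq> (\<Union>x\<in>frontier \<Omega>. ball x (r x / 2))" using r_pos by force
  qed auto
  define t0 where "t0 = Min (insert 1 ((\<lambda>x. r x / 2) ` X))"
  have t0: "t0 > 0" using X r_pos by (auto simp: t0_def)
  have t0_le: "t0 \<le> r x / 2" if "x \<in> X" for x
    using X(2) that unfolding t0_def by (intro Min_le) auto
  show ?thesis
  proof (rule exI[of _ "2 * card X + 1"], intro exI[of _ t0] conjI allI impI t0)
    fix t :: real assume t: "0 < t" "t < t0"
    have tr: "t < r x / 2" if "x \<in> X" for x using t t0_le[OF that] by simp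
    have "\<forall>x\<in>X. \<exists>K. compact K \<and> K \<subseteq> \<Omega> \<and> (\<forall>y\<in>\<Omega> \<inter> ball x (r x / 2). y + t *\<^sub>R n x \<in> K)"
      using shifted X(1) t(1) tr by blast
    then obtain K where K: "\<And>x. x \<in> X \<Longrightarrow> compact (K x)" "\<And>x. x \<in> X \<Longrightarrow> K x \<subseteq> \<Omega>"
        "\<And>x y. x \<in> X \<Longrightarrow> y \<in> \<Omega> \<inter> ball x (r x / 2) \<Longrightarrow> y + t *\<^sub>R n x \<in> K x"
      by metis
    define K0 where "K0 = closure \<Omega> - (\<Union>x\<in>X. ball x (r x / 2))"
    have K0: "compact K0" "K0 \<subseteq> \<Omega>"
    proof -
      have "compact (closure \<Omega> \<inter> - (\<Union>x\<in>X. ball x (r x / 2)))"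
        using \<Omega> by (intro compact_Int_closed closed_Compl open_UN) auto
      then show "compact K0" by (simp add: K0_def Diff_eq)
      show "K0 \<subseteq> \<Omega>" using X(3) \<Omega>(1) by (auto simp: K0_def frontier_def interior_open)
    qed
    define K' where "K' = K0 \<union> (\<Union>x\<in>X. K x)"
    have K': "compact K'" "K' \<subseteq> \<Omega>"
      using K K0 X(2) by (auto simp: K'_def intro!: compact_Un compact_UN)
    have bK: "K' \<in> sets borel" "K0 \<in> sets borel" using K'(1) K0(1) by (auto intro: borel_compact)
    have "nnint \<Omega> (\<lambda>x. (f x)\<^sup>2) \<le> of_nat (2 * card X + 1) * (nnint K' (\<lambda>x. (f x)\<^sup>2)
         + ennreal (t\<^sup>2) * nnint \<Omega> (\<lambda>x. (norm (grad f x))\<^sup>2))" if f: "Cinf f" for f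
    proof -
      have [measurable]: "f \<in> borel_measurable borel" by (rule borel_measurable_continuous_onI[OF Cinf_continuous[OF f]])
      have [measurable]: "\<Omega> \<in> sets borel" "K0 \<in> sets borel" "K' \<in> sets borel" using \<Omega> bK by auto
      define a where "a = nnint K' (\<lambda>x. (f x)\<^sup>2)"
      define b where "b = ennreal (t\<^sup>2) * nnint \<Omega> (\<lambda>x. (norm (grad f x))\<^sup>2)"
      have "nnint \<Omega> (\<lambda>x. (f x)\<^sup>2) \<le> (\<integral>\<^sup>+z. ennreal ((f z)\<^sup>2) * indicator K0 z
          + (\<Sum>x\<in>X. ennreal ((f z)\<^sup>2) * indicator (\<Omega> \<inter> ball x (r x / 2)) z) \<partial>lborel)"
        unfolding nnint_def
      proof (rule nn_integral_mono)
        fix z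
        show "ennreal ((f z)\<^sup>2) * indicator \<Omega> z \<le> ennreal ((f z)\<^sup>2) * indicator K0 z
          + (\<Sum>x\<in>X. ennreal ((f z)\<^sup>2) * indicator (\<Omega> \<inter> ball x (r x / 2)) z)"
        proof (cases "z \<in> \<Omega> \<and> z \<notin> K0")
          case True
          then have "z \<in> closure \<Omega>" using closure_subset by auto
          then obtain x where x: "x \<in> X" "z \<in> ball x (r x / 2)" using True unfolding K0_def by blast
          have "ennreal ((f z)\<^sup>2) * indicator (\<Omega> \<inter> ball x (r x / 2)) z
              \<le> (\<Sum>x\<in>X. ennreal ((f z)\<^sup>2) * indicator (\<Omega> \<inter> ball x (r x / 2)) z)"
            using x X(2) by (intro member_le_sum) auto
          then show ?thesis using True x by (simp add: indicator_def)
        qed (auto simp: indicator_def)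
      qed
      also have "\<dots> = nnint K0 (\<lambda>x. (f x)\<^sup>2) + (\<Sum>x\<in>X. nnint (\<Omega> \<inter> ball x (r x / 2)) (\<lambda>x. (f x)\<^sup>2))"
      proof -
        have m: "(\<lambda>z. ennreal ((f z)\<^sup>2) * indicator A z) \<in> borel_measurable lborel" if "A \<in> sets borel" for A
          using that by measurable
        have bA: "\<Omega> \<inter> ball x \<rho> \<in> sets borel" for x \<rho> using \<Omega> by auto
        show ?thesis
          unfolding nnint_def using bK m[OF bA]
          by (subst nn_integral_add) (auto simp: nn_integral_sum intro!: borel_measurable_sum m)
      qed
      also have "\<dots> \<le> a + (\<Sum>x\<in>X. 2 * a + 2 * b)"
      proof (intro add_mono sum_mono)
        show "nnint K0 (\<lambda>x. (f x)\<^sup>2) \<le> a" unfolding a_def nnint_def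
          by (intro nn_integral_mono) (auto simp: K'_def indicator_def)
        fix x assume x: "x \<in> X"
        have "nnint (\<Omega> \<inter> ball x (r x / 2)) (\<lambda>x. (f x)\<^sup>2) \<le> 2 * nnint K' (\<lambda>x. (f x)\<^sup>2)
            + 2 * (ennreal ((norm (t *\<^sub>R n x))\<^sup>2) * nnint \<Omega> (\<lambda>x. (norm (grad f x))\<^sup>2))"
        proof (rule nnint_shift_estimate[OF f])
          show "z + s *\<^sub>R (t *\<^sub>R n x) \<in> \<Omega>" if "z \<in> \<Omega> \<inter> ball x (r x / 2)" "0 \<le> s" "s \<le> 1" for z s
            using X(1) x t(1) tr[OF x] that by (intro segment) auto
          show "z + t *\<^sub>R n x \<in> K'" if "z \<in> \<Omega> \<inter> ball x (r x / 2)" for z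
            using K(3)[OF x that] x by (auto simp: K'_def)
        qed (use \<Omega> bK in auto)
        moreover have "norm (n x) = 1" using n_norm X(1) x by blast
        ultimately show "nnint (\<Omega> \<inter> ball x (r x / 2)) (\<lambda>x. (f x)\<^sup>2) \<le> 2 * a + 2 * b"
          by (simp add: a_def b_def)
      qed
      also have "\<dots> \<le> of_nat (2 * card X + 1) * (a + b)"
      proof -
        have "a + (\<Sum>x\<in>X. 2 * a + 2 * b) + b = of_nat (2 * card X + 1) * (a + b)"
          by (simp add: algebra_simps)
        then show ?thesis by (metis le_iff_add)
      qed
      finally show ?thesis unfolding a_def b_def .
    qed
    then have "boundary_reduction \<Omega> (2 * card X + 1) t K'"
      using K' unfolding boundary_reduction_def by simp
    then show "\<exists>K. boundary_reduction \<Omega> (2 * card X + 1) t K" by blast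
  qed
qed

text \<open>A kernel for local averages.  It is Lipschitz, so averages at nearby points are close.\<close>

definition tent :: "real \<Rightarrow> 'a::real_normed_vector \<Rightarrow> real" where
  "tent h z = max 0 (h - norm z)"

lemma tent_props: "0 \<le> tent h z" "h \<le> norm z \<Longrightarrow> tent h z = 0" "continuous_on A (tent h)"
  "\<bar>tent h z - tent h w\<bar> \<le> norm (z - w)"
proof -
  show "\<bar>tent h z - tent h w\<bar> \<le> norm (z - w)"
    using norm_triangle_ineq3[of z w] by (auto simp: tent_def max_def)
qed (auto simp: tent_def[abs_def] intro!: continuous_intros)

lemma tent_integral:
  fixes h :: real assumes h: "h > 0"
  shows "integrable lborel (tent h :: 'a::euclidean_space \<Rightarrow> real)"
    and "0 < (LINT y|lborel. tent h (y::'a))"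
proof -
  show I: "integrable lborel (tent h :: 'a \<Rightarrow> real)"
    by (rule integrable_continuous_compact_support[of _ "cball 0 h"]) (auto intro: tent_props)
  have J: "integrable lborel (\<lambda>y::'a. (h/2) * indicator (ball 0 (h/2)) y)"
    using emeasure_bounded_finite[OF bounded_ball, of "0::'a" "h/2"]
    by (intro integrable_mult_right integrable_real_indicator) auto
  have "(LINT y|lborel. (h/2) * indicator (ball (0::'a) (h/2)) y) \<le> (LINT y|lborel. tent h (y::'a))"
    by (rule integral_mono[OF J I]) (auto simp: tent_def indicator_def max_def)
  moreover have "(LINT y|lborel. (h/2) * indicator (ball (0::'a) (h/2)) y) = (h/2) * measure lborel (ball (0::'a) (h/2))"
    by simp
  moreover have "0 < (h/2) * measure lborel (ball (0::'a) (h/2))"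
    using h content_ball_pos[of "h/2" "0::'a"] by (intro mult_pos_pos) auto
  ultimately show "0 < (LINT y|lborel. tent h (y::'a))" by linarith
qed

text \<open>Jensen's inequality for the probability density \<open>tent h / c\<close>, obtained from the Cauchy--Schwarz
  inequality for the square root of the weight.\<close>

lemma tent_average:
  fixes f :: "'a::euclidean_space \<Rightarrow> real"
  assumes h: "h > 0" and f: "continuous_on UNIV f"
  defines "c \<equiv> LINT y|lborel. tent h (y::'a)"
  shows "(f x - (LINT y|lborel. tent h y * f (x + y)) / c)\<^sup>2
     \<le> (LINT y|lborel. tent h y / c * (f (x + y) - f x)\<^sup>2)"
    and "integrable lborel (\<lambda>y. tent h y / c * (f (x + y) - f x)\<^sup>2)"
proof -
  have c: "c > 0" unfolding c_def by (rule tent_integral[OF h])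
  have cf: "continuous_on UNIV (\<lambda>y. f (x + y))"
    by (rule continuous_on_compose2[OF f]) (auto intro!: continuous_intros)
  have I: "integrable lborel (\<lambda>y. tent h y * g y)" if "continuous_on UNIV g" for g :: "'a \<Rightarrow> real"
    by (rule integrable_continuous_compact_support[of _ "cball 0 h"])
      (auto intro!: continuous_intros tent_props(3) that simp: tent_props(2))
  have I1: "integrable lborel (\<lambda>y. tent h y * (f (x + y) - f x)\<^sup>2)"
    by (rule I) (intro continuous_intros cf)
  then show "integrable lborel (\<lambda>y. tent h y / c * (f (x + y) - f x)\<^sup>2)"
    by simp
  let ?u = "\<lambda>y::'a. sqrt (tent h y)" and ?v = "\<lambda>y. sqrt (tent h y) * (f (x + y) - f x)"
  have m: "?u \<in> borel_measurable lborel" "?v \<in> borel_measurable lborel"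
    by (auto intro!: borel_measurable_continuous_onI continuous_intros tent_props(3) cf)
  have L: "L2 lborel ?u" "L2 lborel ?v"
    using m I1 tent_integral(1)[OF h] by (auto simp: L2_def tent_props(1) power_mult_distrib)
  have "(LINT y|lborel. tent h y * (f (x + y) - f x)) = (LINT y|lborel. tent h y * f (x + y) - f x * tent h y)"
    by (simp add: algebra_simps)
  also have "\<dots> = (LINT y|lborel. tent h y * f (x + y)) - f x * c"
    unfolding c_def using I[OF cf] tent_integral(1)[OF h] by (subst Bochner_Integration.integral_diff) auto
  finally have "((LINT y|lborel. tent h y * f (x + y)) - f x * c)\<^sup>2 = (LINT y|lborel. ?u y \<bullet> ?v y)\<^sup>2"
    by (simp add: tent_props(1) mult.assoc[symmetric] flip: real_sqrt_mult)
  also have "\<dots> \<le> nsq lborel ?u * nsq lborel ?v"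
    by (rule integral_cauchy_schwarz[OF L])
  also have "\<dots> = c * (LINT y|lborel. tent h y * (f (x + y) - f x)\<^sup>2)"
    by (simp add: nsq_def c_def tent_props(1) power_mult_distrib)
  finally have *: "((LINT y|lborel. tent h y * f (x + y)) - f x * c)\<^sup>2 \<le> c * (LINT y|lborel. tent h y * (f (x + y) - f x)\<^sup>2)" .
  have "(f x - (LINT y|lborel. tent h y * f (x + y)) / c)\<^sup>2 = ((LINT y|lborel. tent h y * f (x + y)) - f x * c)\<^sup>2 / c\<^sup>2"
    using c by (simp add: power2_commute[of "f x"] diff_divide_distrib flip: power_divide)
  also have "\<dots> \<le> (c * (LINT y|lborel. tent h y * (f (x + y) - f x)\<^sup>2)) / c\<^sup>2"
    using * by (rule divide_right_mono) simp
  also have "\<dots> = (LINT y|lborel. tent h y / c * (f (x + y) - f x)\<^sup>2)"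
    using c by (simp add: power2_eq_square)
  finally show "(f x - (LINT y|lborel. tent h y * f (x + y)) / c)\<^sup>2
     \<le> (LINT y|lborel. tent h y / c * (f (x + y) - f x)\<^sup>2)" .
qed

text \<open>Averaging the translation estimate over all shifts of length less than \<open>h\<close>.\<close>

lemma tent_average_estimate:
  fixes f :: "real^'d \<Rightarrow> real"
  assumes h: "h > 0" and f: "Cinf f" and K: "K \<in> sets borel" and \<Omega>: "\<Omega> \<in> sets borel"
    and sub: "\<And>x. x \<in> K \<Longrightarrow> ball x h \<subseteq> \<Omega>"
  shows "nnint K (\<lambda>x. (f x - (LINT y|lborel. tent h y * f (x + y)) / (LINT y|lborel. tent h (y::real^'d)))\<^sup>2)
    \<le> ennreal (h\<^sup>2) * nnint \<Omega> (\<lambda>x. (norm (grad f x))\<^sup>2)"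
proof -
  define c where "c = (LINT y|lborel. tent h (y::real^'d))"
  have c: "c > 0" unfolding c_def by (rule tent_integral[OF h])
  note [measurable] = K \<Omega>
  have [measurable]: "f \<in> borel_measurable borel" by (rule borel_measurable_continuous_onI[OF Cinf_continuous[OF f]])
  have [measurable]: "(tent h :: real^'d \<Rightarrow> real) \<in> borel_measurable borel"
    by (rule borel_measurable_continuous_onI[OF tent_props(3)])
  let ?D = "ennreal (h\<^sup>2) * nnint \<Omega> (\<lambda>x. (norm (grad f x))\<^sup>2)"
  have "nnint K (\<lambda>x. (f x - (LINT y|lborel. tent h y * f (x + y)) / c)\<^sup>2)
     \<le> (\<integral>\<^sup>+x. (\<integral>\<^sup>+y. ennreal (tent h y / c) * (ennreal ((f (x + y) - f x)\<^sup>2) * indicator K x) \<partial>lborel) \<partial>lborel)"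
    unfolding nnint_def
  proof (rule nn_integral_mono)
    fix x
    have "ennreal ((f x - (LINT y|lborel. tent h y * f (x + y)) / c)\<^sup>2)
        \<le> ennreal (LINT y|lborel. tent h y / c * (f (x + y) - f x)\<^sup>2)"
      unfolding c_def by (intro ennreal_leI tent_average(1)[OF h Cinf_continuous[OF f]])
    also have "\<dots> = (\<integral>\<^sup>+y. ennreal (tent h y / c * (f (x + y) - f x)\<^sup>2) \<partial>lborel)"
      using tent_average(2)[OF h Cinf_continuous[OF f], of x] c
      by (intro nn_integral_eq_integral[symmetric]) (auto simp: c_def tent_props(1))
    also have "\<dots> = (\<integral>\<^sup>+y. ennreal (tent h y / c) * ennreal ((f (x + y) - f x)\<^sup>2) \<partial>lborel)"
      using c by (intro nn_integral_cong ennreal_mult) (auto simp: tent_props(1))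
    finally show "ennreal ((f x - (LINT y|lborel. tent h y * f (x + y)) / c)\<^sup>2) * indicator K x
        \<le> (\<integral>\<^sup>+y. ennreal (tent h y / c) * (ennreal ((f (x + y) - f x)\<^sup>2) * indicator K x) \<partial>lborel)"
      by (cases "x \<in> K") auto
  qed
  also have "\<dots> = (\<integral>\<^sup>+y. (\<integral>\<^sup>+x. ennreal (tent h y / c) * (ennreal ((f (x + y) - f x)\<^sup>2) * indicator K x) \<partial>lborel) \<partial>lborel)"
    by (rule lborel_pair.Fubini'[symmetric]) measurable
  also have "\<dots> = (\<integral>\<^sup>+y. ennreal (tent h y / c) * nnint K (\<lambda>x. (f (x + y) - f x)\<^sup>2) \<partial>lborel)"
    unfolding nnint_def by (intro nn_integral_cong nn_integral_cmult) measurable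
  also have "\<dots> \<le> (\<integral>\<^sup>+y. ennreal (tent h (y::real^'d) / c) * ?D \<partial>lborel)"
  proof (rule nn_integral_mono)
    fix y :: "real^'d"
    show "ennreal (tent h y / c) * nnint K (\<lambda>x. (f (x + y) - f x)\<^sup>2) \<le> ennreal (tent h y / c) * ?D"
    proof (cases "norm y < h")
      case True
      have "nnint K (\<lambda>x. (f (x + y) - f x)\<^sup>2) \<le> ennreal ((norm y)\<^sup>2) * nnint \<Omega> (\<lambda>x. (norm (grad f x))\<^sup>2)"
      proof (rule translation_estimate[OF f K \<Omega>])
        fix x s assume x: "x \<in> K" and s: "0 \<le> s" "s \<le> (1::real)"
        have "norm (s *\<^sub>R y) \<le> norm y" using s by (simp add: mult_left_le_one_le)
        then have "x + s *\<^sub>R y \<in> ball x h" using True by (simp add: dist_norm)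
        then show "x + s *\<^sub>R y \<in> \<Omega>" using sub[OF x] by blast
      qed
      also have "\<dots> \<le> ?D" using True h by (intro mult_right_mono ennreal_leI power_mono) auto
      finally show ?thesis by (rule mult_left_mono) simp
    next
      case False
      then show ?thesis by (simp add: tent_props(2))
    qed
  qed
  also have "\<dots> = (\<integral>\<^sup>+y. ennreal (tent h (y::real^'d) / c) \<partial>lborel) * ?D"
    by (rule nn_integral_multc) measurable
  also have "(\<integral>\<^sup>+y. ennreal (tent h (y::real^'d) / c) \<partial>lborel) = ennreal (LINT y|lborel. tent h (y::real^'d) / c)"
    using c tent_integral(1)[OF h] by (intro nn_integral_eq_integral) (auto simp: tent_props(1))
  also have "(LINT y|lborel. tent h (y::real^'d) / c) = 1" using c by (simp add: c_def)
  finally show ?thesis by (simp add: c_def)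
qed

section \<open>Rellich compactness on Lipschitz domains\<close>

text \<open>The quantity \<open>I f\<close> is small relative to the Sobolev norm up to finitely many linear functionals
  of \<open>f\<close>, those with kernels \<open>k p\<close> for \<open>p \<in> X\<close>.\<close>

definition finite_rank_bound ::
    "(real^'d) set \<Rightarrow> ((real^'d \<Rightarrow> real) \<Rightarrow> ennreal) \<Rightarrow> real \<Rightarrow>
     (real^'d) set \<Rightarrow> (real^'d \<Rightarrow> real^'d \<Rightarrow> real) \<Rightarrow> real \<Rightarrow> bool" where
  "finite_rank_bound \<Omega> I e X k C \<longleftrightarrow> finite X \<and> (\<forall>p. continuous_on UNIV (k p)) \<and> C \<ge> 0 \<and>
    (\<forall>f. Cinf f \<longrightarrow> I f \<le> ennreal (e * (nsq (lebesgue_on \<Omega>) f + nsq (lebesgue_on \<Omega>) (grad f))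
        + C * (\<Sum>p\<in>X. (LINT z|lebesgue_on \<Omega>. k p z * f z)\<^sup>2)))"

lemma finite_rank_boundD:
  assumes "finite_rank_bound \<Omega> I e X k C"
  shows "finite X" "continuous_on UNIV (k p)" "C \<ge> 0"
    "Cinf f \<Longrightarrow> I f \<le> ennreal (e * (nsq (lebesgue_on \<Omega>) f + nsq (lebesgue_on \<Omega>) (grad f))
        + C * (\<Sum>p\<in>X. (LINT z|lebesgue_on \<Omega>. k p z * f z)\<^sup>2))"
  using assms unfolding finite_rank_bound_def by simp_all

text \<open>On \<open>K\<close> the function differs little from its averages at scale \<open>h\<close>.  The averages vary slowly with
  the point because the kernel is Lipschitz, so those at the points of a finite \<open>\<delta>\<close>-net of \<open>K\<close> control
  all of them.\<close>

lemma interior_finite_rank_bound: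
  fixes \<Omega> :: "(real^'d) set"
  assumes \<Omega>: "open \<Omega>" "bounded \<Omega>" and K: "compact K" "K \<subseteq> \<Omega>" and e: "e > 0"
  shows "\<exists>X k C. finite_rank_bound \<Omega> (\<lambda>f. nnint K (\<lambda>x. (f x)\<^sup>2)) e X k C"
proof -
  let ?M = "lebesgue_on \<Omega>"
  obtain d where d: "d > 0" "(\<Union>x\<in>K. ball x d) \<subseteq> \<Omega>"
    by (rule compact_subset_open_imp_ball_epsilon_subset[OF K(1) \<Omega>(1) K(2)])
  define h where "h = min d (min 1 (e / 2))"
  have h: "h > 0" "h \<le> 1" "h \<le> e / 2" "h \<le> d" using d e by (auto simp: h_def)
  have hh: "2 * h\<^sup>2 \<le> e" proof -
    have "h * h \<le> h * 1" using h by (intro mult_left_mono) auto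
    then show ?thesis using h(3) by (simp add: power2_eq_square)
  qed
  have sub: "ball x h \<subseteq> \<Omega>" if "x \<in> K" for x
  proof -
    have "ball x h \<subseteq> ball x d" using h(4) by (rule subset_ball)
    also have "\<dots> \<subseteq> \<Omega>" using d(2) that by (auto simp: UN_subset_iff)
    finally show ?thesis .
  qed
  define c where "c = (LINT y|lborel. tent h (y::real^'d))"
  have c: "c > 0" unfolding c_def by (rule tent_integral[OF h(1)])
  define m where "m = measure lborel \<Omega>"
  have m: "m \<ge> 0" by (simp add: m_def)
  have em: "emeasure lborel \<Omega> = ennreal m"
    unfolding m_def using emeasure_bounded_finite[OF \<Omega>(2)] by (intro emeasure_eq_ennreal_measure) auto
  \<comment> \<open>Chosen such that the oscillation of the averages contributes at most \<open>e\<close> times the squared norm;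
    the summand \<open>1\<close> only avoids a division by \<open>0\<close>.\<close>
  define \<delta> where "\<delta> = c * sqrt e / (2 * (m + 1))"
  have \<delta>: "\<delta> > 0" using c e m by (simp add: \<delta>_def)
  have \<delta>e: "4 * m\<^sup>2 * \<delta>\<^sup>2 / c\<^sup>2 \<le> e"
  proof -
    have \<delta>2: "\<delta>\<^sup>2 = c\<^sup>2 * e / (4 * (m + 1)\<^sup>2)"
      unfolding \<delta>_def power_divide power_mult_distrib using e by simp
    have "4 * m\<^sup>2 * \<delta>\<^sup>2 / c\<^sup>2 = e * (m / (m + 1))\<^sup>2"
      unfolding \<delta>2 power_divide using c by simp
    also have "\<dots> \<le> e * 1" using e m by (intro mult_left_mono power_le_one) auto
    finally show ?thesis by simp
  qed
  obtain X where X: "X \<subseteq> K" "finite X" "K \<subseteq> (\<Union>x\<in>X. ball x \<delta>)"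
  proof (rule compactE_image[OF K(1), of K "\<lambda>x. ball x \<delta>"])
    show "K \<subseteq> (\<Union>x\<in>K. ball x \<delta>)" using \<delta> by force
  qed auto
  define k where "k p z = tent h (z - p)" for p z :: "real^'d"
  have kc: "continuous_on UNIV (k p)" for p
    unfolding k_def by (rule continuous_on_compose2[OF tent_props(3)[of UNIV]]) (auto intro!: continuous_intros)
  have "finite_rank_bound \<Omega> (\<lambda>f. nnint K (\<lambda>x. (f x)\<^sup>2)) e X k (4 * m / c\<^sup>2)"
    unfolding finite_rank_bound_def
  proof (intro conjI allI impI)
    show "finite X" by fact
    show "continuous_on UNIV (k p)" for p by (rule kc)
    show "0 \<le> 4 * m / c\<^sup>2" using m by simp
    fix f :: "real^'d \<Rightarrow> real" assume f: "Cinf f"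
    note fc = Cinf_continuous[OF f]
    define a where "a = nsq ?M f"
    define b where "b = nsq ?M (grad f)"
    define S where "S = (\<Sum>p\<in>X. (LINT z|?M. k p z * f z)\<^sup>2)"
    define A where "A x = (LINT z|?M. k x z * f z) / c" for x
    have A_lborel: "A x = (LINT y|lborel. tent h y * f (x + y)) / c" if x: "x \<in> K" for x
    proof -
      have cont: "continuous_on UNIV (\<lambda>z. k x z * f z)" by (intro continuous_intros kc fc)
      have "(LINT z|?M. k x z * f z) = (LINT z|lborel. k x z * f z)"
      proof (rule integral_lebesgue_on_compact_support[OF \<Omega>(1) sub[OF x] cont])
        fix z assume "z \<notin> ball x h"
        then show "k x z * f z = 0" by (simp add: k_def tent_props(2) dist_norm norm_minus_commute)
      qed
      also have "\<dots> = (LINT y|lborel. k x (x + y) * f (x + y))"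
        using lborel_integral_translate[of "\<lambda>z. k x z * f z" x] borel_measurable_continuous_onI[OF cont] by simp
      finally show ?thesis by (simp add: A_def k_def)
    qed
    have Lf: "L2 ?M f" by (rule continuous_L2[OF fc \<Omega>])
    have A_bound: "(A x)\<^sup>2 \<le> 2 * S / c\<^sup>2 + 2 * (\<delta>\<^sup>2 * m * a / c\<^sup>2)" if x: "x \<in> K" for x
    proof -
      obtain p where p: "p \<in> X" "dist p x < \<delta>" using X(3) x by auto
      have Lk: "L2 ?M (\<lambda>z. k x z - k p z)"
        by (rule continuous_L2[OF _ \<Omega>]) (intro continuous_intros kc)
      have Ik: "integrable ?M (\<lambda>z. k q z * f z)" for q
        using L2_inner_integrable[OF continuous_L2[OF kc[of q] \<Omega>] Lf] by simp
      have "(A x - A p)\<^sup>2 = ((LINT z|?M. (k x z - k p z) \<bullet> f z) / c)\<^sup>2"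
        using Ik by (simp add: A_def left_diff_distrib diff_divide_distrib)
      also have "\<dots> \<le> nsq ?M (\<lambda>z. k x z - k p z) * a / c\<^sup>2"
        unfolding a_def power_divide by (intro divide_right_mono integral_cauchy_schwarz Lk Lf) simp
      also have "\<dots> \<le> (\<delta>\<^sup>2 * m) * a / c\<^sup>2"
      proof (intro divide_right_mono mult_right_mono)
        interpret finite_measure ?M by (rule finite_measure_lebesgue_on_bounded[OF \<Omega>])
        have "nsq ?M (\<lambda>z. k x z - k p z) \<le> (LINT z|?M. \<delta>\<^sup>2)"
          unfolding nsq_def
        proof (rule integral_mono[OF L2_integrable[OF Lk]])
          fix z
          have "norm (k x z - k p z) \<le> norm ((z - x) - (z - p))"
            unfolding k_def real_norm_def by (rule tent_props(4))
          also have "\<dots> \<le> \<delta>" using p(2) by (simp add: dist_norm)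
          finally show "(norm (k x z - k p z))\<^sup>2 \<le> \<delta>\<^sup>2" by (intro power_mono) auto
        qed simp
        also have "\<dots> = \<delta>\<^sup>2 * m" using \<Omega> by (simp add: m_def measure_restrict_space measure_completion)
        finally show "nsq ?M (\<lambda>z. k x z - k p z) \<le> \<delta>\<^sup>2 * m" .
      qed (auto simp: a_def)
      finally have 1: "(A x - A p)\<^sup>2 \<le> \<delta>\<^sup>2 * m * a / c\<^sup>2" .
      have "(LINT z|?M. k p z * f z)\<^sup>2 \<le> S"
        unfolding S_def by (rule member_le_sum[OF p(1)]) (auto simp: X)
      then have 2: "(A p)\<^sup>2 \<le> S / c\<^sup>2" unfolding A_def power_divide by (intro divide_right_mono) auto
      have "(A x)\<^sup>2 \<le> 2 * (A p)\<^sup>2 + 2 * (A p - A x)\<^sup>2" by (rule square_le_shift)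
      then show ?thesis using 1 2 by (simp add: power2_commute[of "A p"])
    qed
    define Bd where "Bd = 2 * S / c\<^sup>2 + 2 * (\<delta>\<^sup>2 * m * a / c\<^sup>2)"
    have S: "S \<ge> 0" by (auto simp: S_def intro: sum_nonneg)
    have ab: "a \<ge> 0" "b \<ge> 0" by (auto simp: a_def b_def)
    have Bd: "Bd \<ge> 0" using S ab m unfolding Bd_def by (intro add_nonneg_nonneg) auto
    have Kb[measurable]: "K \<in> sets borel" using K(1) by (rule borel_compact)
    have [measurable]: "f \<in> borel_measurable borel" by (rule borel_measurable_continuous_onI[OF fc])
    let ?AA = "\<lambda>x. (LINT y|lborel. tent h y * f (x + y)) / c"
    have [measurable]: "(tent h :: real^'d \<Rightarrow> real) \<in> borel_measurable borel"
      by (rule borel_measurable_continuous_onI[OF tent_props(3)])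
    have [measurable]: "?AA \<in> borel_measurable borel" by measurable
    have "nnint K (\<lambda>x. (f x)\<^sup>2) \<le> (\<integral>\<^sup>+x. 2 * (ennreal ((f x - ?AA x)\<^sup>2) * indicator K x) + ennreal (2 * Bd) * indicator K x \<partial>lborel)"
      unfolding nnint_def
    proof (rule nn_integral_mono)
      fix x
      show "ennreal ((f x)\<^sup>2) * indicator K x \<le> 2 * (ennreal ((f x - ?AA x)\<^sup>2) * indicator K x) + ennreal (2 * Bd) * indicator K x"
      proof (cases "x \<in> K")
        case True
        have "(f x)\<^sup>2 \<le> 2 * (A x)\<^sup>2 + 2 * (A x - f x)\<^sup>2" by (rule square_le_shift)
        also have "\<dots> \<le> 2 * (f x - ?AA x)\<^sup>2 + 2 * Bd"
          using A_bound[OF True] A_lborel[OF True] unfolding Bd_def by (simp add: power2_commute)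
        finally have "ennreal ((f x)\<^sup>2) \<le> ennreal (2 * (f x - ?AA x)\<^sup>2 + 2 * Bd)" by (rule ennreal_leI)
        also have "\<dots> = 2 * ennreal ((f x - ?AA x)\<^sup>2) + ennreal (2 * Bd)"
          using Bd by (subst ennreal_plus) (auto simp: ennreal_mult)
        finally show ?thesis using True by simp
      qed simp
    qed
    also have "\<dots> = 2 * nnint K (\<lambda>x. (f x - ?AA x)\<^sup>2) + ennreal (2 * Bd) * emeasure lborel K"
      unfolding nnint_def by (subst nn_integral_add) (auto simp: nn_integral_cmult)
    also have "\<dots> \<le> 2 * (ennreal (h\<^sup>2) * nnint \<Omega> (\<lambda>x. (norm (grad f x))\<^sup>2)) + ennreal (2 * Bd) * emeasure lborel \<Omega>"
      using tent_average_estimate[OF h(1) f Kb _ sub] \<Omega> K unfolding c_def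
      by (intro add_mono mult_left_mono emeasure_mono) auto
    also have "\<dots> = ennreal (2 * h\<^sup>2 * b + 2 * Bd * m)"
      unfolding em b_def using Bd m ab
      by (simp add: ennreal_nsq_eq_nnint[OF continuous_grad[OF f] \<Omega>, symmetric] ennreal_mult mult.assoc
          flip: ennreal_plus ennreal_mult ennreal_numeral)
    also have "\<dots> \<le> ennreal (e * (a + b) + 4 * m / c\<^sup>2 * S)"
    proof (rule ennreal_leI)
      have "2 * h\<^sup>2 * b \<le> e * b" using hh ab by (intro mult_right_mono) auto
      moreover have "2 * Bd * m = 4 * m / c\<^sup>2 * S + (4 * m\<^sup>2 * \<delta>\<^sup>2 / c\<^sup>2) * a"
        by (simp add: Bd_def power2_eq_square algebra_simps add_divide_distrib)
      moreover have "(4 * m\<^sup>2 * \<delta>\<^sup>2 / c\<^sup>2) * a \<le> e * a" using \<delta>e ab by (intro mult_right_mono) auto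
      ultimately show "2 * h\<^sup>2 * b + 2 * Bd * m \<le> e * (a + b) + 4 * m / c\<^sup>2 * S"
        unfolding distrib_left by linarith
    qed
    finally show "nnint K (\<lambda>x. (f x)\<^sup>2) \<le> ennreal (e * (nsq ?M f + nsq ?M (grad f))
        + 4 * m / c\<^sup>2 * (\<Sum>p\<in>X. (LINT z|?M. k p z * f z)\<^sup>2))"
      unfolding a_def b_def S_def .
  qed
  then show ?thesis by blast
qed

text \<open>First push the mass away from the boundary with a small \<open>t\<close>, then apply the interior bound to
  the compact set this yields.\<close>

lemma ehrling_inequality:
  fixes \<Omega> :: "(real^'d) set"
  assumes \<Omega>: "open \<Omega>" "bounded \<Omega>" and lip: "lipschitz_boundary \<Omega>" and e: "e > 0"
  shows "\<exists>X k C. finite_rank_bound \<Omega> (\<lambda>f. ennreal (nsq (lebesgue_on \<Omega>) f)) e X k C"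
proof -
  let ?M = "lebesgue_on \<Omega>"
  obtain N t0 where t0: "t0 > 0" and N: "\<forall>t. 0 < t \<longrightarrow> t < t0 \<longrightarrow> (\<exists>K. boundary_reduction \<Omega> N t K)"
    using boundary_reduction_exists[OF \<Omega> lip] by blast
  define N' where "N' = real N + 1"
  have N': "N' > 0" "real N \<le> N'" by (auto simp: N'_def)
  define e' where "e' = e / (2 * N')"
  have e': "e' > 0" using e N' by (simp add: e'_def)
  define t where "t = min (t0 / 2) (min 1 e')"
  have t: "0 < t" "t < t0" "t \<le> 1" "t \<le> e'" using t0 e' by (auto simp: t_def)
  have tt: "t\<^sup>2 \<le> e'" proof -
    have "t * t \<le> t * 1" using t by (intro mult_left_mono) auto
    then show ?thesis using t(4) by (simp add: power2_eq_square)
  qed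
  obtain K where bK: "boundary_reduction \<Omega> N t K" using N t(1,2) by blast
  then have K: "compact K" "K \<subseteq> \<Omega>" by (simp_all add: boundary_reduction_def)
  have est: "nnint \<Omega> (\<lambda>x. (f x)\<^sup>2) \<le> of_nat N * (nnint K (\<lambda>x. (f x)\<^sup>2)
         + ennreal (t\<^sup>2) * nnint \<Omega> (\<lambda>x. (norm (grad f x))\<^sup>2))" if "Cinf f" for f
    using bK that by (simp add: boundary_reduction_def)
  obtain X k C where frb: "finite_rank_bound \<Omega> (\<lambda>f. nnint K (\<lambda>x. (f x)\<^sup>2)) e' X k C"
    using interior_finite_rank_bound[OF \<Omega> K e'] by blast
  note X = finite_rank_boundD(1-3)[OF frb] and int = finite_rank_boundD(4)[OF frb]
  have "finite_rank_bound \<Omega> (\<lambda>f. ennreal (nsq ?M f)) e X k (N' * C)"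
    unfolding finite_rank_bound_def
  proof (intro conjI allI impI)
    show "finite X" "continuous_on UNIV (k p)" for p by (fact X)+
    show "0 \<le> N' * C" using X N' by simp
    fix f :: "real^'d \<Rightarrow> real" assume f: "Cinf f"
    define a where "a = nsq ?M f"
    define b where "b = nsq ?M (grad f)"
    define S where "S = (\<Sum>p\<in>X. (LINT z|?M. k p z * f z)\<^sup>2)"
    have nn: "a \<ge> 0" "b \<ge> 0" "S \<ge> 0" by (auto simp: a_def b_def S_def intro: sum_nonneg)
    have "ennreal a = nnint \<Omega> (\<lambda>x. (f x)\<^sup>2)"
      using ennreal_nsq_eq_nnint[OF Cinf_continuous[OF f] \<Omega>] by (simp add: a_def)
    also have "\<dots> \<le> of_nat N * (nnint K (\<lambda>x. (f x)\<^sup>2) + ennreal (t\<^sup>2) * ennreal b)"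
      using est[OF f] ennreal_nsq_eq_nnint[OF continuous_grad[OF f] \<Omega>] by (simp add: b_def)
    also have "\<dots> \<le> of_nat N * (ennreal (e' * (a + b) + C * S) + ennreal (t\<^sup>2) * ennreal b)"
      using int[OF f] by (intro mult_left_mono add_mono) (auto simp: a_def b_def S_def)
    also have "\<dots> = ennreal (real N * (e' * (a + b) + C * S + t\<^sup>2 * b))"
      using nn X(3) e' by (simp add: ennreal_of_nat_eq_real_of_nat flip: ennreal_mult ennreal_plus)
    finally have "a \<le> real N * (e' * (a + b) + C * S + t\<^sup>2 * b)"
      by (subst (asm) ennreal_le_iff) (use nn X(3) e' in auto)
    also have "\<dots> \<le> N' * (e' * (a + b) + C * S + e' * (a + b))"
    proof (rule mult_mono[OF N'(2)])
      have "t\<^sup>2 * b \<le> e' * (a + b)" using tt nn e' by (intro mult_mono) auto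
      then show "e' * (a + b) + C * S + t\<^sup>2 * b \<le> e' * (a + b) + C * S + e' * (a + b)" by simp
    qed (use nn X(3) e' N' in auto)
    also have "\<dots> = e * (a + b) + N' * C * S"
      using N' by (simp add: e'_def field_simps)
    finally show "ennreal (nsq ?M f) \<le> ennreal (e * (nsq ?M f + nsq ?M (grad f)) + N' * C * (\<Sum>p\<in>X. (LINT z|?M. k p z * f z)\<^sup>2))"
      unfolding a_def b_def S_def by (rule ennreal_leI)
  qed
  then show ?thesis by blast
qed

lemma finite_family_convergent_subsequence:
  fixes l :: "'i \<Rightarrow> nat \<Rightarrow> real"
  assumes "finite X" "\<And>p. p \<in> X \<Longrightarrow> bounded (range (l p))"
  shows "\<exists>r. strict_mono r \<and> (\<forall>p\<in>X. convergent (\<lambda>n. l p (r n)))"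
  using assms
proof (induction X rule: finite_induct)
  case empty
  show ?case by (rule exI[of _ id]) (simp add: strict_mono_def)
next
  case (insert q X)
  then obtain r where r: "strict_mono r" "\<forall>p\<in>X. convergent (\<lambda>n. l p (r n))" by auto
  have "bounded (range (\<lambda>n. l q (r n)))"
    by (rule bounded_subset[OF insert.prems[OF insertI1]]) auto
  then obtain L s where s: "strict_mono s" "(\<lambda>n. l q (r (s n))) \<longlonglongrightarrow> L"
    using bounded_imp_convergent_subsequence[of "\<lambda>n. l q (r n)"] by (auto simp: o_def)
  have "convergent (\<lambda>n. l p (r (s n)))" if "p \<in> X" for p
    using r(2) that s(1) convergent_subseq_convergent[of "\<lambda>n. l p (r n)" s] by (auto simp: o_def)
  moreover have "convergent (\<lambda>n. l q (r (s n)))" using s(2) by (auto simp: convergent_def)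
  ultimately have "\<forall>p\<in>insert q X. convergent (\<lambda>n. l p ((r \<circ> s) n))" by simp
  then show ?case using strict_mono_o[OF r(1) s(1)] by blast
qed

text \<open>A subsequence along which the countably many functionals of the Ehrling inequalities
  converge is Cauchy in \<open>L\<^sup>2\<close>.\<close>

lemma rellich:
  fixes \<Omega> :: "(real^'d) set" and f :: "nat \<Rightarrow> real^'d \<Rightarrow> real"
  assumes \<Omega>: "open \<Omega>" "bounded \<Omega>" and lip: "lipschitz_boundary \<Omega>"
    and f: "\<And>n. Cinf (f n)"
    and B: "\<And>n. nsq (lebesgue_on \<Omega>) (f n) + nsq (lebesgue_on \<Omega>) (grad (f n)) \<le> B"
  shows "\<exists>r. strict_mono r \<and> L2_Cauchy (lebesgue_on \<Omega>) (\<lambda>n. f (r n))"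
proof -
  let ?M = "lebesgue_on \<Omega>"
  have L: "L2 ?M (f n)" "L2 ?M (grad (f n))" for n
    by (rule continuous_L2[OF Cinf_continuous[OF f] \<Omega>], rule continuous_L2[OF continuous_grad[OF f] \<Omega>])
  have "\<forall>j. \<exists>X k C. finite_rank_bound \<Omega> (\<lambda>f. ennreal (nsq ?M f)) (inverse (real (Suc j))) X k C"
    by (intro allI ehrling_inequality[OF \<Omega> lip]) simp
  then obtain X k C where E: "\<And>j. finite_rank_bound \<Omega> (\<lambda>f. ennreal (nsq ?M f)) (inverse (real (Suc j))) (X j) (k j) (C j)"
    by metis
  note X = finite_rank_boundD(1-3)[OF E]
  have ehr: "nsq ?M g \<le> inverse (real (Suc j)) * (nsq ?M g + nsq ?M (grad g))
        + C j * (\<Sum>p\<in>X j. (LINT z|?M. k j p z * g z)\<^sup>2)" if "Cinf g" for g j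
    by (rule ennreal_le_iff[THEN iffD1, OF _ finite_rank_boundD(4)[OF E that]])
      (auto intro!: add_nonneg_nonneg mult_nonneg_nonneg sum_nonneg X(3))
  have Lk: "L2 ?M (k j p)" for j p by (rule continuous_L2[OF X(2) \<Omega>])
  have bdd: "bounded (range (\<lambda>n. LINT z|?M. k j p z * f (s n) z))" for j p s
  proof (rule boundedI)
    fix y assume "y \<in> range (\<lambda>n. LINT z|?M. k j p z * f (s n) z)"
    then obtain n where y: "y = (LINT z|?M. k j p z \<bullet> f (s n) z)" by auto
    have "y\<^sup>2 \<le> nsq ?M (k j p) * nsq ?M (f (s n))" unfolding y by (rule integral_cauchy_schwarz[OF Lk L(1)])
    also have "\<dots> \<le> nsq ?M (k j p) * B" proof (rule mult_left_mono)
      show "nsq ?M (f (s n)) \<le> B" using B[of "s n"] nsq_nonneg[of ?M "grad (f (s n))"] by linarith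
    qed simp
    finally have "sqrt (y\<^sup>2) \<le> sqrt (nsq ?M (k j p) * B)" by (rule real_sqrt_le_mono)
    then show "norm y \<le> sqrt (nsq ?M (k j p) * B)" by simp
  qed
  interpret subseqs "\<lambda>j s. \<forall>p\<in>X j. convergent (\<lambda>n. LINT z|?M. k j p z * f (s n) z)"
  proof
    fix j and s :: "nat \<Rightarrow> nat"
    show "\<exists>r'. strict_mono r' \<and> (\<forall>p\<in>X j. convergent (\<lambda>n. LINT z|?M. k j p z * f ((s \<circ> r') n) z))"
      unfolding o_apply
      by (rule finite_family_convergent_subsequence[where l = "\<lambda>p n. LINT z|?M. k j p z * f (s n) z", OF X(1) bdd])
  qed
  have conv: "convergent (\<lambda>n. LINT z|?M. k j p z * f (diagseq n) z)" if "p \<in> X j" for j p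
  proof -
    have "\<forall>p\<in>X j. convergent (\<lambda>n. LINT z|?M. k j p z * f ((diagseq \<circ> (+) (Suc j)) n) z)"
    proof (rule diagseq_holds)
      fix r s j assume "strict_mono (r::nat\<Rightarrow>nat)" "\<forall>p\<in>X j. convergent (\<lambda>n. LINT z|?M. k j p z * f (s n) z)"
      then show "\<forall>p\<in>X j. convergent (\<lambda>n. LINT z|?M. k j p z * f ((s \<circ> r) n) z)"
        using convergent_subseq_convergent[of "\<lambda>n. LINT z|?M. k j p z * f (s n) z" r for p] by (auto simp: o_def)
    qed
    then have "convergent (\<lambda>n. LINT z|?M. k j p z * f (diagseq (n + Suc j)) z)"
      using that by (simp add: add.commute)
    then show ?thesis by (rule convergent_ignore_initial_segment[THEN iffD1, rotated -1])
  qed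
  have "L2_Cauchy ?M (\<lambda>n. f (diagseq n))"
    unfolding L2_Cauchy_def
  proof (intro allI impI)
    fix e :: real assume e: "e > 0"
    have B0: "B \<ge> 0" using B[of 0] nsq_nonneg[of ?M "f 0"] nsq_nonneg[of ?M "grad (f 0)"] by linarith
    obtain j where j: "inverse (real (Suc j)) * (4 * B) < e / 2"
    proof -
      obtain j where "inverse (real (Suc j)) < e / (2 * (4 * B + 1))"
        using reals_Archimedean[of "e / (2 * (4 * B + 1))"] e B0 by auto
      then have "inverse (real (Suc j)) * (4 * B + 1) < e / 2" using B0 by (simp add: field_simps)
      moreover have "inverse (real (Suc j)) * (4 * B) \<le> inverse (real (Suc j)) * (4 * B + 1)"
        by (intro mult_left_mono) auto
      ultimately have "inverse (real (Suc j)) * (4 * B) < e / 2" by linarith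
      then show ?thesis by (rule that)
    qed
    define l where "l p n = (LINT z|?M. k j p z * f (diagseq n) z)" for p n
    define \<eta> where "\<eta> = e / (2 * (C j * real (card (X j)) + 1))"
    have \<eta>: "\<eta> > 0" using e X(3)[of j] by (simp add: \<eta>_def add_nonneg_pos)
    have "\<forall>p\<in>X j. \<exists>N. \<forall>m\<ge>N. \<forall>n\<ge>N. \<bar>l p m - l p n\<bar> < sqrt \<eta>"
    proof
      fix p assume "p \<in> X j"
      then have "Cauchy (l p)" using conv[of p j] by (simp add: l_def[abs_def] convergent_Cauchy)
      then show "\<exists>N. \<forall>m\<ge>N. \<forall>n\<ge>N. \<bar>l p m - l p n\<bar> < sqrt \<eta>"
        using \<eta> by (auto simp: Cauchy_def dist_real_def)
    qed
    then obtain Np where Np: "\<And>p m n. p \<in> X j \<Longrightarrow> m \<ge> Np p \<Longrightarrow> n \<ge> Np p \<Longrightarrow> \<bar>l p m - l p n\<bar> < sqrt \<eta>"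
      by metis
    \<comment> \<open>A common bound for the finitely many thresholds; a sum serves as well as a maximum and also
      covers empty \<open>X j\<close>.\<close>
    define N where "N = (\<Sum>p\<in>X j. Np p)"
    have NN: "Np p \<le> N" if "p \<in> X j" for p unfolding N_def using that X(1) by (intro member_le_sum) auto
    have "nsq ?M (\<lambda>x. f (diagseq m) x - f (diagseq n) x) < e" if mn: "m \<ge> N" "n \<ge> N" for m n
    proof -
      define g where "g x = 1 * f (diagseq m) x + (-1) * f (diagseq n) x" for x
      have g: "Cinf g" unfolding g_def by (rule Cinf_lincomb[OF f f])
      have g_eq: "g = (\<lambda>x. f (diagseq m) x - f (diagseq n) x)" by (simp add: g_def fun_eq_iff)
      have gg: "grad g = (\<lambda>x. grad (f (diagseq m)) x - grad (f (diagseq n)) x)"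
        unfolding g_def fun_eq_iff using grad_lincomb[OF f f, where a = 1 and b = "-1"] by simp
      have "nsq ?M g + nsq ?M (grad g) \<le> 4 * B"
        using nsq_diff_le[OF L(1)[of "diagseq m"] L(1)[of "diagseq n"]] nsq_diff_le[OF L(2)[of "diagseq m"] L(2)[of "diagseq n"]]
          B[of "diagseq m"] B[of "diagseq n"] unfolding g_eq[symmetric] gg[symmetric] by linarith
      then have "inverse (real (Suc j)) * (nsq ?M g + nsq ?M (grad g)) \<le> inverse (real (Suc j)) * (4 * B)"
        by (rule mult_left_mono) simp
      with j have 1: "inverse (real (Suc j)) * (nsq ?M g + nsq ?M (grad g)) < e / 2" by linarith
      have "(LINT z|?M. k j p z * g z)\<^sup>2 \<le> \<eta>" if p: "p \<in> X j" for p
      proof -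
        have "(LINT z|?M. k j p z * g z) = l p m - l p n"
          using L2_inner_integrable[OF Lk[of j p] L(1)] by (simp add: l_def g_eq right_diff_distrib)
        moreover have "\<bar>l p m - l p n\<bar> \<le> sqrt \<eta>" using Np[OF p] NN[OF p] mn by (meson less_imp_le order_trans)
        then have "\<bar>l p m - l p n\<bar>\<^sup>2 \<le> (sqrt \<eta>)\<^sup>2" by (intro power_mono) auto
        ultimately show ?thesis using \<eta> by simp
      qed
      then have "C j * (\<Sum>p\<in>X j. (LINT z|?M. k j p z * g z)\<^sup>2) \<le> C j * (\<Sum>p\<in>X j. \<eta>)"
        by (intro mult_left_mono sum_mono X(3))
      also have "\<dots> \<le> e / 2"
      proof -
        have "(C j * real (card (X j))) * \<eta> \<le> (C j * real (card (X j)) + 1) * \<eta>" using \<eta> by (intro mult_right_mono) auto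
        also have "\<dots> = e / 2"
        proof -
          have "C j * real (card (X j)) + 1 \<noteq> 0" using X(3)[of j] by (metis add_nonneg_pos less_irrefl mult_nonneg_nonneg of_nat_0_le_iff zero_less_one)
          then show ?thesis unfolding \<eta>_def by (simp add: field_simps)
        qed
        finally show ?thesis by (simp add: mult.assoc)
      qed
      finally have "nsq ?M g < e" using ehr[OF g, of j] 1 by linarith
      then show ?thesis unfolding g_eq .
    qed
    then show "\<exists>N. \<forall>m\<ge>N. \<forall>n\<ge>N. nsq ?M (\<lambda>x. f (diagseq m) x - f (diagseq n) x) < e" by blast
  qed
  with subseq_diagseq show ?thesis by blast
qed

section \<open>Finiteness of the surface measure\<close>

text \<open>The set has upper Minkowski content of dimension \<open>s\<close> at most of order \<open>C\<close>.\<close>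

definition covering_bound :: "nat \<Rightarrow> 'a::metric_space set \<Rightarrow> real \<Rightarrow> bool" where
  "covering_bound s A C \<longleftrightarrow> (\<forall>\<epsilon>. 0 < \<epsilon> \<longrightarrow> \<epsilon> \<le> 1 \<longrightarrow>
    (\<exists>Y. finite Y \<and> real (card Y) * \<epsilon> ^ s \<le> C \<and> A \<subseteq> (\<Union>y\<in>Y. ball y \<epsilon>)))"

lemma covering_bound_Un:
  assumes "covering_bound s A C" "covering_bound s B D"
  shows "covering_bound s (A \<union> B) (C + D)"
  unfolding covering_bound_def
proof (intro allI impI)
  fix \<epsilon> :: real assume e: "0 < \<epsilon>" "\<epsilon> \<le> 1"
  obtain Y where Y: "finite Y" "real (card Y) * \<epsilon> ^ s \<le> C" "A \<subseteq> (\<Union>y\<in>Y. ball y \<epsilon>)"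
    using assms(1) e unfolding covering_bound_def by blast
  obtain Z where Z: "finite Z" "real (card Z) * \<epsilon> ^ s \<le> D" "B \<subseteq> (\<Union>y\<in>Z. ball y \<epsilon>)"
    using assms(2) e unfolding covering_bound_def by blast
  have "real (card (Y \<union> Z)) * \<epsilon> ^ s \<le> (real (card Y) + real (card Z)) * \<epsilon> ^ s"
    using card_Un_le[of Y Z] e by (intro mult_right_mono) auto
  then have "finite (Y \<union> Z) \<and> real (card (Y \<union> Z)) * \<epsilon> ^ s \<le> C + D \<and> A \<union> B \<subseteq> (\<Union>y\<in>Y \<union> Z. ball y \<epsilon>)"
    using Y Z by (auto simp: distrib_right)
  then show "\<exists>Y. finite Y \<and> real (card Y) * \<epsilon> ^ s \<le> C + D \<and> A \<union> B \<subseteq> (\<Union>y\<in>Y. ball y \<epsilon>)" by blast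
qed

lemma covering_bound_UN:
  assumes "finite X" "\<And>x. x \<in> X \<Longrightarrow> \<exists>C. covering_bound s (A x) C"
  shows "\<exists>C. covering_bound s (\<Union>x\<in>X. A x) C"
  using assms
proof (induction X rule: finite_induct)
  case empty
  have "covering_bound s {} 0" unfolding covering_bound_def by (auto intro!: exI[of _ "{}"])
  then show ?case by auto
next
  case (insert x X)
  then obtain C D where "covering_bound s (A x) C" "covering_bound s (\<Union>x\<in>X. A x) D" by blast
  from covering_bound_Un[OF this] show ?case by auto
qed

lemma hausdorff_outer_le:
  fixes A :: "'a::metric_space set"
  assumes "covering_bound s A C"
  shows "hausdorff_outer s A \<le> ennreal (unit_ball_vol (real s) * C)"
  unfolding hausdorff_outer_def
proof (rule SUP_least)
  fix \<delta> :: real assume "\<delta> \<in> {0<..}"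
  define \<epsilon> where "\<epsilon> = min (\<delta> / 2) 1"
  have e: "0 < \<epsilon>" "\<epsilon> \<le> 1" "2 * \<epsilon> \<le> \<delta>" using \<open>\<delta> \<in> {0<..}\<close> by (auto simp: \<epsilon>_def)
  obtain Y where Y: "finite Y" "real (card Y) * \<epsilon> ^ s \<le> C" "A \<subseteq> (\<Union>y\<in>Y. ball y \<epsilon>)"
    using assms e unfolding covering_bound_def by blast
  obtain y where y: "bij_betw y {0..<card Y} Y" using ex_bij_betw_nat_finite[OF Y(1)] by blast
  define U where "U i = (if i < card Y then ball (y i) \<epsilon> else {})" for i
  have diam: "diameter (ball z \<epsilon>) \<le> 2 * \<epsilon>" for z :: 'a
  proof (cases "ball z \<epsilon> = {}")
    case False
    then have "(SUP (v, w)\<in>ball z \<epsilon> \<times> ball z \<epsilon>. dist v w) \<le> 2 * \<epsilon>"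
    proof (intro cSUP_least)
      fix vw assume "vw \<in> ball z \<epsilon> \<times> ball z \<epsilon>"
      then show "(case vw of (v, w) \<Rightarrow> dist v w) \<le> 2 * \<epsilon>"
        using dist_triangle2[of "fst vw" "snd vw" z] by (auto simp: dist_commute)
    qed auto
    then show ?thesis using False by (simp add: diameter_def)
  qed (use e in \<open>simp add: diameter_def\<close>)
  have Yi: "Y = y ` {0..<card Y}" using y by (simp add: bij_betw_def)
  have cov: "A \<subseteq> (\<Union>i. U i)"
  proof
    fix a assume "a \<in> A"
    then obtain z where "z \<in> Y" "a \<in> ball z \<epsilon>" using Y(3) by blast
    moreover have "z \<in> y ` {0..<card Y}" using \<open>z \<in> Y\<close> by (subst (asm) Yi)
    ultimately obtain i where "i < card Y" "a \<in> ball (y i) \<epsilon>" by auto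
    then show "a \<in> (\<Union>i. U i)" by (auto simp: U_def)
  qed
  have ok: "bounded (U i) \<and> diameter (U i) \<le> \<delta>" for i
    using diam[of "y i"] e by (auto simp: U_def)
  have "(INF C\<in>{C :: nat \<Rightarrow> 'a set. A \<subseteq> (\<Union>i. C i) \<and> (\<forall>i. bounded (C i) \<and> diameter (C i) \<le> \<delta>)}.
         \<Sum>i. if C i = {} then 0 else ennreal (unit_ball_vol (real s) * (diameter (C i) / 2) ^ s))
      \<le> (\<Sum>i. if U i = {} then 0 else ennreal (unit_ball_vol (real s) * (diameter (U i) / 2) ^ s))"
    using cov ok by (intro INF_lower) auto
  also have "\<dots> = (\<Sum>i<card Y. if U i = {} then 0 else ennreal (unit_ball_vol (real s) * (diameter (U i) / 2) ^ s))"
    by (rule suminf_finite) (auto simp: U_def)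
  also have "\<dots> \<le> (\<Sum>i<card Y. ennreal (unit_ball_vol (real s) * \<epsilon> ^ s))"
  proof (rule sum_mono)
    fix i assume i: "i \<in> {..<card Y}"
    have "(diameter (U i) / 2) ^ s \<le> \<epsilon> ^ s"
      using diam[of "y i"] i diameter_ge_0[of "ball (y i) \<epsilon>"] by (intro power_mono) (auto simp: U_def)
    then show "(if U i = {} then 0 else ennreal (unit_ball_vol (real s) * (diameter (U i) / 2) ^ s))
        \<le> ennreal (unit_ball_vol (real s) * \<epsilon> ^ s)"
      by (auto intro!: ennreal_leI mult_left_mono unit_ball_vol_nonneg)
  qed
  also have "\<dots> = ennreal (unit_ball_vol (real s) * (real (card Y) * \<epsilon> ^ s))"
    using e by (simp add: ennreal_of_nat_eq_real_of_nat mult.left_commute unit_ball_vol_nonneg flip: ennreal_mult)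
  also have "\<dots> \<le> ennreal (unit_ball_vol (real s) * C)"
    using Y(2) by (intro ennreal_leI mult_left_mono unit_ball_vol_nonneg) auto
  finally show "(INF C\<in>{C :: nat \<Rightarrow> 'a set. A \<subseteq> (\<Union>i. C i) \<and> (\<forall>i. bounded (C i) \<and> diameter (C i) \<le> \<delta>)}.
         \<Sum>i. if C i = {} then 0 else ennreal (unit_ball_vol (real s) * (diameter (C i) / 2) ^ s))
      \<le> ennreal (unit_ball_vol (real s) * C)" .
qed

text \<open>A point of a Lipschitz graph is determined up to the factor \<open>1 + L\<close> by its component
  orthogonal to the direction of the graph, so stacking balls above separated points of the graph
  keeps them disjoint, and comparing volumes gains one power of the radius.\<close>

lemma lipschitz_graph_packing:
  fixes Y :: "(real^'d) set"
  assumes n: "norm n = 1" and \<gamma>: "L-lipschitz_on UNIV \<gamma>"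
    and graph: "\<And>y. y \<in> Y \<Longrightarrow> y \<in> ball x r \<and> y \<bullet> n = \<gamma> (y - (y \<bullet> n) *\<^sub>R n)"
    and Y: "finite Y" "\<And>y z. y \<in> Y \<Longrightarrow> z \<in> Y \<Longrightarrow> y \<noteq> z \<Longrightarrow> \<epsilon> \<le> dist y z"
    and e: "0 < \<epsilon>" "\<epsilon> \<le> 1" and r: "r > 0"
  shows "real (card Y) * \<epsilon> ^ (CARD('d) - 1) \<le> (2 * (r + 3)) ^ CARD('d) * (1 + L) ^ (CARD('d) - 1)"
proof -
  define s where "s = CARD('d) - 1"
  have d: "CARD('d) = Suc s" by (simp add: s_def)
  have L: "L \<ge> 0" using \<gamma> by (rule lipschitz_on_nonneg)
  define \<eta> where "\<eta> = \<epsilon> / (1 + L)"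
  have \<eta>: "0 < \<eta>" "\<eta> \<le> 1" "\<epsilon> = \<eta> * (1 + L)" using e L by (auto simp: \<eta>_def field_simps)
  have nn: "n \<bullet> n = 1" using n by (simp add: norm_eq_1)
  define \<pi> where "\<pi> y = y - (y \<bullet> n) *\<^sub>R n" for y
  have \<pi>_diff: "\<pi> (y - z) = \<pi> y - \<pi> z" for y z by (simp add: \<pi>_def algebra_simps)
  have \<pi>_n: "\<pi> (y + c *\<^sub>R n) = \<pi> y" for y c by (simp add: \<pi>_def inner_add_left nn algebra_simps)
  have \<pi>_norm: "norm (\<pi> y) \<le> norm y" for y
  proof -
    have "(norm (\<pi> y))\<^sup>2 = (norm y)\<^sup>2 - (y \<bullet> n)\<^sup>2"
      unfolding power2_norm_eq_inner
      by (simp add: \<pi>_def inner_diff_left inner_diff_right nn inner_commute[of n y] power2_eq_square[of "y \<bullet> n"])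
    then have "(norm (\<pi> y))\<^sup>2 \<le> (norm y)\<^sup>2" by simp
    then show ?thesis by (rule power2_le_imp_le) simp
  qed
  have sep: "\<eta> \<le> norm (\<pi> y - \<pi> z)" if "y \<in> Y" "z \<in> Y" "y \<noteq> z" for y z
  proof -
    have "y - z = (\<pi> y - \<pi> z) + (y \<bullet> n - z \<bullet> n) *\<^sub>R n" by (simp add: \<pi>_def algebra_simps)
    then have "norm (y - z) \<le> norm (\<pi> y - \<pi> z) + \<bar>y \<bullet> n - z \<bullet> n\<bar>"
      using norm_triangle_ineq[of "\<pi> y - \<pi> z" "(y \<bullet> n - z \<bullet> n) *\<^sub>R n"] n by simp
    moreover have "\<bar>y \<bullet> n - z \<bullet> n\<bar> \<le> L * norm (\<pi> y - \<pi> z)"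
      using lipschitz_onD[OF \<gamma>, of "\<pi> y" "\<pi> z"] graph[OF that(1)] graph[OF that(2)]
      by (simp add: dist_norm \<pi>_def)
    ultimately have "\<epsilon> \<le> (1 + L) * norm (\<pi> y - \<pi> z)"
      using Y(2)[OF that] by (simp add: dist_norm algebra_simps)
    then show ?thesis using L by (simp add: \<eta>(3) mult.commute)
  qed
  \<comment> \<open>About \<open>1 / \<eta>\<close> balls of diameter \<open>\<eta>\<close> are stacked above each point, filling height one.\<close>
  define K where "K = nat \<lceil>1 / \<eta>\<rceil>"
  have K: "1 \<le> real K * \<eta>" "real K * \<eta> \<le> 2"
  proof -
    have "1 / \<eta> \<le> real K" unfolding K_def by linarith
    then show "1 \<le> real K * \<eta>" using \<eta> by (simp add: field_simps)
    have "0 < 1 / \<eta>" using \<eta> by simp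
    then have "real K \<le> 1 / \<eta> + 1" unfolding K_def by linarith
    then have "real K * \<eta> \<le> (1 / \<eta> + 1) * \<eta>" using \<eta> by (intro mult_right_mono) auto
    also have "\<dots> \<le> 2" using \<eta> by (simp add: field_simps)
    finally show "real K * \<eta> \<le> 2" .
  qed
  define B where "B p = ball (fst p + (real (snd p) * \<eta>) *\<^sub>R n) (\<eta> / 2)" for p :: "(real^'d) \<times> nat"
  let ?I = "Y \<times> {..<K}"
  have disj: "disjoint_family_on B ?I"
    unfolding disjoint_family_on_def
  proof (intro ballI impI)
    fix p p' assume p: "p \<in> ?I" "p' \<in> ?I" "p \<noteq> p'"
    obtain y k y' k' where pp: "p = (y, k)" "p' = (y', k')" by fastforce
    let ?c = "y + (real k * \<eta>) *\<^sub>R n" and ?c' = "y' + (real k' * \<eta>) *\<^sub>R n"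
    have "\<eta> \<le> norm (?c - ?c')"
    proof (cases "y = y'")
      case True
      then have "?c - ?c' = ((real k - real k') * \<eta>) *\<^sub>R n" by (simp add: algebra_simps)
      moreover have "k \<noteq> k'" using p pp True by simp
      then have "1 \<le> \<bar>real k - real k'\<bar>" by (cases k k' rule: linorder_cases) auto
      then have "1 * \<eta> \<le> \<bar>real k - real k'\<bar> * \<eta>" using \<eta> by (intro mult_right_mono) auto
      ultimately show ?thesis using n \<eta> by (simp add: abs_mult)
    next
      case False
      then have "\<eta> \<le> norm (\<pi> y - \<pi> y')" using p pp by (intro sep) auto
      also have "\<pi> y - \<pi> y' = \<pi> (?c - ?c')" by (simp add: \<pi>_diff \<pi>_n)
      also have "norm \<dots> \<le> norm (?c - ?c')" by (rule \<pi>_norm)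
      finally show ?thesis .
    qed
    then have "ball ?c (\<eta> / 2) \<inter> ball ?c' (\<eta> / 2) = {}" by (intro disjoint_ballI) (simp add: dist_norm)
    then show "B p \<inter> B p' = {}" by (simp add: B_def pp)
  qed
  have sub: "(\<Union>p\<in>?I. B p) \<subseteq> ball x (r + 3)"
  proof
    fix z assume "z \<in> (\<Union>p\<in>?I. B p)"
    then obtain y k where yk: "y \<in> Y" "k < K" "dist (y + (real k * \<eta>) *\<^sub>R n) z < \<eta> / 2" by (auto simp: B_def)
    have "real k * \<eta> \<le> real K * \<eta>" using yk \<eta> by (intro mult_right_mono) auto
    then have "real k * \<eta> \<le> 2" using K by linarith
    then have "dist y (y + (real k * \<eta>) *\<^sub>R n) \<le> 2" using \<eta> n by (simp add: dist_norm abs_mult)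
    moreover have "dist x y < r" using graph[OF yk(1)] by simp
    moreover have "dist x z \<le> dist x y + dist y (y + (real k * \<eta>) *\<^sub>R n) + dist (y + (real k * \<eta>) *\<^sub>R n) z"
      by (smt (verit) dist_triangle)
    ultimately show "z \<in> ball x (r + 3)" using yk(3) \<eta> by simp
  qed
  have fin: "finite ?I" using Y(1) by simp
  have vol: "measure lborel (ball a \<rho>) = unit_ball_vol (real CARD('d)) * \<rho> ^ CARD('d)" if "\<rho> \<ge> 0" for a :: "real^'d" and \<rho>
    using content_ball[OF that, of a] by simp
  have "(\<Sum>p\<in>?I. measure lborel (B p)) = measure lborel (\<Union>p\<in>?I. B p)"
  proof (rule measure_UNION'[symmetric, OF fin])
    show "B p \<in> fmeasurable lborel" for p
      using emeasure_bounded_finite[OF bounded_ball] by (auto simp: B_def fmeasurable_def)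
    show "pairwise (\<lambda>p p'. disjnt (B p) (B p')) ?I"
      using disj unfolding disjoint_family_on_def pairwise_def disjnt_def by blast
  qed
  also have "\<dots> \<le> measure lborel (ball x (r + 3))"
    using sub emeasure_bounded_finite[OF bounded_ball] by (intro measure_mono_fmeasurable) (auto simp: B_def fmeasurable_def intro!: borel_open open_UN)
  finally have "real (card ?I) * (unit_ball_vol (real CARD('d)) * (\<eta> / 2) ^ CARD('d))
      \<le> unit_ball_vol (real CARD('d)) * (r + 3) ^ CARD('d)"
    using \<eta> r by (simp add: B_def vol)
  then have "unit_ball_vol (real CARD('d)) * (real (card ?I) * (\<eta> / 2) ^ CARD('d))
      \<le> unit_ball_vol (real CARD('d)) * (r + 3) ^ CARD('d)"
    by (simp only: ac_simps)
  then have "real (card ?I) * (\<eta> / 2) ^ CARD('d) \<le> (r + 3) ^ CARD('d)"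
    by (rule mult_left_le_imp_le) (simp add: unit_ball_vol_pos)
  then have "2 ^ CARD('d) * (real (card ?I) * (\<eta> / 2) ^ CARD('d)) \<le> 2 ^ CARD('d) * (r + 3) ^ CARD('d)"
    by (rule mult_left_mono) simp
  moreover have "2 ^ CARD('d) * (real (card ?I) * (\<eta> / 2) ^ CARD('d)) = real (card ?I) * \<eta> ^ CARD('d)"
    by (simp add: power_divide)
  ultimately have *: "real (card Y) * real K * \<eta> ^ Suc s \<le> (2 * (r + 3)) ^ CARD('d)"
    by (simp only: card_cartesian_product card_lessThan of_nat_mult power_mult_distrib d)
  have "real (card Y) * \<eta> ^ s = (real (card Y) * \<eta> ^ s) * 1" by simp
  also have "\<dots> \<le> (real (card Y) * \<eta> ^ s) * (real K * \<eta>)" using K \<eta> by (intro mult_left_mono) auto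
  also have "\<dots> = real (card Y) * real K * \<eta> ^ Suc s" by simp
  also note *
  finally have "real (card Y) * \<eta> ^ s * (1 + L) ^ s \<le> (2 * (r + 3)) ^ CARD('d) * (1 + L) ^ s"
    using L by (intro mult_right_mono) auto
  then show ?thesis unfolding s_def[symmetric] \<eta>(3) by (simp add: power_mult_distrib mult.assoc)
qed

text \<open>A separated set of largest cardinality is also a covering.\<close>

lemma maximal_separated_set:
  fixes T :: "'a::metric_space set"
  assumes "\<And>Y. finite Y \<Longrightarrow> Y \<subseteq> T \<Longrightarrow> pairwise (\<lambda>y z. \<epsilon> \<le> dist y z) Y \<Longrightarrow> card Y \<le> b" and "\<epsilon> > 0"
  shows "\<exists>Y. finite Y \<and> Y \<subseteq> T \<and> pairwise (\<lambda>y z. \<epsilon> \<le> dist y z) Y \<and> T \<subseteq> (\<Union>y\<in>Y. ball y \<epsilon>)"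
proof -
  let ?P = "\<lambda>Y. finite Y \<and> Y \<subseteq> T \<and> pairwise (\<lambda>y z. \<epsilon> \<le> dist y z) Y"
  have "\<exists>Y. ?P Y \<and> (\<forall>Z. ?P Z \<longrightarrow> card Z \<le> card Y)"
    by (rule ex_has_greatest_nat[of ?P "{}" card "Suc b"]) (use assms(1) in \<open>auto simp: less_Suc_eq_le\<close>)
  then obtain Y where Y: "finite Y" "Y \<subseteq> T" "pairwise (\<lambda>y z. \<epsilon> \<le> dist y z) Y"
    and max: "\<And>Z. finite Z \<Longrightarrow> Z \<subseteq> T \<Longrightarrow> pairwise (\<lambda>y z. \<epsilon> \<le> dist y z) Z \<Longrightarrow> card Z \<le> card Y" by blast
  have "T \<subseteq> (\<Union>y\<in>Y. ball y \<epsilon>)"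
  proof (rule subsetI, rule ccontr)
    fix t assume t: "t \<in> T" "t \<notin> (\<Union>y\<in>Y. ball y \<epsilon>)"
    then have far: "\<epsilon> \<le> dist y t" if "y \<in> Y" for y using that by (auto simp: not_less)
    have "t \<notin> Y" using far[of t] assms(2) by auto
    moreover have "card (insert t Y) \<le> card Y"
      using Y t far by (intro max) (auto simp: pairwise_insert dist_commute)
    ultimately show False using Y(1) by simp
  qed
  with Y show ?thesis by blast
qed

text \<open>Inside a chart the boundary is contained in the graph, so the packing bound applies to its
  separated subsets.\<close>

lemma frontier_patch_covering:
  fixes \<Omega> :: "(real^'d) set"
  assumes op: "open \<Omega>" and lip: "lipschitz_boundary \<Omega>" and x: "x \<in> frontier \<Omega>"
  shows "\<exists>r>0. \<exists>C. covering_bound (CARD('d) - 1) (frontier \<Omega> \<inter> ball x r) C"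
proof -
  obtain r n L \<gamma> where r: "r > 0" and n: "norm n = 1" and \<gamma>: "L-lipschitz_on UNIV \<gamma>"
    and eq: "\<Omega> \<inter> ball x r = {y \<in> ball x r. \<gamma> (y - (y \<bullet> n) *\<^sub>R n) < y \<bullet> n}"
    using bspec[OF lip[unfolded lipschitz_boundary_def] x] by blast
  have cont: "continuous_on UNIV (\<lambda>z. \<gamma> (z - (z \<bullet> n) *\<^sub>R n))"
    by (rule continuous_on_compose2[OF lipschitz_on_continuous_on[OF \<gamma>]]) (auto intro!: continuous_intros)
  have graph: "y \<bullet> n = \<gamma> (y - (y \<bullet> n) *\<^sub>R n)" if y: "y \<in> frontier \<Omega> \<inter> ball x r" for y
  proof (rule antisym)
    have "y \<notin> \<Omega>" using y op by (auto simp: frontier_def interior_open)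
    then have "y \<notin> \<Omega> \<inter> ball x r" by simp
    then show "y \<bullet> n \<le> \<gamma> (y - (y \<bullet> n) *\<^sub>R n)" unfolding eq using y by (simp add: not_less)
    show "\<gamma> (y - (y \<bullet> n) *\<^sub>R n) \<le> y \<bullet> n"
    proof (rule ccontr)
      assume below: "\<not> \<gamma> (y - (y \<bullet> n) *\<^sub>R n) \<le> y \<bullet> n"
      define U where "U = ball x r \<inter> {z. z \<bullet> n < \<gamma> (z - (z \<bullet> n) *\<^sub>R n)}"
      have "open U" unfolding U_def by (intro open_Int open_ball open_Collect_less continuous_intros cont)
      moreover have "y \<in> U" using y below by (simp add: U_def)
      moreover have "U \<inter> \<Omega> = {}"
      proof -
        have "U \<inter> \<Omega> = U \<inter> (\<Omega> \<inter> ball x r)" by (auto simp: U_def)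
        then show ?thesis unfolding eq by (auto simp: U_def)
      qed
      ultimately have "y \<notin> closure \<Omega>" by (metis IntI closure_iff_nhds_not_empty empty_iff inf_commute order_refl)
      then show False using y by (simp add: frontier_def)
    qed
  qed
  let ?s = "CARD('d) - 1" and ?T = "frontier \<Omega> \<inter> ball x r"
  let ?C = "(2 * (r + 3)) ^ CARD('d) * (1 + L) ^ ?s"
  have "covering_bound ?s ?T ?C"
    unfolding covering_bound_def
  proof (intro allI impI)
    fix \<epsilon> :: real assume e: "0 < \<epsilon>" "\<epsilon> \<le> 1"
    have bound: "real (card Y) * \<epsilon> ^ ?s \<le> ?C"
      if "finite Y" "Y \<subseteq> ?T" "pairwise (\<lambda>y z. \<epsilon> \<le> dist y z) Y" for Y
      by (rule lipschitz_graph_packing[OF n \<gamma> _ that(1) _ e r])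
        (use that graph in \<open>auto simp: pairwise_def subset_eq\<close>)
    have "\<exists>Y. finite Y \<and> Y \<subseteq> ?T \<and> pairwise (\<lambda>y z. \<epsilon> \<le> dist y z) Y \<and> ?T \<subseteq> (\<Union>y\<in>Y. ball y \<epsilon>)"
    proof (rule maximal_separated_set[OF _ e(1)])
      fix Y assume "finite Y" "Y \<subseteq> ?T" "pairwise (\<lambda>y z. \<epsilon> \<le> dist y z) Y"
      then have "real (card Y) * \<epsilon> ^ ?s \<le> ?C" by (rule bound)
      then have "real (card Y) \<le> ?C / \<epsilon> ^ ?s" using e by (simp add: pos_le_divide_eq)
      then show "card Y \<le> nat \<lceil>?C / \<epsilon> ^ ?s\<rceil>" by linarith
    qed
    then obtain Y where Y: "finite Y" "Y \<subseteq> ?T" "pairwise (\<lambda>y z. \<epsilon> \<le> dist y z) Y" "?T \<subseteq> (\<Union>y\<in>Y. ball y \<epsilon>)" by blast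
    then show "\<exists>Y. finite Y \<and> real (card Y) * \<epsilon> ^ ?s \<le> ?C \<and> ?T \<subseteq> (\<Union>y\<in>Y. ball y \<epsilon>)"
      using bound[OF Y(1-3)] by blast
  qed
  then show ?thesis using r by blast
qed

lemma sets_hausdorff_measure: "sets (hausdorff_measure s) = sets borel" "space (hausdorff_measure s) = UNIV"
  by (simp_all add: hausdorff_measure_def sets_measure_of_conv space_measure_of_conv)
    (metis sets.sigma_sets_eq space_borel)

text \<open>If the outer measure were not countably additive on Borel sets, \<open>measure_of\<close> would give the zero
  measure; in either case it is bounded by the outer measure, hence by the covering numbers.\<close>

lemma finite_measure_surface_measure:
  fixes \<Omega> :: "(real^'d) set"
  assumes op: "open \<Omega>" and bd: "bounded \<Omega>" and lip: "lipschitz_boundary \<Omega>"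
  shows "finite_measure (surface_measure \<Omega>)"
proof -
  let ?s = "CARD('d) - 1"
  have "\<forall>x\<in>frontier \<Omega>. \<exists>r. r > 0 \<and> (\<exists>C. covering_bound ?s (frontier \<Omega> \<inter> ball x r) C)"
    using frontier_patch_covering[OF op lip] by blast
  then obtain r where r: "\<And>x. x \<in> frontier \<Omega> \<Longrightarrow> r x > 0"
      "\<And>x. x \<in> frontier \<Omega> \<Longrightarrow> \<exists>C. covering_bound ?s (frontier \<Omega> \<inter> ball x (r x)) C" by metis
  have "compact (frontier \<Omega>)" using bd by (simp add: compact_frontier_bounded)
  then obtain X where X: "X \<subseteq> frontier \<Omega>" "finite X" "frontier \<Omega> \<subseteq> (\<Union>x\<in>X. ball x (r x))"
  proof (rule compactE_image[of _ "frontier \<Omega>" "\<lambda>x. ball x (r x)"])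
    show "frontier \<Omega> \<subseteq> (\<Union>x\<in>frontier \<Omega>. ball x (r x))" using r by force
  qed auto
  have "\<exists>C. covering_bound ?s (\<Union>x\<in>X. frontier \<Omega> \<inter> ball x (r x)) C"
    using X r(2) by (intro covering_bound_UN) auto
  moreover have "(\<Union>x\<in>X. frontier \<Omega> \<inter> ball x (r x)) = frontier \<Omega>" using X(3) by blast
  ultimately obtain C where "covering_bound ?s (frontier \<Omega>) C" by auto
  then have 1: "hausdorff_outer ?s (frontier \<Omega>) \<le> ennreal (unit_ball_vol (real ?s) * C)" by (rule hausdorff_outer_le)
  have 2: "emeasure (hausdorff_measure ?s) (frontier \<Omega>) \<le> hausdorff_outer ?s (frontier \<Omega>)"
    unfolding hausdorff_measure_def by (simp add: emeasure_measure_of_conv)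
  have fin: "emeasure (hausdorff_measure ?s) (frontier \<Omega>) < top"
    by (rule le_less_trans[OF order_trans[OF 2 1] ennreal_less_top])
  have sets: "frontier \<Omega> \<in> sets (hausdorff_measure ?s)" by (simp add: sets_hausdorff_measure)
  show ?thesis
  proof
    have sp: "space (surface_measure \<Omega>) = frontier \<Omega>"
      by (simp add: surface_measure_def space_restrict_space sets_hausdorff_measure)
    have "emeasure (surface_measure \<Omega>) (frontier \<Omega>) = emeasure (restrict_space (hausdorff_measure ?s) (frontier \<Omega>)) (frontier \<Omega>)"
    proof -
      have "frontier \<Omega> \<in> sets (restrict_space (hausdorff_measure ?s) (frontier \<Omega>))"
        using sets by (simp add: sets_restrict_space_iff sets_hausdorff_measure)
      then show ?thesis unfolding surface_measure_def by simp
    qed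
    also have "\<dots> = emeasure (hausdorff_measure ?s) (frontier \<Omega>)"
      using sets by (intro emeasure_restrict_space) (auto simp: sets_hausdorff_measure)
    finally show "emeasure (surface_measure \<Omega>) (space (surface_measure \<Omega>)) \<noteq> \<infinity>" using fin sp by simp
  qed
qed

lemma continuous_measurable_surface_measure:
  fixes f :: "real^'d \<Rightarrow> 'b::euclidean_space"
  assumes "continuous_on UNIV f" shows "f \<in> borel_measurable (surface_measure \<Omega>)"
  unfolding surface_measure_def
proof (intro measurable_completion measurable_restrict_space1)
  show "f \<in> borel_measurable (hausdorff_measure (CARD('d) - 1))"
    using borel_measurable_continuous_onI[OF assms] measurable_cong_sets[OF sets_hausdorff_measure(1) refl] by blast
qed

text \<open>From \<open>a\<^sup>2 \<le> \<delta>\<^sup>2 + \<delta>\<^sup>2\<^sup>-\<^sup>p a\<^sup>p\<close>, by cases on \<open>a \<le> \<delta>\<close>, choosing \<open>\<delta>\<close> small first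
  and \<open>n\<close> large afterwards.\<close>

lemma nn_integral_powr_exponent_decrease:
  fixes a :: "nat \<Rightarrow> 'a \<Rightarrow> real"
  assumes fin: "finite_measure M" and p: "p \<ge> 2" and a: "\<And>n. a n \<in> borel_measurable M" "\<And>n x. 0 \<le> a n x"
    and lim: "(\<lambda>n. \<integral>\<^sup>+x. ennreal (a n x powr p) \<partial>M) \<longlonglongrightarrow> 0"
  shows "(\<lambda>n. \<integral>\<^sup>+x. ennreal (a n x powr 2) \<partial>M) \<longlonglongrightarrow> 0"
proof -
  interpret finite_measure M by fact
  define m where "m = measure M (space M)"
  have em: "emeasure M (space M) = ennreal m" by (simp add: m_def emeasure_eq_measure)
  have m: "m \<ge> 0" by (simp add: m_def)
  have bound: "(\<integral>\<^sup>+x. ennreal (a n x powr 2) \<partial>M) \<le> ennreal (\<delta> powr 2 * m) + ennreal (\<delta> powr (2 - p)) * (\<integral>\<^sup>+x. ennreal (a n x powr p) \<partial>M)"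
    if d: "\<delta> > 0" for \<delta> n
  proof -
    have "(\<integral>\<^sup>+x. ennreal (a n x powr 2) \<partial>M) \<le> (\<integral>\<^sup>+x. ennreal (\<delta> powr 2) + ennreal (\<delta> powr (2 - p)) * ennreal (a n x powr p) \<partial>M)"
    proof (rule nn_integral_mono)
      fix x
      have "a n x powr 2 \<le> \<delta> powr 2 + \<delta> powr (2 - p) * a n x powr p"
      proof (cases "a n x \<le> \<delta>")
        case True
        then have "a n x powr 2 \<le> \<delta> powr 2" using a(2) by (intro powr_mono2) auto
        then show ?thesis by (simp add: add_increasing2)
      next
        case False
        then have pos: "a n x > 0" using d by simp
        have "a n x powr 2 = a n x powr (2 - p) * a n x powr p" by (simp flip: powr_add)
        also have "\<dots> \<le> \<delta> powr (2 - p) * a n x powr p"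
          using False d p by (intro mult_right_mono powr_mono2') auto
        finally show ?thesis by (simp add: add_increasing)
      qed
      then have "ennreal (a n x powr 2) \<le> ennreal (\<delta> powr 2 + \<delta> powr (2 - p) * a n x powr p)" by (rule ennreal_leI)
      then show "ennreal (a n x powr 2) \<le> ennreal (\<delta> powr 2) + ennreal (\<delta> powr (2 - p)) * ennreal (a n x powr p)"
        by (simp add: ennreal_plus ennreal_mult)
    qed
    also have "\<dots> = ennreal (\<delta> powr 2) * emeasure M (space M) + ennreal (\<delta> powr (2 - p)) * (\<integral>\<^sup>+x. ennreal (a n x powr p) \<partial>M)"
      using a(1) by (subst nn_integral_add) (auto simp: nn_integral_cmult)
    finally show ?thesis by (simp add: em ennreal_mult m)
  qed
  show ?thesis
  proof (rule order_tendstoI)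
    fix e :: ennreal assume "0 < e"
    then obtain e' :: real where e': "e' > 0" "ennreal e' < e"
      by (metis ennreal_0 ennreal_cases ennreal_less_zero_iff dense ennreal_less_top not_le top.extremum_strict less_top)
    define \<delta> where "\<delta> = sqrt (e' / (m + 1))"
    have d: "\<delta> > 0" using e' m by (simp add: \<delta>_def)
    have dm: "\<delta> powr 2 * m < e'"
    proof -
      have "\<delta> powr 2 * m = e' * (m / (m + 1))" using d e' m by (simp add: \<delta>_def)
      also have "\<dots> < e' * 1" using e' m by (intro mult_strict_left_mono) auto
      finally show ?thesis by simp
    qed
    have "(\<lambda>n. ennreal (\<delta> powr 2 * m) + ennreal (\<delta> powr (2 - p)) * (\<integral>\<^sup>+x. ennreal (a n x powr p) \<partial>M))
        \<longlonglongrightarrow> ennreal (\<delta> powr 2 * m) + ennreal (\<delta> powr (2 - p)) * 0"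
      by (intro tendsto_add tendsto_const ennreal_tendsto_cmult lim) simp
    moreover have "ennreal (\<delta> powr 2 * m) + ennreal (\<delta> powr (2 - p)) * 0 < e"
      using dm e' by (simp add: ennreal_lessI less_trans[OF _ e'(2)])
    ultimately have "\<forall>\<^sub>F n in sequentially. ennreal (\<delta> powr 2 * m) + ennreal (\<delta> powr (2 - p)) * (\<integral>\<^sup>+x. ennreal (a n x powr p) \<partial>M) < e"
      by (rule order_tendstoD)
    then show "\<forall>\<^sub>F n in sequentially. (\<integral>\<^sup>+x. ennreal (a n x powr 2) \<partial>M) < e"
      by eventually_elim (rule le_less_trans[OF bound[OF d]])
  qed simp
qed

section \<open>Functions with zero trace\<close>

lemma L2_lim_iff_powr_2:
  assumes "\<And>n. L2 M (f n)" "L2 M F"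
  shows "L2_lim M f F \<longleftrightarrow> (\<lambda>n. \<integral>\<^sup>+x. ennreal (norm (f n x - F x) powr 2) \<partial>M) \<longlonglongrightarrow> 0"
proof -
  have "(\<integral>\<^sup>+x. ennreal (norm (f n x - F x) powr 2) \<partial>M) = ennreal (nsq M (\<lambda>x. f n x - F x))" for n
    by (rule nn_integral_powr_2[OF L2_diff[OF assms]])
  moreover have "(\<lambda>n. ennreal (nsq M (\<lambda>x. f n x - F x))) \<longlonglongrightarrow> ennreal 0 \<longleftrightarrow> (\<lambda>n. nsq M (\<lambda>x. f n x - F x)) \<longlonglongrightarrow> 0"
    by (rule tendsto_ennreal_iff) auto
  ultimately show ?thesis using assms by (simp add: L2_lim_def)
qed

lemma borel_measurable_component:
  fixes V :: "'a \<Rightarrow> 'b::euclidean_space ^ 'k"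
  assumes "V \<in> borel_measurable M" shows "(\<lambda>x. V x $ i) \<in> borel_measurable M"
proof -
  have "(\<lambda>v::'b^'k. v $ i) \<in> borel_measurable borel"
    by (intro borel_measurable_continuous_onI continuous_intros)
  from measurable_compose[OF assms this] show ?thesis .
qed

lemma borel_measurable_vec1:
  fixes f :: "'a \<Rightarrow> 'b::euclidean_space"
  assumes "f \<in> borel_measurable M" shows "(\<lambda>x. (\<chi> i. f x) :: 'b^1) \<in> borel_measurable M"
proof -
  have "(\<lambda>v::'b. (\<chi> i. v) :: 'b^1) \<in> borel_measurable borel"
    by (intro borel_measurable_continuous_onI continuous_intros)
  from measurable_compose[OF assms this] show ?thesis .
qed

lemma norm_vec1: "norm ((\<chi> i. c) :: 'b::real_normed_vector ^ 1) = norm c"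
  by (simp add: norm_vec_def UNIV_1)

lemma norm_vec_1_eq: "norm (v :: 'b::real_normed_vector ^ 1) = norm (v $ 1)"
  by (simp add: norm_vec_def UNIV_1)

lemma inner_vec_1_eq: "(v :: 'b::real_inner ^ 1) \<bullet> w = v $ 1 \<bullet> w $ 1"
  by (simp add: inner_vec_def UNIV_1)

lemma L2_component:
  fixes V :: "'a \<Rightarrow> 'b::euclidean_space ^ 'k"
  assumes "L2 M V"
  shows "L2 M (\<lambda>x. V x $ i)" and "nsq M (\<lambda>x. V x $ i) \<le> nsq M V"
proof -
  have m: "(\<lambda>x. V x $ i) \<in> borel_measurable M" by (rule borel_measurable_component[OF L2_measurable[OF assms]])
  have le: "(norm (V x $ i))\<^sup>2 \<le> (norm (V x))\<^sup>2" for x by (intro power_mono Finite_Cartesian_Product.norm_nth_le) auto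
  have int: "integrable M (\<lambda>x. (norm (V x $ i))\<^sup>2)"
    by (rule Bochner_Integration.integrable_bound[OF L2_integrable[OF assms]])
      (use m le in \<open>auto simp: borel_measurable_power borel_measurable_norm\<close>)
  with m show "L2 M (\<lambda>x. V x $ i)" by (simp add: L2_def)
  show "nsq M (\<lambda>x. V x $ i) \<le> nsq M V"
    unfolding nsq_def by (rule integral_mono[OF int L2_integrable[OF assms] le])
qed

lemma L2_lim_component:
  fixes V :: "'a \<Rightarrow> 'b::euclidean_space ^ 'k"
  assumes "L2_lim M U V" shows "L2_lim M (\<lambda>n x. U n x $ i) (\<lambda>x. V x $ i)"
proof -
  have "nsq M (\<lambda>x. U n x $ i - V x $ i) \<le> nsq M (\<lambda>x. U n x - V x)" for n
    using L2_component(2)[OF L2_diff[OF L2_limD(1,2)[OF assms]], of n i] by simp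
  then have "(\<lambda>n. nsq M (\<lambda>x. U n x $ i - V x $ i)) \<longlonglongrightarrow> 0"
    by (intro tendsto_sandwich[OF always_eventually always_eventually tendsto_const L2_limD(3)[OF assms]]) auto
  then show ?thesis using assms by (simp add: L2_lim_def L2_component(1))
qed

lemma L2_vec1: "L2 M f \<Longrightarrow> L2 M (\<lambda>x. (\<chi> i. f x) :: 'b::euclidean_space ^ 1)"
  by (simp add: L2_def borel_measurable_vec1 norm_vec1)

lemma L2_integrable_finite:
  assumes "finite_measure M" "L2 M f" shows "integrable M f"
  using integrable_norm_L2(1)[OF assms, of 1] L2_measurable[OF assms(2)] by (simp add: integrable_norm_iff)

lemma AE_eq_borel_measurable_lebesgue_on:
  fixes f g :: "'a::euclidean_space \<Rightarrow> 'b::euclidean_space"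
  assumes "f \<in> borel_measurable (lebesgue_on S)" "AE x in lebesgue_on S. f x = g x" "S \<in> sets lebesgue"
  shows "g \<in> borel_measurable (lebesgue_on S)"
proof -
  have "(\<lambda>x. if x \<in> S then f x else 0) \<in> borel_measurable lebesgue"
    using assms(1,3) by (simp add: borel_measurable_if)
  moreover have "AE x in lebesgue. (if x \<in> S then f x else 0) = (if x \<in> S then g x else 0)"
    using assms(2,3) by (auto simp: AE_restrict_space_iff elim: AE_mp)
  ultimately have "(\<lambda>x. if x \<in> S then g x else 0) \<in> borel_measurable lebesgue"
    by (rule borel_measurable_AE)
  then show ?thesis using assms(3) by (simp add: borel_measurable_if)
qed

text \<open>A scalar function of zero trace together with its gradient.  Carrying the gradient along makes
  the notion linear on the nose and closed under \<open>L\<^sup>2\<close> limits, independently of the choice of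
  representatives in \<open>weak_grad\<close>.\<close>

definition zero_trace_pair :: "(real^'d) set \<Rightarrow> (real^'d \<Rightarrow> real) \<Rightarrow> (real^'d \<Rightarrow> real^'d) \<Rightarrow> bool" where
  "zero_trace_pair \<Omega> f G \<longleftrightarrow> (\<exists>\<phi>. (\<forall>n. Cinf (\<phi> n)) \<and>
     L2_lim (lebesgue_on \<Omega>) \<phi> f \<and> L2_lim (lebesgue_on \<Omega>) (\<lambda>n. grad (\<phi> n)) G \<and>
     (\<lambda>n. \<integral>\<^sup>+x. ennreal ((\<phi> n x)\<^sup>2) \<partial>surface_measure \<Omega>) \<longlonglongrightarrow> 0)"

lemma zero_trace_pair_L2:
  "zero_trace_pair \<Omega> f G \<Longrightarrow> L2 (lebesgue_on \<Omega>) f" "zero_trace_pair \<Omega> f G \<Longrightarrow> L2 (lebesgue_on \<Omega>) G"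
  unfolding zero_trace_pair_def by (auto dest: L2_limD(2))

lemma surface_nn_integral_lincomb:
  assumes "continuous_on UNIV f" "continuous_on UNIV g"
  shows "(\<integral>\<^sup>+x. ennreal ((a * f x + b * g x)\<^sup>2) \<partial>surface_measure \<Omega>) \<le>
    ennreal (2 * a\<^sup>2) * (\<integral>\<^sup>+x. ennreal ((f x)\<^sup>2) \<partial>surface_measure \<Omega>) +
    ennreal (2 * b\<^sup>2) * (\<integral>\<^sup>+x. ennreal ((g x)\<^sup>2) \<partial>surface_measure \<Omega>)"
proof -
  note [measurable] = continuous_measurable_surface_measure[OF assms(1), of \<Omega>]
    continuous_measurable_surface_measure[OF assms(2), of \<Omega>]
  have "(\<integral>\<^sup>+x. ennreal ((a * f x + b * g x)\<^sup>2) \<partial>surface_measure \<Omega>) \<le>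
    (\<integral>\<^sup>+x. ennreal (2 * a\<^sup>2) * ennreal ((f x)\<^sup>2) + ennreal (2 * b\<^sup>2) * ennreal ((g x)\<^sup>2) \<partial>surface_measure \<Omega>)"
  proof (rule nn_integral_mono)
    fix x
    have "(a * f x + b * g x)\<^sup>2 \<le> 2 * a\<^sup>2 * (f x)\<^sup>2 + 2 * b\<^sup>2 * (g x)\<^sup>2"
      using norm_add_squared_le[of "a * f x" "b * g x"] by (simp add: power_mult_distrib)
    then have "ennreal ((a * f x + b * g x)\<^sup>2) \<le> ennreal (2 * a\<^sup>2 * (f x)\<^sup>2 + 2 * b\<^sup>2 * (g x)\<^sup>2)" by (rule ennreal_leI)
    also have "\<dots> = ennreal (2 * a\<^sup>2) * ennreal ((f x)\<^sup>2) + ennreal (2 * b\<^sup>2) * ennreal ((g x)\<^sup>2)"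
      by (simp add: ennreal_plus ennreal_mult)
    finally show "ennreal ((a * f x + b * g x)\<^sup>2) \<le> ennreal (2 * a\<^sup>2) * ennreal ((f x)\<^sup>2) + ennreal (2 * b\<^sup>2) * ennreal ((g x)\<^sup>2)" .
  qed
  also have "\<dots> = ennreal (2 * a\<^sup>2) * (\<integral>\<^sup>+x. ennreal ((f x)\<^sup>2) \<partial>surface_measure \<Omega>) +
    ennreal (2 * b\<^sup>2) * (\<integral>\<^sup>+x. ennreal ((g x)\<^sup>2) \<partial>surface_measure \<Omega>)"
    by (subst nn_integral_add) (auto simp: nn_integral_cmult)
  finally show ?thesis .
qed

lemma zero_trace_pair_lincomb:
  assumes "zero_trace_pair \<Omega> f G" "zero_trace_pair \<Omega> h H"
  shows "zero_trace_pair \<Omega> (\<lambda>x. a * f x + b * h x) (\<lambda>x. a *\<^sub>R G x + b *\<^sub>R H x)"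
proof -
  let ?M = "lebesgue_on \<Omega>"
  obtain \<phi> where p: "\<And>n. Cinf (\<phi> n)" "L2_lim ?M \<phi> f" "L2_lim ?M (\<lambda>n. grad (\<phi> n)) G"
      "(\<lambda>n. \<integral>\<^sup>+x. ennreal ((\<phi> n x)\<^sup>2) \<partial>surface_measure \<Omega>) \<longlonglongrightarrow> 0"
    using assms(1) unfolding zero_trace_pair_def by auto
  obtain \<psi> where q: "\<And>n. Cinf (\<psi> n)" "L2_lim ?M \<psi> h" "L2_lim ?M (\<lambda>n. grad (\<psi> n)) H"
      "(\<lambda>n. \<integral>\<^sup>+x. ennreal ((\<psi> n x)\<^sup>2) \<partial>surface_measure \<Omega>) \<longlonglongrightarrow> 0"
    using assms(2) unfolding zero_trace_pair_def by auto
  define \<theta> where "\<theta> n x = a * \<phi> n x + b * \<psi> n x" for n x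
  have c: "Cinf (\<theta> n)" for n unfolding \<theta>_def by (rule Cinf_lincomb[OF p(1) q(1)])
  have L: "L2_lim ?M \<theta> (\<lambda>x. a * f x + b * h x)"
    using L2_lim_add[OF L2_lim_scaleR[OF p(2), of a] L2_lim_scaleR[OF q(2), of b]] by (simp add: \<theta>_def[abs_def])
  have gr: "grad (\<theta> n) = (\<lambda>x. a *\<^sub>R grad (\<phi> n) x + b *\<^sub>R grad (\<psi> n) x)" for n
    unfolding \<theta>_def fun_eq_iff by (intro allI grad_lincomb p q)
  have LG: "L2_lim ?M (\<lambda>n. grad (\<theta> n)) (\<lambda>x. a *\<^sub>R G x + b *\<^sub>R H x)"
    unfolding gr by (rule L2_lim_add[OF L2_lim_scaleR[OF p(3)] L2_lim_scaleR[OF q(3)]])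
  have B: "(\<integral>\<^sup>+x. ennreal ((\<theta> n x)\<^sup>2) \<partial>surface_measure \<Omega>) \<le>
    ennreal (2 * a\<^sup>2) * (\<integral>\<^sup>+x. ennreal ((\<phi> n x)\<^sup>2) \<partial>surface_measure \<Omega>) +
    ennreal (2 * b\<^sup>2) * (\<integral>\<^sup>+x. ennreal ((\<psi> n x)\<^sup>2) \<partial>surface_measure \<Omega>)" for n
    unfolding \<theta>_def by (intro surface_nn_integral_lincomb Cinf_continuous p q)
  have "(\<lambda>n. ennreal (2 * a\<^sup>2) * (\<integral>\<^sup>+x. ennreal ((\<phi> n x)\<^sup>2) \<partial>surface_measure \<Omega>) +
    ennreal (2 * b\<^sup>2) * (\<integral>\<^sup>+x. ennreal ((\<psi> n x)\<^sup>2) \<partial>surface_measure \<Omega>)) \<longlonglongrightarrow>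
     ennreal (2 * a\<^sup>2) * 0 + ennreal (2 * b\<^sup>2) * 0"
    by (intro tendsto_add ennreal_tendsto_cmult p q) auto
  then have T: "(\<lambda>n. ennreal (2 * a\<^sup>2) * (\<integral>\<^sup>+x. ennreal ((\<phi> n x)\<^sup>2) \<partial>surface_measure \<Omega>) +
    ennreal (2 * b\<^sup>2) * (\<integral>\<^sup>+x. ennreal ((\<psi> n x)\<^sup>2) \<partial>surface_measure \<Omega>)) \<longlonglongrightarrow> 0" by simp
  have "(\<lambda>n. \<integral>\<^sup>+x. ennreal ((\<theta> n x)\<^sup>2) \<partial>surface_measure \<Omega>) \<longlonglongrightarrow> 0"
    by (rule tendsto_sandwich[OF always_eventually always_eventually tendsto_const T]) (use B in auto)
  then show ?thesis unfolding zero_trace_pair_def using c L LG by blast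
qed

text \<open>Integration by parts passes to the \<open>L\<^sup>2\<close> limit.\<close>

lemma zero_trace_pair_weak_gradient:
  assumes \<Omega>: "open \<Omega>" "bounded \<Omega>" and pair: "zero_trace_pair \<Omega> f G" and \<psi>: "\<psi> \<in> test_functions \<Omega>"
  shows "(LINT x|lebesgue_on \<Omega>. f x * partial_deriv j \<psi> x) = - (LINT x|lebesgue_on \<Omega>. G x $ j * \<psi> x)"
proof -
  let ?M = "lebesgue_on \<Omega>"
  obtain \<phi> where p: "\<And>n. Cinf (\<phi> n)" "L2_lim ?M \<phi> f" "L2_lim ?M (\<lambda>n. grad (\<phi> n)) G"
    using pair unfolding zero_trace_pair_def by auto
  have \<psi>': "Cinf \<psi>" using \<psi> by (rule test_function_Cinf)
  have L1: "L2 ?M (partial_deriv j \<psi>)"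
    using \<psi>' Cinf_iff by (intro continuous_L2[OF _ \<Omega>] Cinf_continuous) blast
  have L2: "L2 ?M (\<lambda>x. \<psi> x *\<^sub>R (axis j 1 :: real^'a))"
    by (intro continuous_L2[OF _ \<Omega>] continuous_intros Cinf_continuous[OF \<psi>'])
  have "(\<lambda>n. LINT x|?M. \<phi> n x * partial_deriv j \<psi> x) \<longlonglongrightarrow> (LINT x|?M. f x * partial_deriv j \<psi> x)"
    using L2_lim_inner[OF p(2) L1] by simp
  moreover have "(\<lambda>n. LINT x|?M. grad (\<phi> n) x $ j * \<psi> x) \<longlonglongrightarrow> (LINT x|?M. G x $ j * \<psi> x)"
    using L2_lim_inner[OF p(3) L2] by (simp add: inner_axis mult.commute)
  then have "(\<lambda>n. - (LINT x|?M. grad (\<phi> n) x $ j * \<psi> x)) \<longlonglongrightarrow> - (LINT x|?M. G x $ j * \<psi> x)"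
    by (rule tendsto_minus)
  ultimately show ?thesis
    unfolding smooth_integration_by_parts[OF \<Omega>(1) p(1) \<psi>] by (rule LIMSEQ_unique)
qed

lemma Lp_imp_L2:
  fixes f :: "real^'d \<Rightarrow> 'b::euclidean_space"
  assumes fin: "finite_measure (lebesgue_on \<Omega>)" and p: "p \<ge> 2" and f: "Lp_on \<Omega> p f"
  shows "L2 (lebesgue_on \<Omega>) f"
  unfolding L2_def
proof
  interpret finite_measure "lebesgue_on \<Omega>" by fact
  show m: "f \<in> borel_measurable (lebesgue_on \<Omega>)" using f by (simp add: Lp_on_def)
  have "integrable (lebesgue_on \<Omega>) (\<lambda>x. 1 + norm (f x) powr p)" using f by (simp add: Lp_on_def)
  then show "integrable (lebesgue_on \<Omega>) (\<lambda>x. (norm (f x))\<^sup>2)"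
  proof (rule Bochner_Integration.integrable_bound)
    show "(\<lambda>x. (norm (f x))\<^sup>2) \<in> borel_measurable (lebesgue_on \<Omega>)" using m by simp
    show "AE x in lebesgue_on \<Omega>. norm ((norm (f x))\<^sup>2) \<le> norm (1 + norm (f x) powr p)"
    proof (rule AE_I2)
      fix x
      have "(norm (f x))\<^sup>2 \<le> 1 + norm (f x) powr p"
      proof (cases "norm (f x) \<le> 1")
        case True
        then have "(norm (f x))\<^sup>2 \<le> 1" by (simp add: power_le_one)
        then show ?thesis by (simp add: add_increasing2)
      next
        case False
        then have "(norm (f x))\<^sup>2 = norm (f x) powr 2" by (simp add: powr_numeral)
        also have "\<dots> \<le> norm (f x) powr p" using False p by (intro powr_mono) auto
        finally show ?thesis by simp
      qed
      then show "norm ((norm (f x))\<^sup>2) \<le> norm (1 + norm (f x) powr p)" by simp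
    qed
  qed
qed

lemma L2_imp_Lp_2:
  fixes f :: "real^'d \<Rightarrow> 'b::euclidean_space"
  assumes "L2 (lebesgue_on \<Omega>) f" shows "Lp_on \<Omega> 2 f"
proof -
  have "(\<lambda>x. norm (f x) powr 2) = (\<lambda>x. (norm (f x))\<^sup>2)" by (simp add: fun_eq_iff powr_numeral)
  then show ?thesis using assms by (simp only: Lp_on_def L2_def)
qed

lemma weak_grad_eq:
  assumes "open \<Omega>" "has_weak_gradient \<Omega> u G"
  shows "has_weak_gradient \<Omega> u (weak_grad \<Omega> u)" "AE x in lebesgue_on \<Omega>. G x = weak_grad \<Omega> u x"
proof -
  show h: "has_weak_gradient \<Omega> u (weak_grad \<Omega> u)" unfolding weak_grad_def by (rule someI[where P = "has_weak_gradient \<Omega> u", OF assms(2)])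
  show "AE x in lebesgue_on \<Omega>. G x = weak_grad \<Omega> u x" by (rule weak_gradient_unique[OF assms h])
qed

lemma sobolev_weak_grad:
  fixes u :: "real^'d \<Rightarrow> real^'k"
  assumes \<Omega>: "open \<Omega>" and u: "u \<in> sobolev \<Omega> p"
  shows "has_weak_gradient \<Omega> u (weak_grad \<Omega> u)" "Lp_on \<Omega> p (weak_grad \<Omega> u)"
proof -
  obtain G where G: "has_weak_gradient \<Omega> u G" "Lp_on \<Omega> p G" using u by (auto simp: sobolev_def)
  show "has_weak_gradient \<Omega> u (weak_grad \<Omega> u)" by (rule weak_grad_eq(1)[OF \<Omega> G(1)])
  have ae: "AE x in lebesgue_on \<Omega>. G x = weak_grad \<Omega> u x" by (rule weak_grad_eq(2)[OF \<Omega> G(1)])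
  have m: "weak_grad \<Omega> u \<in> borel_measurable (lebesgue_on \<Omega>)"
    using G(2) \<Omega> by (intro AE_eq_borel_measurable_lebesgue_on[OF _ ae]) (auto simp: Lp_on_def)
  have "AE x in lebesgue_on \<Omega>. norm (G x) powr p = norm (weak_grad \<Omega> u x) powr p"
    using ae by eventually_elim simp
  then have "integrable (lebesgue_on \<Omega>) (\<lambda>x. norm (weak_grad \<Omega> u x) powr p)"
    using G(2) m by (subst integrable_cong_AE[symmetric]) (auto simp: Lp_on_def)
  with m show "Lp_on \<Omega> p (weak_grad \<Omega> u)" by (simp add: Lp_on_def)
qed

lemma integrable_vec_nth:
  fixes f :: "'a \<Rightarrow> 'b::euclidean_space ^ 'k"
  shows "integrable M f \<Longrightarrow> integrable M (\<lambda>x. f x $ i)"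
  by (rule integrable_bounded_linear[OF bounded_linear_vec_nth])

lemma has_weak_gradient_diff:
  fixes u w :: "real^'d \<Rightarrow> real^'k"
  assumes \<Omega>: "open \<Omega>" and u: "has_weak_gradient \<Omega> u G" and w: "has_weak_gradient \<Omega> w H"
  shows "has_weak_gradient \<Omega> (\<lambda>x. w x - u x) (\<lambda>x. H x - G x)"
proof -
  have loc: "integrable (lebesgue_on K) f \<and> integrable (lebesgue_on K) F"
    if "has_weak_gradient \<Omega> f F" "compact K" "K \<subseteq> \<Omega>" for f :: "real^'d \<Rightarrow> real^'k" and F K
    using that(1)[unfolded has_weak_gradient_def, THEN conjunct1, rule_format, of K] that(2,3) by simp
  have int: "integrable (lebesgue_on \<Omega>) (\<lambda>x. f x $ i * partial_deriv j \<phi> x)"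
      "integrable (lebesgue_on \<Omega>) (\<lambda>x. F x $ i $ j * \<phi> x)"
    if f: "has_weak_gradient \<Omega> f F" and \<phi>: "\<phi> \<in> test_functions \<Omega>" for f :: "real^'d \<Rightarrow> real^'k" and F \<phi> i j
  proof -
    note K = test_function_support[OF \<phi>]
    have c: "Cinf \<phi>" by (rule test_function_Cinf[OF \<phi>])
    then have c': "Cinf (partial_deriv j \<phi>)" using Cinf_iff by blast
    show "integrable (lebesgue_on \<Omega>) (\<lambda>x. f x $ i * partial_deriv j \<phi> x)"
      by (rule integrable_mult_compact_support[OF \<Omega> K])
        (use loc[OF f K] in \<open>simp_all add: integrable_vec_nth Cinf_continuous[OF c'] partial_deriv_outside_support\<close>)
    show "integrable (lebesgue_on \<Omega>) (\<lambda>x. F x $ i $ j * \<phi> x)"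
      by (rule integrable_mult_compact_support[OF \<Omega> K])
        (use loc[OF f K] in \<open>simp_all add: integrable_vec_nth Cinf_continuous[OF c] outside_support\<close>)
  qed
  show ?thesis
    unfolding has_weak_gradient_def
  proof (intro conjI allI impI ballI)
    fix K assume "compact K \<and> K \<subseteq> \<Omega>"
    then show "integrable (lebesgue_on K) (\<lambda>x. w x - u x)" "integrable (lebesgue_on K) (\<lambda>x. H x - G x)"
      using loc[OF u] loc[OF w] by simp_all
  next
    fix \<phi> i j assume \<phi>: "\<phi> \<in> test_functions \<Omega>"
    have "(LINT x|lebesgue_on \<Omega>. (w x - u x) $ i * partial_deriv j \<phi> x)
        = (LINT x|lebesgue_on \<Omega>. w x $ i * partial_deriv j \<phi> x) - (LINT x|lebesgue_on \<Omega>. u x $ i * partial_deriv j \<phi> x)"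
      using int(1)[OF u \<phi>] int(1)[OF w \<phi>] by (simp add: left_diff_distrib)
    also have "\<dots> = - ((LINT x|lebesgue_on \<Omega>. H x $ i $ j * \<phi> x) - (LINT x|lebesgue_on \<Omega>. G x $ i $ j * \<phi> x))"
      unfolding has_weak_gradient_test[OF u \<phi>] has_weak_gradient_test[OF w \<phi>] by simp
    also have "\<dots> = - (LINT x|lebesgue_on \<Omega>. (H x - G x) $ i $ j * \<phi> x)"
      using int(2)[OF u \<phi>] int(2)[OF w \<phi>] by (simp add: left_diff_distrib)
    finally show "(LINT x|lebesgue_on \<Omega>. (w x - u x) $ i * partial_deriv j \<phi> x) = - (LINT x|lebesgue_on \<Omega>. (H x - G x) $ i $ j * \<phi> x)" .
  qed
qed

lemma norm_diff_powr_le: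
  fixes a b :: "'a::real_normed_vector"
  assumes "p \<ge> 0" shows "norm (a - b) powr p \<le> 2 powr p * (norm a powr p + norm b powr p)"
proof -
  have "norm (a - b) powr p \<le> (2 * max (norm a) (norm b)) powr p"
    using norm_triangle_ineq4[of a b] assms by (intro powr_mono2) auto
  also have "\<dots> = 2 powr p * max (norm a) (norm b) powr p" by (simp add: powr_mult)
  also have "max (norm a) (norm b) powr p \<le> norm a powr p + norm b powr p"
    by (cases "norm a \<le> norm b") (auto simp: max_def)
  finally show ?thesis by (simp add: mult_left_mono)
qed

lemma Lp_on_diff:
  assumes "Lp_on \<Omega> p f" "Lp_on \<Omega> p g" "p \<ge> 0" shows "Lp_on \<Omega> p (\<lambda>x. f x - g x)"
  unfolding Lp_on_def
proof
  have fg: "f \<in> borel_measurable (lebesgue_on \<Omega>)" "g \<in> borel_measurable (lebesgue_on \<Omega>)"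
    using assms(1,2) by (simp_all add: Lp_on_def)
  show m: "(\<lambda>x. f x - g x) \<in> borel_measurable (lebesgue_on \<Omega>)" by (rule borel_measurable_diff[OF fg])
  have "integrable (lebesgue_on \<Omega>) (\<lambda>x. 2 powr p * (norm (f x) powr p + norm (g x) powr p))"
    using assms by (simp add: Lp_on_def)
  then show "integrable (lebesgue_on \<Omega>) (\<lambda>x. norm (f x - g x) powr p)"
    by (rule Bochner_Integration.integrable_bound)
      (use m norm_diff_powr_le[OF assms(3)] in \<open>auto intro!: AE_I2 order_trans[OF _ abs_ge_self]\<close>)
qed

lemma nn_integral_powr_diff_tendsto:
  fixes f g :: "nat \<Rightarrow> 'a \<Rightarrow> 'b::euclidean_space"
  assumes p: "p \<ge> 0"
    and [measurable]: "\<And>n. f n \<in> borel_measurable M" "F \<in> borel_measurable M"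
      "\<And>n. g n \<in> borel_measurable M" "G \<in> borel_measurable M"
    and f: "(\<lambda>n. \<integral>\<^sup>+x. ennreal (norm (f n x - F x) powr p) \<partial>M) \<longlonglongrightarrow> 0"
    and g: "(\<lambda>n. \<integral>\<^sup>+x. ennreal (norm (g n x - G x) powr p) \<partial>M) \<longlonglongrightarrow> 0"
  shows "(\<lambda>n. \<integral>\<^sup>+x. ennreal (norm ((f n x - g n x) - (F x - G x)) powr p) \<partial>M) \<longlonglongrightarrow> 0"
proof -
  let ?c = "ennreal (2 powr p)"
  have B: "(\<integral>\<^sup>+x. ennreal (norm ((f n x - g n x) - (F x - G x)) powr p) \<partial>M) \<le>
    ?c * ((\<integral>\<^sup>+x. ennreal (norm (f n x - F x) powr p) \<partial>M) + (\<integral>\<^sup>+x. ennreal (norm (g n x - G x) powr p) \<partial>M))" for n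
  proof -
    have "(\<integral>\<^sup>+x. ennreal (norm ((f n x - g n x) - (F x - G x)) powr p) \<partial>M) \<le>
      (\<integral>\<^sup>+x. ?c * (ennreal (norm (f n x - F x) powr p) + ennreal (norm (g n x - G x) powr p)) \<partial>M)"
    proof (rule nn_integral_mono)
      fix x
      have eq: "(f n x - g n x) - (F x - G x) = (f n x - F x) - (g n x - G x)" by simp
      have "ennreal (norm ((f n x - g n x) - (F x - G x)) powr p) \<le> ennreal (2 powr p * (norm (f n x - F x) powr p + norm (g n x - G x) powr p))"
        unfolding eq by (intro ennreal_leI norm_diff_powr_le p)
      then show "ennreal (norm ((f n x - g n x) - (F x - G x)) powr p) \<le> ?c * (ennreal (norm (f n x - F x) powr p) + ennreal (norm (g n x - G x) powr p))"
        by (simp add: ennreal_mult ennreal_plus)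
    qed
    also have "\<dots> = ?c * ((\<integral>\<^sup>+x. ennreal (norm (f n x - F x) powr p) \<partial>M) + (\<integral>\<^sup>+x. ennreal (norm (g n x - G x) powr p) \<partial>M))"
    proof -
      have m1: "(\<lambda>x. ennreal (norm (f n x - F x) powr p)) \<in> borel_measurable M" by measurable
      have m2: "(\<lambda>x. ennreal (norm (g n x - G x) powr p)) \<in> borel_measurable M" by measurable
      have "(\<integral>\<^sup>+x. ?c * (ennreal (norm (f n x - F x) powr p) + ennreal (norm (g n x - G x) powr p)) \<partial>M)
        = ?c * (\<integral>\<^sup>+x. ennreal (norm (f n x - F x) powr p) + ennreal (norm (g n x - G x) powr p) \<partial>M)"
        by (rule nn_integral_cmult) (intro borel_measurable_add m1 m2)
      then show ?thesis by (simp only: nn_integral_add[OF m1 m2])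
    qed
    finally show ?thesis .
  qed
  have "(\<lambda>n. ?c * ((\<integral>\<^sup>+x. ennreal (norm (f n x - F x) powr p) \<partial>M) + (\<integral>\<^sup>+x. ennreal (norm (g n x - G x) powr p) \<partial>M))) \<longlonglongrightarrow> ?c * (0 + 0)"
    by (intro ennreal_tendsto_cmult tendsto_add f g) simp
  then have T: "(\<lambda>n. ?c * ((\<integral>\<^sup>+x. ennreal (norm (f n x - F x) powr p) \<partial>M) + (\<integral>\<^sup>+x. ennreal (norm (g n x - G x) powr p) \<partial>M))) \<longlonglongrightarrow> 0" by simp
  show ?thesis
    by (rule tendsto_sandwich[OF always_eventually always_eventually tendsto_const T]) (use B in auto)
qed

lemma smooth_iff_Cinf: "smooth f \<longleftrightarrow> (\<forall>i. Cinf (\<lambda>x. f x $ i))"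
  unfolding smooth_def Cinf_def by (rule all_comm)

lemma jacobian_smooth:
  fixes f :: "real^'d \<Rightarrow> real^'k"
  assumes "smooth f"
  shows "jacobian f (at x) = (\<chi> i. grad (\<lambda>x. f x $ i) x)"
proof -
  have "(f has_derivative (\<lambda>h. \<chi> i. grad (\<lambda>x. f x $ i) x \<bullet> h)) (at x)"
  proof (subst has_derivative_componentwise_within, intro ballI)
    fix b :: "real^'k" assume "b \<in> Basis"
    then obtain i where b: "b = axis i 1" by (auto simp: Basis_vec_def)
    have "((\<lambda>x. f x $ i) has_derivative (\<lambda>h. grad (\<lambda>x. f x $ i) x \<bullet> h)) (at x)"
      using assms by (intro Cinf_grad) (simp add: smooth_iff_Cinf)
    then show "((\<lambda>x. f x \<bullet> b) has_derivative (\<lambda>h. (\<chi> i. grad (\<lambda>x. f x $ i) x \<bullet> h) \<bullet> b)) (at x)"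
      by (simp add: b inner_axis)
  qed
  then have "frechet_derivative f (at x) = (\<lambda>h. \<chi> i. grad (\<lambda>x. f x $ i) x \<bullet> h)"
    by (rule frechet_derivative_at[symmetric])
  then show ?thesis by (simp add: jacobian_def matrix_def vec_eq_iff inner_axis)
qed

lemma smooth_continuous:
  assumes "smooth f" shows "continuous_on UNIV f"
proof -
  have "continuous_on UNIV (\<lambda>x. \<chi> i. f x $ i)"
    by (intro continuous_on_vec_lambda Cinf_continuous) (use assms smooth_iff_Cinf in blast)
  then show ?thesis by simp
qed

lemma jacobian_continuous:
  assumes "smooth f" shows "continuous_on UNIV (\<lambda>x. jacobian f (at x))"
  unfolding jacobian_smooth[OF assms]
  by (intro continuous_on_vec_lambda continuous_grad) (use assms smooth_iff_Cinf in blast)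

lemma smooth_diff:
  assumes "smooth f" "smooth g"
  shows "smooth (\<lambda>x. f x - g x)" "jacobian (\<lambda>x. f x - g x) (at x) = jacobian f (at x) - jacobian g (at x)"
proof -
  have c: "Cinf (\<lambda>x. f x $ i)" "Cinf (\<lambda>x. g x $ i)" for i using assms by (auto simp: smooth_iff_Cinf)
  show s: "smooth (\<lambda>x. f x - g x)"
    unfolding smooth_iff_Cinf using Cinf_lincomb[OF c, of 1 _ "-1"] by simp
  show "jacobian (\<lambda>x. f x - g x) (at x) = jacobian f (at x) - jacobian g (at x)"
    unfolding jacobian_smooth[OF s] jacobian_smooth[OF assms(1)] jacobian_smooth[OF assms(2)]
    using grad_lincomb[OF c, where a = 1 and b = "-1"] by (simp add: vec_eq_iff)
qed

text \<open>Differences of the approximating sequences approximate the difference; the weak gradients match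
  by uniqueness.\<close>

lemma sobolev_trace_diff:
  fixes u w :: "real^'d \<Rightarrow> real^'k"
  assumes \<Omega>: "open \<Omega>" and p: "p \<ge> 0" and w: "w \<in> sobolev_trace \<Omega> p g" and u: "u \<in> sobolev_trace \<Omega> p g"
  shows "(\<lambda>x. w x - u x) \<in> sobolev_zero \<Omega> p"
    and "AE x in lebesgue_on \<Omega>. weak_grad \<Omega> w x - weak_grad \<Omega> u x = weak_grad \<Omega> (\<lambda>x. w x - u x) x"
proof -
  let ?M = "lebesgue_on \<Omega>"
  have sw: "w \<in> sobolev \<Omega> p" "has_trace \<Omega> p w g" and su: "u \<in> sobolev \<Omega> p" "has_trace \<Omega> p u g"
    using w u by (auto simp: sobolev_trace_def)
  note gw = sobolev_weak_grad[OF \<Omega> sw(1)] and gu = sobolev_weak_grad[OF \<Omega> su(1)]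
  note hd = has_weak_gradient_diff[OF \<Omega> gu(1) gw(1)]
  show ae: "AE x in ?M. weak_grad \<Omega> w x - weak_grad \<Omega> u x = weak_grad \<Omega> (\<lambda>x. w x - u x) x"
    by (rule weak_grad_eq(2)[OF \<Omega> hd])
  have Lw: "Lp_on \<Omega> p w" and Lu: "Lp_on \<Omega> p u" using sw su by (auto simp: sobolev_def)
  have "(\<lambda>x. w x - u x) \<in> sobolev \<Omega> p"
    unfolding sobolev_def using Lp_on_diff[OF Lw Lu p] hd Lp_on_diff[OF gw(2) gu(2) p] by blast
  moreover have "has_trace \<Omega> p (\<lambda>x. w x - u x) (\<lambda>_. 0)"
  proof -
    obtain \<phi> where f: "\<And>n. smooth (\<phi> n)"
      "(\<lambda>n. \<integral>\<^sup>+x. ennreal (norm (\<phi> n x - w x) powr p) \<partial>?M) \<longlonglongrightarrow> 0"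
      "(\<lambda>n. \<integral>\<^sup>+x. ennreal (norm (jacobian (\<phi> n) (at x) - weak_grad \<Omega> w x) powr p) \<partial>?M) \<longlonglongrightarrow> 0"
      "(\<lambda>n. \<integral>\<^sup>+x. ennreal (norm (\<phi> n x - g x) powr p) \<partial>surface_measure \<Omega>) \<longlonglongrightarrow> 0"
      and gm: "g \<in> borel_measurable (surface_measure \<Omega>)"
      using sw(2) unfolding has_trace_def by auto
    obtain \<psi> where h: "\<And>n. smooth (\<psi> n)"
      "(\<lambda>n. \<integral>\<^sup>+x. ennreal (norm (\<psi> n x - u x) powr p) \<partial>?M) \<longlonglongrightarrow> 0"
      "(\<lambda>n. \<integral>\<^sup>+x. ennreal (norm (jacobian (\<psi> n) (at x) - weak_grad \<Omega> u x) powr p) \<partial>?M) \<longlonglongrightarrow> 0"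
      "(\<lambda>n. \<integral>\<^sup>+x. ennreal (norm (\<psi> n x - g x) powr p) \<partial>surface_measure \<Omega>) \<longlonglongrightarrow> 0"
      using su(2) unfolding has_trace_def by auto
    have mw: "w \<in> borel_measurable ?M" "u \<in> borel_measurable ?M"
      "weak_grad \<Omega> w \<in> borel_measurable ?M" "weak_grad \<Omega> u \<in> borel_measurable ?M"
      using Lw Lu gw(2) gu(2) by (auto simp: Lp_on_def)
    have 1: "(\<lambda>n. \<integral>\<^sup>+x. ennreal (norm ((\<phi> n x - \<psi> n x) - (w x - u x)) powr p) \<partial>?M) \<longlonglongrightarrow> 0"
      by (intro nn_integral_powr_diff_tendsto p f h mw continuous_measurable_lebesgue_on smooth_continuous)
    have "(\<lambda>n. \<integral>\<^sup>+x. ennreal (norm ((jacobian (\<phi> n) (at x) - jacobian (\<psi> n) (at x)) - (weak_grad \<Omega> w x - weak_grad \<Omega> u x)) powr p) \<partial>?M) \<longlonglongrightarrow> 0"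
      by (intro nn_integral_powr_diff_tendsto p f h mw continuous_measurable_lebesgue_on jacobian_continuous)
    moreover have "(\<integral>\<^sup>+x. ennreal (norm ((jacobian (\<phi> n) (at x) - jacobian (\<psi> n) (at x)) - (weak_grad \<Omega> w x - weak_grad \<Omega> u x)) powr p) \<partial>?M)
       = (\<integral>\<^sup>+x. ennreal (norm (jacobian (\<lambda>x. \<phi> n x - \<psi> n x) (at x) - weak_grad \<Omega> (\<lambda>x. w x - u x) x) powr p) \<partial>?M)" for n
      unfolding smooth_diff(2)[OF f(1) h(1)]
    proof (rule nn_integral_cong_AE)
      show "AE x in ?M. ennreal (norm ((jacobian (\<phi> n) (at x) - jacobian (\<psi> n) (at x)) - (weak_grad \<Omega> w x - weak_grad \<Omega> u x)) powr p)
        = ennreal (norm ((jacobian (\<phi> n) (at x) - jacobian (\<psi> n) (at x)) - weak_grad \<Omega> (\<lambda>x. w x - u x) x) powr p)"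
        using ae by eventually_elim simp
    qed
    ultimately have 2: "(\<lambda>n. \<integral>\<^sup>+x. ennreal (norm (jacobian (\<lambda>x. \<phi> n x - \<psi> n x) (at x) - weak_grad \<Omega> (\<lambda>x. w x - u x) x) powr p) \<partial>?M) \<longlonglongrightarrow> 0"
      by simp
    have "(\<lambda>n. \<integral>\<^sup>+x. ennreal (norm ((\<phi> n x - \<psi> n x) - (g x - g x)) powr p) \<partial>surface_measure \<Omega>) \<longlonglongrightarrow> 0"
      by (intro nn_integral_powr_diff_tendsto p f h gm continuous_measurable_surface_measure smooth_continuous)
    then have 3: "(\<lambda>n. \<integral>\<^sup>+x. ennreal (norm ((\<phi> n x - \<psi> n x) - 0) powr p) \<partial>surface_measure \<Omega>) \<longlonglongrightarrow> 0" by simp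
    show ?thesis
      unfolding has_trace_def
      by (intro conjI exI[of _ "\<lambda>n x. \<phi> n x - \<psi> n x"] allI smooth_diff(1) f h 1 2 3) simp
  qed
  ultimately show "(\<lambda>x. w x - u x) \<in> sobolev_zero \<Omega> p" by (simp add: sobolev_trace_def)
qed

text \<open>Both the domain and its boundary have finite measure, so convergence with exponent \<open>p\<close> implies
  convergence with exponent \<open>2\<close>.\<close>

lemma sobolev_zero_component:
  fixes v :: "real^'d \<Rightarrow> real^'k"
  assumes \<Omega>: "open \<Omega>" "bounded \<Omega>" and lip: "lipschitz_boundary \<Omega>" and p: "p \<ge> 2" and v: "v \<in> sobolev_zero \<Omega> p"
  shows "L2 (lebesgue_on \<Omega>) v" "L2 (lebesgue_on \<Omega>) (weak_grad \<Omega> v)"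
    "zero_trace_pair \<Omega> (\<lambda>x. v x $ i) (\<lambda>x. weak_grad \<Omega> v x $ i)"
proof -
  let ?M = "lebesgue_on \<Omega>"
  have fin: "finite_measure ?M" by (rule finite_measure_lebesgue_on_bounded[OF \<Omega>])
  have sv: "v \<in> sobolev \<Omega> p" "has_trace \<Omega> p v (\<lambda>_. 0)" using v by (auto simp: sobolev_trace_def)
  show Lv: "L2 ?M v" using sv by (intro Lp_imp_L2[OF fin p]) (simp add: sobolev_def)
  show Lg: "L2 ?M (weak_grad \<Omega> v)" by (intro Lp_imp_L2[OF fin p] sobolev_weak_grad(2)[OF \<Omega>(1) sv(1)])
  obtain \<phi> where f: "\<And>n. smooth (\<phi> n)"
    "(\<lambda>n. \<integral>\<^sup>+x. ennreal (norm (\<phi> n x - v x) powr p) \<partial>?M) \<longlonglongrightarrow> 0"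
    "(\<lambda>n. \<integral>\<^sup>+x. ennreal (norm (jacobian (\<phi> n) (at x) - weak_grad \<Omega> v x) powr p) \<partial>?M) \<longlonglongrightarrow> 0"
    "(\<lambda>n. \<integral>\<^sup>+x. ennreal (norm (\<phi> n x - 0) powr p) \<partial>surface_measure \<Omega>) \<longlonglongrightarrow> 0"
    using sv(2) unfolding has_trace_def by auto
  have L\<phi>: "L2 ?M (\<phi> n)" "L2 ?M (\<lambda>x. jacobian (\<phi> n) (at x))" for n
    by (intro continuous_L2 smooth_continuous jacobian_continuous f \<Omega>)+
  have mm: "(\<lambda>x. norm (\<phi> n x - v x)) \<in> borel_measurable ?M"
     "(\<lambda>x. norm (jacobian (\<phi> n) (at x) - weak_grad \<Omega> v x)) \<in> borel_measurable ?M"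
     "(\<lambda>x. norm (\<phi> n x - 0)) \<in> borel_measurable (surface_measure \<Omega>)" for n
    using L2_measurable[OF L2_diff[OF L\<phi>(1) Lv]] L2_measurable[OF L2_diff[OF L\<phi>(2) Lg]]
      continuous_measurable_surface_measure[OF smooth_continuous[OF f(1)]] by simp_all
  have "L2_lim ?M \<phi> v"
    unfolding L2_lim_iff_powr_2[OF L\<phi>(1) Lv]
    by (rule nn_integral_powr_exponent_decrease[OF fin p mm(1) _ f(2)]) simp
  then have 1: "L2_lim ?M (\<lambda>n x. \<phi> n x $ i) (\<lambda>x. v x $ i)" by (rule L2_lim_component)
  have "L2_lim ?M (\<lambda>n x. jacobian (\<phi> n) (at x)) (weak_grad \<Omega> v)"
    unfolding L2_lim_iff_powr_2[OF L\<phi>(2) Lg]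
    by (rule nn_integral_powr_exponent_decrease[OF fin p mm(2) _ f(3)]) simp
  from L2_lim_component[OF this, of i]
  have 2: "L2_lim ?M (\<lambda>n. grad (\<lambda>x. \<phi> n x $ i)) (\<lambda>x. weak_grad \<Omega> v x $ i)"
    by (simp add: jacobian_smooth[OF f(1)])
  have T: "(\<lambda>n. \<integral>\<^sup>+x. ennreal (norm (\<phi> n x - 0) powr 2) \<partial>surface_measure \<Omega>) \<longlonglongrightarrow> 0"
    by (rule nn_integral_powr_exponent_decrease[OF finite_measure_surface_measure[OF \<Omega> lip] p mm(3) _ f(4)]) simp
  have B: "(\<integral>\<^sup>+x. ennreal ((\<phi> n x $ i)\<^sup>2) \<partial>surface_measure \<Omega>) \<le> (\<integral>\<^sup>+x. ennreal (norm (\<phi> n x - 0) powr 2) \<partial>surface_measure \<Omega>)" for n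
  proof (intro nn_integral_mono ennreal_leI)
    fix x
    have "\<bar>\<phi> n x $ i\<bar>\<^sup>2 \<le> (norm (\<phi> n x))\<^sup>2" by (intro power_mono component_le_norm_cart) simp
    then show "(\<phi> n x $ i)\<^sup>2 \<le> norm (\<phi> n x - 0) powr 2" by (simp add: powr_numeral)
  qed
  have 3: "(\<lambda>n. \<integral>\<^sup>+x. ennreal ((\<phi> n x $ i)\<^sup>2) \<partial>surface_measure \<Omega>) \<longlonglongrightarrow> 0"
    by (rule tendsto_sandwich[OF always_eventually always_eventually tendsto_const T]) (use B in auto)
  show "zero_trace_pair \<Omega> (\<lambda>x. v x $ i) (\<lambda>x. weak_grad \<Omega> v x $ i)"
    unfolding zero_trace_pair_def
    by (intro exI[of _ "\<lambda>n x. \<phi> n x $ i"] conjI allI 1 2 3) (use f(1) in \<open>simp add: smooth_iff_Cinf\<close>)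
qed

text \<open>In the converse direction, a pair gives a \<open>real^1\<close>-valued function that can serve as an eigenfunction
  and as a test function in the eigenvalue equation.\<close>

lemma zero_trace_pair_sobolev_zero:
  fixes f :: "real^'d \<Rightarrow> real"
  assumes \<Omega>: "open \<Omega>" "bounded \<Omega>" and pair: "zero_trace_pair \<Omega> f G"
  defines "v \<equiv> (\<lambda>x. (\<chi> i. f x) :: real^1)"
  shows "v \<in> sobolev_zero \<Omega> 2" "AE x in lebesgue_on \<Omega>. (\<chi> i. G x) = weak_grad \<Omega> v x"
proof -
  let ?M = "lebesgue_on \<Omega>" and ?H = "\<lambda>x. (\<chi> i. G x) :: real^'d^1"
  have fin: "finite_measure ?M" by (rule finite_measure_lebesgue_on_bounded[OF \<Omega>])
  note L = zero_trace_pair_L2[OF pair]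
  have Lv: "L2 ?M v" "L2 ?M ?H" unfolding v_def by (rule L2_vec1[OF L(1)], rule L2_vec1[OF L(2)])
  have loc: "integrable (lebesgue_on K) F" if F: "L2 ?M F" and K: "compact K" "K \<subseteq> \<Omega>"
    for F :: "real^'d \<Rightarrow> 'b::euclidean_space" and K
  proof -
    have "integrable ?M F" by (rule L2_integrable_finite[OF fin F])
    then have "integrable lebesgue (\<lambda>x. indicator \<Omega> x *\<^sub>R F x)" using \<Omega> by (simp add: integrable_restrict_space)
    moreover have Ks: "K \<in> sets lebesgue" using K(1) by (simp add: borel_compact)
    ultimately have "integrable lebesgue (\<lambda>x. indicator K x *\<^sub>R (indicator \<Omega> x *\<^sub>R F x))"
      by (intro integrable_mult_indicator[OF Ks])
    moreover have "indicator K x *\<^sub>R (indicator \<Omega> x *\<^sub>R F x) = indicator K x *\<^sub>R F x" for x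
      using K(2) by (auto simp: indicator_def)
    ultimately have "integrable lebesgue (\<lambda>x. indicator K x *\<^sub>R F x)" by (simp only:)
    then show ?thesis using Ks by (simp add: integrable_restrict_space)
  qed
  have hw: "has_weak_gradient \<Omega> v ?H"
    unfolding has_weak_gradient_def
  proof (intro conjI allI impI ballI)
    fix K assume "compact K \<and> K \<subseteq> \<Omega>"
    then show "integrable (lebesgue_on K) v" "integrable (lebesgue_on K) ?H" using loc[OF Lv(1)] loc[OF Lv(2)] by auto
  next
    fix \<psi> i j assume "\<psi> \<in> test_functions \<Omega>"
    from zero_trace_pair_weak_gradient[OF \<Omega> pair this, of j]
    show "(LINT x|?M. v x $ i * partial_deriv j \<psi> x) = - (LINT x|?M. ?H x $ i $ j * \<psi> x)" by (simp add: v_def)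
  qed
  show ae: "AE x in ?M. ?H x = weak_grad \<Omega> v x" by (rule weak_grad_eq(2)[OF \<Omega>(1) hw])
  have "v \<in> sobolev \<Omega> 2" unfolding sobolev_def using hw L2_imp_Lp_2[OF Lv(1)] L2_imp_Lp_2[OF Lv(2)] by blast
  moreover have "has_trace \<Omega> 2 v (\<lambda>_. 0)"
  proof -
    obtain \<phi> where p: "\<And>n. Cinf (\<phi> n)" "L2_lim ?M \<phi> f" "L2_lim ?M (\<lambda>n. grad (\<phi> n)) G"
        "(\<lambda>n. \<integral>\<^sup>+x. ennreal ((\<phi> n x)\<^sup>2) \<partial>surface_measure \<Omega>) \<longlonglongrightarrow> 0"
      using pair unfolding zero_trace_pair_def by auto
    define \<psi> where "\<psi> n x = ((\<chi> i. \<phi> n x) :: real^1)" for n x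
    have s: "smooth (\<psi> n)" for n using p(1) by (simp add: smooth_iff_Cinf \<psi>_def)
    have j: "jacobian (\<psi> n) (at x) = (\<chi> i. grad (\<phi> n) x)" for n x
      unfolding jacobian_smooth[OF s] by (simp add: \<psi>_def)
    have nn: "norm (\<psi> n x - v x) = norm (\<phi> n x - f x)" for n x
      by (simp add: norm_vec_1_eq \<psi>_def v_def)
    have 1: "(\<lambda>n. \<integral>\<^sup>+x. ennreal (norm (\<psi> n x - v x) powr 2) \<partial>?M) \<longlonglongrightarrow> 0"
      unfolding nn using p(2) by (subst L2_lim_iff_powr_2[symmetric]) (auto dest: L2_limD)
    have nj: "norm (jacobian (\<psi> n) (at x) - ?H x) = norm (grad (\<phi> n) x - G x)" for n x
      by (simp add: norm_vec_1_eq j)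
    have "(\<lambda>n. \<integral>\<^sup>+x. ennreal (norm (jacobian (\<psi> n) (at x) - ?H x) powr 2) \<partial>?M) \<longlonglongrightarrow> 0"
      unfolding nj using p(3) by (subst L2_lim_iff_powr_2[symmetric]) (auto dest: L2_limD)
    moreover have "(\<integral>\<^sup>+x. ennreal (norm (jacobian (\<psi> n) (at x) - ?H x) powr 2) \<partial>?M)
       = (\<integral>\<^sup>+x. ennreal (norm (jacobian (\<psi> n) (at x) - weak_grad \<Omega> v x) powr 2) \<partial>?M)" for n
      by (rule nn_integral_cong_AE) (use ae in \<open>eventually_elim, simp\<close>)
    ultimately have 2: "(\<lambda>n. \<integral>\<^sup>+x. ennreal (norm (jacobian (\<psi> n) (at x) - weak_grad \<Omega> v x) powr 2) \<partial>?M) \<longlonglongrightarrow> 0" by simp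
    have ns: "norm (\<psi> n x - 0) powr 2 = (\<phi> n x)\<^sup>2" for n x
      by (simp add: norm_vec_1_eq \<psi>_def powr_numeral)
    have 3: "(\<lambda>n. \<integral>\<^sup>+x. ennreal (norm (\<psi> n x - 0) powr 2) \<partial>surface_measure \<Omega>) \<longlonglongrightarrow> 0"
      unfolding ns by (rule p(4))
    show ?thesis unfolding has_trace_def by (intro conjI exI[of _ \<psi>] allI s 1 2 3) simp
  qed
  ultimately show "v \<in> sobolev_zero \<Omega> 2" by (simp add: sobolev_trace_def)
qed

section \<open>The first Dirichlet eigenvalue\<close>

lemma zero_trace_pair_scale:
  "zero_trace_pair \<Omega> f G \<Longrightarrow> zero_trace_pair \<Omega> (\<lambda>x. a * f x) (\<lambda>x. a *\<^sub>R G x)"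
  using zero_trace_pair_lincomb[of \<Omega> f G f G a 0] by simp

lemma zero_trace_pair_smooth_approx:
  assumes pair: "zero_trace_pair \<Omega> f G" and e: "e > 0"
  shows "\<exists>\<phi>. Cinf \<phi> \<and> nsq (lebesgue_on \<Omega>) (\<lambda>x. \<phi> x - f x) < e \<and>
    nsq (lebesgue_on \<Omega>) (\<lambda>x. grad \<phi> x - G x) < e \<and> (\<integral>\<^sup>+x. ennreal ((\<phi> x)\<^sup>2) \<partial>surface_measure \<Omega>) < ennreal e"
proof -
  let ?M = "lebesgue_on \<Omega>"
  obtain \<phi> where p: "\<And>n. Cinf (\<phi> n)" "L2_lim ?M \<phi> f" "L2_lim ?M (\<lambda>n. grad (\<phi> n)) G"
      "(\<lambda>n. \<integral>\<^sup>+x. ennreal ((\<phi> n x)\<^sup>2) \<partial>surface_measure \<Omega>) \<longlonglongrightarrow> 0"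
    using pair unfolding zero_trace_pair_def by auto
  have "\<forall>\<^sub>F n in sequentially. nsq ?M (\<lambda>x. \<phi> n x - f x) < e"
    using L2_limD(3)[OF p(2)] e by (rule order_tendstoD(2))
  moreover have "\<forall>\<^sub>F n in sequentially. nsq ?M (\<lambda>x. grad (\<phi> n) x - G x) < e"
    using L2_limD(3)[OF p(3)] e by (rule order_tendstoD(2))
  moreover have "\<forall>\<^sub>F n in sequentially. (\<integral>\<^sup>+x. ennreal ((\<phi> n x)\<^sup>2) \<partial>surface_measure \<Omega>) < ennreal e"
    using p(4) by (rule order_tendstoD(2)) (use e in simp)
  ultimately have "\<forall>\<^sub>F n in sequentially. nsq ?M (\<lambda>x. \<phi> n x - f x) < e \<and> nsq ?M (\<lambda>x. grad (\<phi> n) x - G x) < e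
      \<and> (\<integral>\<^sup>+x. ennreal ((\<phi> n x)\<^sup>2) \<partial>surface_measure \<Omega>) < ennreal e"
    by eventually_elim simp
  then obtain n where "nsq ?M (\<lambda>x. \<phi> n x - f x) < e \<and> nsq ?M (\<lambda>x. grad (\<phi> n) x - G x) < e
      \<and> (\<integral>\<^sup>+x. ennreal ((\<phi> n x)\<^sup>2) \<partial>surface_measure \<Omega>) < ennreal e"
    using eventually_happens' sequentially_bot by blast
  then show ?thesis using p(1) by blast
qed

lemma L2_lim_subst:
  assumes g: "\<And>n. L2 M (g n)" and f: "L2_lim M f F" and d: "(\<lambda>n. nsq M (\<lambda>x. g n x - f n x)) \<longlonglongrightarrow> 0"
  shows "L2_lim M g F"
proof -
  have "(\<lambda>n. 2 * nsq M (\<lambda>x. g n x - f n x) + 2 * nsq M (\<lambda>x. f n x - F x)) \<longlonglongrightarrow> 2 * 0 + 2 * 0"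
    by (intro tendsto_intros d L2_limD(3)[OF f])
  then have T: "(\<lambda>n. 2 * nsq M (\<lambda>x. g n x - f n x) + 2 * nsq M (\<lambda>x. f n x - F x)) \<longlonglongrightarrow> 0" by simp
  have "(\<lambda>n. nsq M (\<lambda>x. g n x - F x)) \<longlonglongrightarrow> 0"
    by (rule tendsto_sandwich[OF always_eventually always_eventually tendsto_const T])
      (use nsq_triangle[OF g L2_limD(1,2)[OF f]] in auto)
  then show ?thesis using g L2_limD(2)[OF f] by (simp add: L2_lim_def)
qed

text \<open>A minimizing sequence is replaced by smooth functions with small boundary values, to which
  Rellich compactness applies.\<close>

lemma rayleigh_minimizer:
  fixes \<Omega> :: "(real^'d) set"
  assumes \<Omega>: "open \<Omega>" "bounded \<Omega>" and lip: "lipschitz_boundary \<Omega>"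
    and ne: "zero_trace_pair \<Omega> f0 G0" "nsq (lebesgue_on \<Omega>) f0 \<noteq> 0"
  shows "\<exists>f G. zero_trace_pair \<Omega> f G \<and> nsq (lebesgue_on \<Omega>) f = 1 \<and>
    (\<forall>h H. zero_trace_pair \<Omega> h H \<longrightarrow> nsq (lebesgue_on \<Omega>) G * nsq (lebesgue_on \<Omega>) h \<le> nsq (lebesgue_on \<Omega>) H)"
proof -
  let ?M = "lebesgue_on \<Omega>"
  have fin: "finite_measure ?M" by (rule finite_measure_lebesgue_on_bounded[OF \<Omega>])
  define S where "S = {nsq ?M G | f G. zero_trace_pair \<Omega> f G \<and> nsq ?M f = 1}"
  define l where "l = Inf S"
  have bdd: "bdd_below S" by (rule bdd_belowI[of _ 0]) (auto simp: S_def)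
  have normalize: "nsq ?M H / nsq ?M h \<in> S" if pr: "zero_trace_pair \<Omega> h H" and nz: "nsq ?M h \<noteq> 0" for h H
  proof -
    define c where "c = 1 / sqrt (nsq ?M h)"
    have c2: "c\<^sup>2 = 1 / nsq ?M h" by (simp add: c_def power_divide)
    have "nsq ?M (\<lambda>x. c *\<^sub>R h x) = 1" using nz nsq_scaleR[of ?M c h] c2 by simp
    moreover have "nsq ?M (\<lambda>x. c *\<^sub>R H x) = nsq ?M H / nsq ?M h" by (simp add: nsq_scaleR c2)
    ultimately show ?thesis
      unfolding S_def using zero_trace_pair_scale[OF pr, of c]
      by (intro CollectI exI[of _ "\<lambda>x. c * h x"] exI[of _ "\<lambda>x. c *\<^sub>R H x"]) simp
  qed
  have S_ne: "S \<noteq> {}" using normalize[OF ne] by blast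
  have l_low: "l * nsq ?M h \<le> nsq ?M H" if pr: "zero_trace_pair \<Omega> h H" for h H
  proof (cases "nsq ?M h = 0")
    case False
    then have "l \<le> nsq ?M H / nsq ?M h" unfolding l_def by (intro cInf_lower normalize pr bdd)
    moreover have "0 < nsq ?M h" using False nsq_nonneg[of ?M h] by linarith
    ultimately show ?thesis by (simp add: pos_le_divide_eq)
  qed simp
  have l0: "l \<ge> 0" unfolding l_def using S_ne by (rule cInf_greatest) (auto simp: S_def)
  define \<epsilon> where "\<epsilon> n = inverse (real (Suc n))" for n
  have e: "\<epsilon> n > 0" "\<epsilon> n \<le> 1" for n by (auto simp: \<epsilon>_def field_simps)
  have e_lim: "\<epsilon> \<longlonglongrightarrow> 0" unfolding \<epsilon>_def by (rule LIMSEQ_inverse_real_of_nat)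
  define A where "A n f G \<phi> \<longleftrightarrow> zero_trace_pair \<Omega> f G \<and> nsq ?M f = 1 \<and> nsq ?M G < l + \<epsilon> n \<and> Cinf \<phi> \<and>
    nsq ?M (\<lambda>x. \<phi> x - f x) < \<epsilon> n \<and> nsq ?M (\<lambda>x. grad \<phi> x - G x) < \<epsilon> n \<and>
    (\<integral>\<^sup>+x. ennreal ((\<phi> x)\<^sup>2) \<partial>surface_measure \<Omega>) < ennreal (\<epsilon> n)" for n f G \<phi>
  have "\<exists>f G \<phi>. A n f G \<phi>" for n
  proof -
    obtain s where s: "s \<in> S" "s < l + \<epsilon> n"
      using cInf_lessD[OF S_ne, of "l + \<epsilon> n"] e(1)[of n] by (auto simp: l_def)
    then obtain f G where fG: "zero_trace_pair \<Omega> f G" "nsq ?M f = 1" "nsq ?M G < l + \<epsilon> n" by (auto simp: S_def)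
    obtain \<phi> where "Cinf \<phi> \<and> nsq ?M (\<lambda>x. \<phi> x - f x) < \<epsilon> n \<and> nsq ?M (\<lambda>x. grad \<phi> x - G x) < \<epsilon> n \<and>
      (\<integral>\<^sup>+x. ennreal ((\<phi> x)\<^sup>2) \<partial>surface_measure \<Omega>) < ennreal (\<epsilon> n)"
      using zero_trace_pair_smooth_approx[OF fG(1) e(1)] by blast
    then have "A n f G \<phi>" using fG by (simp add: A_def)
    then show ?thesis by blast
  qed
  then obtain f G \<phi> where A: "\<And>n. A n (f n) (G n) (\<phi> n)" by metis
  have pr: "zero_trace_pair \<Omega> (f n) (G n)" and f1: "nsq ?M (f n) = 1" and Gl: "nsq ?M (G n) < l + \<epsilon> n"
    and c: "Cinf (\<phi> n)" and \<phi>f: "nsq ?M (\<lambda>x. \<phi> n x - f n x) < \<epsilon> n"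
    and \<phi>G: "nsq ?M (\<lambda>x. grad (\<phi> n) x - G n x) < \<epsilon> n"
    and surf: "(\<integral>\<^sup>+x. ennreal ((\<phi> n x)\<^sup>2) \<partial>surface_measure \<Omega>) < ennreal (\<epsilon> n)" for n
    using A[of n] by (simp_all add: A_def)
  note L = zero_trace_pair_L2[OF pr]
  have L\<phi>: "L2 ?M (\<phi> n)" "L2 ?M (grad (\<phi> n))" for n
    by (intro continuous_L2 Cinf_continuous c \<Omega>, intro continuous_L2 continuous_grad c \<Omega>)
  have "nsq ?M (\<phi> n) + nsq ?M (grad (\<phi> n)) \<le> 2 * l + 8" for n
  proof -
    have "nsq ?M (\<phi> n) \<le> 2 * nsq ?M (\<lambda>x. \<phi> n x - f n x) + 2 * nsq ?M (f n)"
      using nsq_add_le[OF L2_diff[OF L\<phi>(1) L(1)] L(1), of n n n] by simp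
    moreover have "nsq ?M (grad (\<phi> n)) \<le> 2 * nsq ?M (\<lambda>x. grad (\<phi> n) x - G n x) + 2 * nsq ?M (G n)"
      using nsq_add_le[OF L2_diff[OF L\<phi>(2) L(2)] L(2), of n n n] by simp
    ultimately show ?thesis using \<phi>f[of n] \<phi>G[of n] f1[of n] Gl[of n] e[of n] by linarith
  qed
  then have "\<exists>r. strict_mono r \<and> L2_Cauchy ?M (\<lambda>n. \<phi> (r n))" by (rule rellich[OF \<Omega> lip c])
  then obtain r :: "nat \<Rightarrow> nat" where "strict_mono r \<and> L2_Cauchy ?M (\<lambda>n. \<phi> (r n))" by (rule exE)
  then have r: "strict_mono r" and C\<phi>: "L2_Cauchy ?M (\<lambda>n. \<phi> (r n))" by (rule conjunct1, rule conjunct2)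
  note cauchy = C\<phi>[unfolded L2_Cauchy_def, rule_format]
  have er_lim: "(\<lambda>n. \<epsilon> (r n)) \<longlonglongrightarrow> 0"
    using LIMSEQ_subseq_LIMSEQ[OF e_lim r] by (simp add: o_def)
  have Cf: "L2_Cauchy ?M (\<lambda>n. f (r n))"
    unfolding L2_Cauchy_def
  proof (intro allI impI)
    fix d :: real assume d: "d > 0"
    obtain N1 where N1: "\<And>m n. m \<ge> N1 \<Longrightarrow> n \<ge> N1 \<Longrightarrow> nsq ?M (\<lambda>x. \<phi> (r m) x - \<phi> (r n) x) < d / 12"
      using cauchy[of "d / 12"] d by auto
    obtain N2 where N2: "\<And>n. n \<ge> N2 \<Longrightarrow> \<epsilon> (r n) < d / 12"
      using order_tendstoD(2)[OF er_lim, of "d / 12"] d by (auto simp: eventually_sequentially)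
    have "nsq ?M (\<lambda>x. f (r m) x - f (r n) x) < d" if mn: "m \<ge> max N1 N2" "n \<ge> max N1 N2" for m n
    proof -
      have "nsq ?M (\<lambda>x. f (r m) x - f (r n) x)
          \<le> 2 * nsq ?M (\<lambda>x. f (r m) x - \<phi> (r m) x) + 2 * nsq ?M (\<lambda>x. \<phi> (r m) x - f (r n) x)"
        by (rule nsq_triangle[OF L(1) L\<phi>(1) L(1)])
      moreover have "nsq ?M (\<lambda>x. \<phi> (r m) x - f (r n) x)
          \<le> 2 * nsq ?M (\<lambda>x. \<phi> (r m) x - \<phi> (r n) x) + 2 * nsq ?M (\<lambda>x. \<phi> (r n) x - f (r n) x)"
        by (rule nsq_triangle[OF L\<phi>(1) L\<phi>(1) L(1)])
      moreover have "nsq ?M (\<lambda>x. f (r m) x - \<phi> (r m) x) = nsq ?M (\<lambda>x. \<phi> (r m) x - f (r m) x)"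
        by (rule nsq_diff_commute)
      moreover have "nsq ?M (\<lambda>x. \<phi> (r m) x - \<phi> (r n) x) < d / 12" using N1 mn by simp
      moreover have "\<epsilon> (r m) < d / 12" "\<epsilon> (r n) < d / 12" using N2 mn by simp_all
      ultimately show ?thesis using \<phi>f[of "r m"] \<phi>f[of "r n"] d by linarith
    qed
    then show "\<exists>N. \<forall>m\<ge>N. \<forall>n\<ge>N. nsq ?M (\<lambda>x. f (r m) x - f (r n) x) < d" by (intro exI[of _ "max N1 N2"]) simp
  qed
  note f_cauchy = Cf[unfolded L2_Cauchy_def, rule_format]
  \<comment> \<open>By the parallelogram identity: the gradient of the sum is large because \<open>l\<close> is the infimum of the
    Rayleigh quotient and the sum of two nearby unit vectors has squared norm close to \<open>4\<close>.\<close>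
  have par: "nsq ?M (\<lambda>x. G m x - G n x) \<le> 2 * \<epsilon> m + 2 * \<epsilon> n + l * nsq ?M (\<lambda>x. f m x - f n x)" for m n
  proof -
    have parallelogram: "nsq ?M (\<lambda>x. a x + b x) + nsq ?M (\<lambda>x. a x - b x) = 2 * nsq ?M a + 2 * nsq ?M b"
      if "L2 ?M a" "L2 ?M b" for a b :: "real^'d \<Rightarrow> 'b::euclidean_space"
      using nsq_add[OF that] nsq_add[OF that(1) L2_scaleR[OF that(2), of "-1"]] nsq_scaleR[of ?M "-1" b] by simp
    have "zero_trace_pair \<Omega> (\<lambda>x. f m x + f n x) (\<lambda>x. G m x + G n x)"
      using zero_trace_pair_lincomb[OF pr pr, of 1 m 1 n] by simp
    then have "l * nsq ?M (\<lambda>x. f m x + f n x) \<le> nsq ?M (\<lambda>x. G m x + G n x)" by (rule l_low)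
    moreover have "nsq ?M (\<lambda>x. f m x + f n x) = 4 - nsq ?M (\<lambda>x. f m x - f n x)"
      using parallelogram[OF L(1) L(1), of m n] f1 by simp
    ultimately have "l * 4 - l * nsq ?M (\<lambda>x. f m x - f n x) \<le> nsq ?M (\<lambda>x. G m x + G n x)"
      by (simp add: right_diff_distrib)
    moreover have "nsq ?M (\<lambda>x. G m x + G n x) + nsq ?M (\<lambda>x. G m x - G n x) = 2 * nsq ?M (G m) + 2 * nsq ?M (G n)"
      by (rule parallelogram[OF L(2) L(2)])
    ultimately show ?thesis using Gl[of m] Gl[of n] by linarith
  qed
  have CG: "L2_Cauchy ?M (\<lambda>n. G (r n))"
    unfolding L2_Cauchy_def
  proof (intro allI impI)
    fix d :: real assume d: "d > 0"
    have d': "d / (4 * (l + 1)) > 0" using d l0 by simp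
    obtain N1 where N1: "\<And>m n. m \<ge> N1 \<Longrightarrow> n \<ge> N1 \<Longrightarrow> nsq ?M (\<lambda>x. f (r m) x - f (r n) x) < d / (4 * (l + 1))"
      using f_cauchy[OF d'] by auto
    obtain N2 where N2: "\<And>n. n \<ge> N2 \<Longrightarrow> \<epsilon> (r n) < d / 8"
      using order_tendstoD(2)[OF er_lim, of "d / 8"] d by (auto simp: eventually_sequentially)
    have "nsq ?M (\<lambda>x. G (r m) x - G (r n) x) < d" if mn: "m \<ge> max N1 N2" "n \<ge> max N1 N2" for m n
    proof -
      have "l * nsq ?M (\<lambda>x. f (r m) x - f (r n) x) \<le> l * (d / (4 * (l + 1)))"
        using N1[of m n] mn l0 by (intro mult_left_mono) auto
      also have "\<dots> \<le> (l + 1) * (d / (4 * (l + 1)))" using d' by (intro mult_right_mono) auto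
      also have "\<dots> = d / 4"
      proof -
        have *: "w * (d / (4 * w)) = d / 4" if "w > 0" for w :: real using that by simp
        show ?thesis by (rule *) (use l0 in simp)
      qed
      finally have "l * nsq ?M (\<lambda>x. f (r m) x - f (r n) x) \<le> d / 4" .
      moreover have "\<epsilon> (r m) < d / 8" "\<epsilon> (r n) < d / 8" using N2 mn by simp_all
      ultimately show ?thesis using par[of "r m" "r n"] d by linarith
    qed
    then show "\<exists>N. \<forall>m\<ge>N. \<forall>n\<ge>N. nsq ?M (\<lambda>x. G (r m) x - G (r n) x) < d" by (intro exI[of _ "max N1 N2"]) simp
  qed
  obtain F where F: "L2_lim ?M (\<lambda>n. f (r n)) F" using L2_complete[OF fin L(1) Cf] by blast
  obtain K where K: "L2_lim ?M (\<lambda>n. G (r n)) K" using L2_complete[OF fin L(2) CG] by blast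
  have "(\<lambda>n. nsq ?M (\<lambda>x. \<phi> (r n) x - f (r n) x)) \<longlonglongrightarrow> 0"
    by (rule tendsto_sandwich[OF always_eventually always_eventually tendsto_const er_lim])
      (use \<phi>f in \<open>auto intro: less_imp_le\<close>)
  then have 1: "L2_lim ?M (\<lambda>n. \<phi> (r n)) F" by (rule L2_lim_subst[OF L\<phi>(1) F])
  have "(\<lambda>n. nsq ?M (\<lambda>x. grad (\<phi> (r n)) x - G (r n) x)) \<longlonglongrightarrow> 0"
    by (rule tendsto_sandwich[OF always_eventually always_eventually tendsto_const er_lim])
      (use \<phi>G in \<open>auto intro: less_imp_le\<close>)
  then have 2: "L2_lim ?M (\<lambda>n. grad (\<phi> (r n))) K" by (rule L2_lim_subst[OF L\<phi>(2) K])
  have "(\<lambda>n. ennreal (\<epsilon> (r n))) \<longlonglongrightarrow> ennreal 0" by (intro tendsto_intros er_lim)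
  then have T: "(\<lambda>n. ennreal (\<epsilon> (r n))) \<longlonglongrightarrow> 0" by simp
  have 3: "(\<lambda>n. \<integral>\<^sup>+x. ennreal ((\<phi> (r n) x)\<^sup>2) \<partial>surface_measure \<Omega>) \<longlonglongrightarrow> 0"
    by (rule tendsto_sandwich[OF always_eventually always_eventually tendsto_const T])
      (use surf in \<open>auto intro: less_imp_le\<close>)
  have pair: "zero_trace_pair \<Omega> F K"
    unfolding zero_trace_pair_def by (intro exI[of _ "\<lambda>n. \<phi> (r n)"] conjI allI c 1 2 3)
  have "(\<lambda>n. nsq ?M (f (r n))) \<longlonglongrightarrow> nsq ?M F" by (rule L2_lim_nsq[OF F])
  then have F1: "nsq ?M F = 1" unfolding f1 by (simp add: LIMSEQ_const_iff)
  have "(\<lambda>n. l + \<epsilon> (r n)) \<longlonglongrightarrow> l + 0" by (intro tendsto_intros er_lim)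
  then have "nsq ?M K \<le> l + 0"
    by (rule LIMSEQ_le[OF L2_lim_nsq[OF K]]) (use Gl in \<open>auto intro: less_imp_le\<close>)
  then have Kl: "nsq ?M K \<le> l" by simp
  have "nsq ?M K * nsq ?M h \<le> nsq ?M H" if "zero_trace_pair \<Omega> h H" for h H
    using mult_right_mono[OF Kl, of "nsq ?M h"] l_low[OF that] nsq_nonneg[of ?M h] by linarith
  then show ?thesis using pair F1 by blast
qed

text \<open>For \<open>f + t h\<close> the difference of the two sides of the minimality inequality is a nonnegative
  quadratic in \<open>t\<close> without constant term, so its linear coefficient vanishes.\<close>

lemma rayleigh_minimizer_weak_equation:
  assumes pair: "zero_trace_pair \<Omega> f G" and f1: "nsq (lebesgue_on \<Omega>) f = 1"
    and min: "\<And>h H. zero_trace_pair \<Omega> h H \<Longrightarrow> nsq (lebesgue_on \<Omega>) G * nsq (lebesgue_on \<Omega>) h \<le> nsq (lebesgue_on \<Omega>) H"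
    and h: "zero_trace_pair \<Omega> h H"
  shows "(LINT x|lebesgue_on \<Omega>. G x \<bullet> H x) = nsq (lebesgue_on \<Omega>) G * (LINT x|lebesgue_on \<Omega>. f x * h x)"
proof -
  let ?M = "lebesgue_on \<Omega>"
  note Lf = zero_trace_pair_L2[OF pair] and Lh = zero_trace_pair_L2[OF h]
  let ?b = "(LINT x|?M. G x \<bullet> H x) - nsq ?M G * (LINT x|?M. f x * h x)"
  have "?b\<^sup>2 \<le> 0 * (nsq ?M H - nsq ?M G * nsq ?M h)"
  proof (rule quadratic_nonneg_discriminant)
    fix t :: real
    have "zero_trace_pair \<Omega> (\<lambda>x. f x + t * h x) (\<lambda>x. G x + t *\<^sub>R H x)"
      using zero_trace_pair_lincomb[OF pair h, of 1 t] by simp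
    then have "nsq ?M G * nsq ?M (\<lambda>x. f x + t * h x) \<le> nsq ?M (\<lambda>x. G x + t *\<^sub>R H x)" by (rule min)
    moreover have "nsq ?M (\<lambda>x. f x + t * h x) = 1 + 2 * t * (LINT x|?M. f x * h x) + t\<^sup>2 * nsq ?M h"
      using nsq_add[OF Lf(1) L2_scaleR[OF Lh(1)], of t] nsq_scaleR[of ?M t h] f1
      by (simp add: mult.left_commute[of _ t])
    moreover have "nsq ?M (\<lambda>x. G x + t *\<^sub>R H x) = nsq ?M G + 2 * t * (LINT x|?M. G x \<bullet> H x) + t\<^sup>2 * nsq ?M H"
      using nsq_add[OF Lf(2) L2_scaleR[OF Lh(2)], of t] nsq_scaleR[of ?M t H] by simp
    ultimately show "0 \<le> 0 + 2 * t * ?b + t\<^sup>2 * (nsq ?M H - nsq ?M G * nsq ?M h)"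
      by (simp add: algebra_simps)
  qed
  then show ?thesis by simp
qed

text \<open>The minimizer is an eigenfunction, and testing the equation of any eigenfunction with itself
  exhibits its eigenvalue as a Rayleigh quotient.\<close>

lemma first_dirichlet_eigenvalue_eq:
  fixes \<Omega> :: "(real^'d) set"
  assumes \<Omega>: "open \<Omega>" "bounded \<Omega>" and lip: "lipschitz_boundary \<Omega>"
    and pair: "zero_trace_pair \<Omega> f G" and f1: "nsq (lebesgue_on \<Omega>) f = 1"
    and min: "\<And>h H. zero_trace_pair \<Omega> h H \<Longrightarrow> nsq (lebesgue_on \<Omega>) G * nsq (lebesgue_on \<Omega>) h \<le> nsq (lebesgue_on \<Omega>) H"
  shows "first_dirichlet_eigenvalue \<Omega> = nsq (lebesgue_on \<Omega>) G"
  unfolding first_dirichlet_eigenvalue_def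
proof (rule Least_equality)
  let ?M = "lebesgue_on \<Omega>"
  define e where "e = (\<lambda>x. (\<chi> i. f x) :: real^1)"
  have e0: "e \<in> sobolev_zero \<Omega> 2" and ge: "AE x in ?M. (\<chi> i. G x) = weak_grad \<Omega> e x"
    unfolding e_def by (rule zero_trace_pair_sobolev_zero[OF \<Omega> pair])+
  show "dirichlet_eigenvalue \<Omega> (nsq ?M G)"
    unfolding dirichlet_eigenvalue_def
  proof (intro exI[of _ e] conjI ballI e0 notI)
    assume "AE x in ?M. e x = 0"
    then have "AE x in ?M. (norm (f x))\<^sup>2 = 0" by eventually_elim (simp add: e_def vec_eq_iff)
    then have "nsq ?M f = (LINT x|?M. 0)"
      unfolding nsq_def using L2_integrable[OF zero_trace_pair_L2(1)[OF pair]]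
      by (intro integral_cong_AE) (auto intro: borel_measurable_integrable)
    then show False using f1 by simp
  next
    fix v :: "real^'d \<Rightarrow> real^1" assume v: "v \<in> sobolev_zero \<Omega> 2"
    note sv = sobolev_zero_component[OF \<Omega> lip order_refl v]
    note se = sobolev_zero_component[OF \<Omega> lip order_refl e0]
    have eqv: "AE x in ?M. weak_grad \<Omega> e x \<bullet> weak_grad \<Omega> v x = G x \<bullet> weak_grad \<Omega> v x $ 1"
      using ge
    proof eventually_elim
      case (elim x)
      have "weak_grad \<Omega> e x $ 1 = G x" unfolding elim[symmetric] by simp
      then show ?case by (simp add: inner_vec_1_eq)
    qed
    have "(LINT x|?M. weak_grad \<Omega> e x \<bullet> weak_grad \<Omega> v x) = (LINT x|?M. G x \<bullet> weak_grad \<Omega> v x $ 1)"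
      using L2_inner_integrable[OF se(2) sv(2)] L2_inner_integrable[OF zero_trace_pair_L2(2)[OF pair] L2_component(1)[OF sv(2)]] eqv
      by (intro integral_cong_AE) (auto intro: borel_measurable_integrable)
    also have "\<dots> = nsq ?M G * (LINT x|?M. f x * v x $ 1)"
      by (rule rayleigh_minimizer_weak_equation[OF pair f1 min sv(3)])
    also have "\<dots> = nsq ?M G * (LINT x|?M. e x \<bullet> v x)" by (simp add: e_def inner_vec_1_eq)
    finally show "(LINT x|?M. weak_grad \<Omega> e x \<bullet> weak_grad \<Omega> v x) = nsq ?M G * (LINT x|?M. e x \<bullet> v x)" .
  qed
next
  let ?M = "lebesgue_on \<Omega>"
  fix l assume "dirichlet_eigenvalue \<Omega> l"
  then obtain e :: "real^'d \<Rightarrow> real^1" where e: "e \<in> sobolev_zero \<Omega> 2" "\<not> (AE x in ?M. e x = 0)"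
    and eq: "\<forall>v \<in> sobolev_zero \<Omega> 2. (LINT x|?M. weak_grad \<Omega> e x \<bullet> weak_grad \<Omega> v x) = l * (LINT x|?M. e x \<bullet> v x)"
    unfolding dirichlet_eigenvalue_def by blast
  note se = sobolev_zero_component[OF \<Omega> lip order_refl e(1)]
  have c1: "nsq ?M (\<lambda>x. e x $ 1) = nsq ?M e" "nsq ?M (\<lambda>x. weak_grad \<Omega> e x $ 1) = nsq ?M (weak_grad \<Omega> e)"
    unfolding nsq_def by (simp_all add: norm_vec_1_eq)
  have "nsq ?M (weak_grad \<Omega> e) = l * nsq ?M e"
    using eq e(1) by (simp add: nsq_inner)
  moreover have "nsq ?M G * nsq ?M e \<le> nsq ?M (weak_grad \<Omega> e)" using min[OF se(3)[of 1]] unfolding c1 .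
  moreover have "nsq ?M e > 0"
  proof -
    have "nsq ?M e \<noteq> 0" using nsq_eq_0[OF se(1)] e(2) by blast
    then show ?thesis using nsq_nonneg[of ?M e] by linarith
  qed
  ultimately show "nsq ?M G \<le> l" by simp
qed

text \<open>A nonzero \<open>h\<close> provides the nonempty set of Rayleigh quotients whose infimum is attained.  Without
  it there may be no eigenvalue (the domain may be empty), so the sign is only asserted for
  nonzero \<open>h\<close>.\<close>

lemma dirichlet_poincare:
  fixes \<Omega> :: "(real^'d) set"
  assumes \<Omega>: "open \<Omega>" "bounded \<Omega>" and lip: "lipschitz_boundary \<Omega>" and pair: "zero_trace_pair \<Omega> h H"
  shows "first_dirichlet_eigenvalue \<Omega> * nsq (lebesgue_on \<Omega>) h \<le> nsq (lebesgue_on \<Omega>) H"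
    and "nsq (lebesgue_on \<Omega>) h \<noteq> 0 \<Longrightarrow> 0 \<le> first_dirichlet_eigenvalue \<Omega>"
proof -
  let ?M = "lebesgue_on \<Omega>"
  have *: "first_dirichlet_eigenvalue \<Omega> * nsq ?M h \<le> nsq ?M H \<and> 0 \<le> first_dirichlet_eigenvalue \<Omega>"
    if nz: "nsq ?M h \<noteq> 0"
  proof -
    obtain f G where f: "zero_trace_pair \<Omega> f G" "nsq ?M f = 1"
      and min: "\<And>h H. zero_trace_pair \<Omega> h H \<Longrightarrow> nsq ?M G * nsq ?M h \<le> nsq ?M H"
      using rayleigh_minimizer[OF \<Omega> lip pair nz] by blast
    have "first_dirichlet_eigenvalue \<Omega> = nsq ?M G"
      by (rule first_dirichlet_eigenvalue_eq[OF \<Omega> lip f min])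
    then show ?thesis using min[OF pair] by simp
  qed
  then show "nsq ?M h \<noteq> 0 \<Longrightarrow> 0 \<le> first_dirichlet_eigenvalue \<Omega>" by blast
  show "first_dirichlet_eigenvalue \<Omega> * nsq ?M h \<le> nsq ?M H"
    using * by (cases "nsq ?M h = 0") auto
qed

lemma nsq_components:
  fixes V :: "'a \<Rightarrow> 'b::euclidean_space ^ 'k"
  assumes "L2 M V" shows "nsq M V = (\<Sum>i\<in>UNIV. nsq M (\<lambda>x. V x $ i))"
proof -
  have "nsq M V = (LINT x|M. (\<Sum>i\<in>UNIV. (norm (V x $ i))\<^sup>2))"
    unfolding nsq_def by (simp add: norm_vec_def L2_set_def sum_nonneg)
  also have "\<dots> = (\<Sum>i\<in>UNIV. nsq M (\<lambda>x. V x $ i))"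
    unfolding nsq_def by (intro Bochner_Integration.integral_sum L2_integrable[OF L2_component(1)[OF assms]])
  finally show ?thesis .
qed

text \<open>Summation of the scalar inequality over the components.\<close>

lemma dirichlet_poincare_sobolev_zero:
  fixes v :: "real^'d \<Rightarrow> real^'k"
  assumes \<Omega>: "open \<Omega>" "bounded \<Omega>" and lip: "lipschitz_boundary \<Omega>" and p: "p \<ge> 2" and v: "v \<in> sobolev_zero \<Omega> p"
  shows "first_dirichlet_eigenvalue \<Omega> * nsq (lebesgue_on \<Omega>) v \<le> nsq (lebesgue_on \<Omega>) (weak_grad \<Omega> v)"
    and "nsq (lebesgue_on \<Omega>) v \<noteq> 0 \<Longrightarrow> 0 \<le> first_dirichlet_eigenvalue \<Omega>"
proof -
  let ?M = "lebesgue_on \<Omega>"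
  note sv = sobolev_zero_component[OF \<Omega> lip p v]
  show "first_dirichlet_eigenvalue \<Omega> * nsq ?M v \<le> nsq ?M (weak_grad \<Omega> v)"
    unfolding nsq_components[OF sv(1)] nsq_components[OF sv(2)] sum_distrib_left
    by (intro sum_mono dirichlet_poincare(1)[OF \<Omega> lip sv(3)])
  assume nz: "nsq ?M v \<noteq> 0"
  have "\<exists>i. nsq ?M (\<lambda>x. v x $ i) \<noteq> 0"
  proof (rule ccontr)
    assume "\<nexists>i. nsq ?M (\<lambda>x. v x $ i) \<noteq> 0"
    then have "nsq ?M v = 0" unfolding nsq_components[OF sv(1)] by simp
    with nz show False by contradiction
  qed
  then obtain i where "nsq ?M (\<lambda>x. v x $ i) \<noteq> 0" by (rule exE)
  then show "0 \<le> first_dirichlet_eigenvalue \<Omega>" by (rule dirichlet_poincare(2)[OF \<Omega> lip sv(3)])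
qed

section \<open>Convexity and the energy gap\<close>

text \<open>The restriction to a line is convex on the reals and lies above its tangent.\<close>

lemma convex_gradient_inequality:
  fixes h :: "'a::euclidean_space \<Rightarrow> real"
  assumes conv: "convex_on UNIV h" and D: "(h has_derivative (\<lambda>d. q \<bullet> d)) (at y)"
  shows "h y + q \<bullet> (z - y) \<le> h z"
proof -
  define g where "g t = h (y + t *\<^sub>R (z - y))" for t :: real
  have "convex_on UNIV g"
  proof (rule convex_onI)
    fix t a b :: real assume t: "0 < t" "t < 1"
    have "y + ((1 - t) *\<^sub>R a + t *\<^sub>R b) *\<^sub>R (z - y)
        = (1 - t) *\<^sub>R (y + a *\<^sub>R (z - y)) + t *\<^sub>R (y + b *\<^sub>R (z - y))"
      by (simp add: algebra_simps)
    then show "g ((1 - t) *\<^sub>R a + t *\<^sub>R b) \<le> (1 - t) * g a + t * g b"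
      unfolding g_def using convex_onD[OF conv, of t "y + a *\<^sub>R (z - y)" "y + b *\<^sub>R (z - y)"] t by simp
  qed simp
  moreover have "(g has_real_derivative (q \<bullet> (z - y))) (at 0)"
  proof -
    have "((\<lambda>t. y + t *\<^sub>R (z - y)) has_derivative (\<lambda>s. s *\<^sub>R (z - y))) (at 0)"
      by (auto intro!: derivative_eq_intros)
    moreover have "(h has_derivative (\<lambda>d. q \<bullet> d)) (at (y + 0 *\<^sub>R (z - y)))" using D by simp
    ultimately have "((\<lambda>t. h (y + t *\<^sub>R (z - y))) has_derivative (\<lambda>s. q \<bullet> (s *\<^sub>R (z - y)))) (at 0)"
      by (rule has_derivative_compose)
    then show ?thesis
      unfolding has_field_derivative_def g_def by (rule has_derivative_eq_rhs) (simp add: fun_eq_iff)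
  qed
  ultimately have "g 1 - g 0 \<ge> q \<bullet> (z - y) * (1 - 0)"
    by (intro convex_on_imp_above_tangent[where A = UNIV]) auto
  then show ?thesis by (simp add: g_def)
qed

text \<open>The gradient inequality for the convex function \<open>f - l / 2 |.|\<^sup>2\<close>, rearranged.\<close>

lemma lambda_convex_gradient_subdiff:
  fixes f :: "'a::euclidean_space \<Rightarrow> real"
  assumes f: "lambda_convex l f" and D: "GDERIV f y :> q"
  shows "q \<in> lambda_subdiff l f y"
  unfolding lambda_subdiff_def
proof (intro CollectI allI)
  fix z
  have "((\<lambda>z. f z - l / 2 * (norm z)\<^sup>2) has_derivative (\<lambda>d. (q - l *\<^sub>R y) \<bullet> d)) (at y)"
  proof -
    have "((\<lambda>z. f z - l / 2 * (z \<bullet> z)) has_derivative (\<lambda>d. d \<bullet> q - l / 2 * (y \<bullet> d + d \<bullet> y))) (at y)"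
      using D[unfolded gderiv_def]
      by (intro has_derivative_diff has_derivative_mult_right has_derivative_inner has_derivative_ident)
    then show ?thesis
      unfolding power2_norm_eq_inner
      by (rule has_derivative_eq_rhs) (simp add: fun_eq_iff inner_diff_left inner_commute algebra_simps)
  qed
  from convex_gradient_inequality[OF f[unfolded lambda_convex_def] this, of z]
  show "f y + q \<bullet> (z - y) + l / 2 * (norm (z - y))\<^sup>2 \<le> f z"
    unfolding power2_norm_eq_inner by (simp add: inner_commute algebra_simps inner_diff_left inner_diff_right)
qed

lemma lambda_subdiffD:
  "q \<in> lambda_subdiff l f y \<Longrightarrow> f y + q \<bullet> (z - y) + l / 2 * (norm (z - y))\<^sup>2 \<le> f z"
  by (simp add: lambda_subdiff_def)

lemma GDERIV_transform_open:
  assumes "GDERIV f y :> q" "open S" "y \<in> S" "\<And>z. z \<in> S \<Longrightarrow> f z = g z"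
  shows "GDERIV g y :> q"
  using assms unfolding gderiv_def by (rule has_derivative_transform_within_open)

text \<open>For a simple function in place of \<open>G\<close> only countably many values \<open>H\<close> occur; continuity in \<open>H\<close> carries
  measurability over to limits of simple functions.\<close>

lemma caratheodory_measurable:
  fixes W :: "real^'d \<Rightarrow> 'b::euclidean_space \<Rightarrow> real"
  assumes \<Omega>: "\<Omega> \<in> sets lebesgue" and W: "\<And>H. (\<lambda>x. W x H) \<in> borel_measurable (lebesgue_on \<Omega>)"
    and cont: "AE x in lebesgue_on \<Omega>. continuous_on UNIV (W x)"
    and G: "G \<in> borel_measurable (lebesgue_on \<Omega>)"
  shows "(\<lambda>x. W x (G x)) \<in> borel_measurable (lebesgue_on \<Omega>)"
proof -
  let ?M = "lebesgue_on \<Omega>"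
  obtain s where s: "\<And>n. simple_function ?M (s n)" "\<And>x. x \<in> space ?M \<Longrightarrow> (\<lambda>n. s n x) \<longlonglongrightarrow> G x"
    using borel_measurable_implies_sequence_metric[OF G, of 0] by blast
  have m: "(\<lambda>x. W x (s n x)) \<in> borel_measurable ?M" for n
  proof (rule measurable_compose_countable'[where I = "s n ` space ?M" and f = "\<lambda>H x. W x H" and g = "s n"])
    have "finite (s n ` space ?M)" using s(1) by (rule simple_functionD)
    then show "countable (s n ` space ?M)" by (rule countable_finite)
    show "s n \<in> ?M \<rightarrow>\<^sub>M count_space (s n ` space ?M)"
      using simple_functionD[OF s(1), of n] by (subst measurable_count_space_eq2) auto
  qed (rule W)
  have "(\<lambda>x. lim (\<lambda>n. W x (s n x))) \<in> borel_measurable ?M" by (rule borel_measurable_lim_metric[OF m])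
  moreover have "AE x in ?M. lim (\<lambda>n. W x (s n x)) = W x (G x)"
    using cont AE_space
  proof eventually_elim
    case (elim x)
    have "(\<lambda>n. W x (s n x)) \<longlonglongrightarrow> W x (G x)"
      using elim(1) s(2)[OF elim(2)] by (rule continuous_on_tendsto_compose) auto
    then show ?case by (rule limI)
  qed
  ultimately show ?thesis by (rule AE_eq_borel_measurable_lebesgue_on[OF _ _ \<Omega>])
qed

lemma growth_integrable:
  fixes W :: "real^'d \<Rightarrow> 'b::euclidean_space \<Rightarrow> real"
  assumes fin: "finite_measure (lebesgue_on \<Omega>)" and m: "(\<lambda>x. W x (G x)) \<in> borel_measurable (lebesgue_on \<Omega>)"
    and growth: "\<exists>C>0. AE x in lebesgue_on \<Omega>. \<forall>H.
        1 / C * (norm H powr p - 1) \<le> W x H \<and> W x H \<le> C * (norm H powr p + 1)"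
    and G: "Lp_on \<Omega> p G"
  shows "integrable (lebesgue_on \<Omega>) (\<lambda>x. W x (G x))"
proof -
  interpret finite_measure "lebesgue_on \<Omega>" by fact
  obtain C where C: "C > 0" "AE x in lebesgue_on \<Omega>. \<forall>H.
        1 / C * (norm H powr p - 1) \<le> W x H \<and> W x H \<le> C * (norm H powr p + 1)"
    using growth by blast
  have "integrable (lebesgue_on \<Omega>) (\<lambda>x. C * (norm (G x) powr p + 1) + 1 / C)"
    using G by (simp add: Lp_on_def)
  then show ?thesis
  proof (rule Bochner_Integration.integrable_bound)
    show "AE x in lebesgue_on \<Omega>. norm (W x (G x)) \<le> norm (C * (norm (G x) powr p + 1) + 1 / C)"
      using C(2)
    proof eventually_elim
      case (elim x)
      define a where "a = norm (G x) powr p"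
      have a: "a \<ge> 0" by (simp add: a_def)
      have "1 / C * (a - 1) \<le> W x (G x)" "W x (G x) \<le> C * (a + 1)" using elim by (simp_all add: a_def)
      moreover have "1 / C * (a - 1) = a / C - 1 / C" by (simp add: diff_divide_distrib)
      moreover have "a / C \<ge> 0" "1 / C > 0" "C * (a + 1) > 0" using a C(1) by simp_all
      ultimately have "\<bar>W x (G x)\<bar> \<le> C * (a + 1) + 1 / C" by linarith
      then show ?case by (simp add: a_def)
    qed
  qed (rule m)
qed

lemma push_forward_props:
  fixes w :: "real^'d \<Rightarrow> real^'k" and \<omega> :: "real^'k \<Rightarrow> real"
  assumes fin: "finite_measure (lebesgue_on \<Omega>)" and w: "w \<in> borel_measurable (lebesgue_on \<Omega>)" "w ` \<Omega> \<subseteq> D"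
    and \<omega>: "continuous_on (closure D) \<omega>" and bd: "bounded D"
  shows "push_forward \<Omega> D w \<in> radon_pos (closure D)"
    and "(LINT y|push_forward \<Omega> D w. \<omega> y) = (LINT x|lebesgue_on \<Omega>. \<omega> (w x))"
    and "integrable (lebesgue_on \<Omega>) (\<lambda>x. \<omega> (w x))"
proof -
  interpret finite_measure "lebesgue_on \<Omega>" by fact
  have wD: "w x \<in> closure D" if "x \<in> \<Omega>" for x using w(2) that closure_subset[of D] by blast
  have wm: "w \<in> lebesgue_on \<Omega> \<rightarrow>\<^sub>M restrict_space borel (closure D)"
    using w(1) wD by (intro measurable_restrict_space2) auto
  have \<omega>m: "\<omega> \<in> borel_measurable (restrict_space borel (closure D))"
    by (rule borel_measurable_continuous_on_restrict[OF \<omega>])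
  have "finite_measure (distr (lebesgue_on \<Omega>) (restrict_space borel (closure D)) w)"
    by (rule finite_measure_distr[OF wm])
  then show "push_forward \<Omega> D w \<in> radon_pos (closure D)" by (simp add: radon_pos_def push_forward_def)
  show "(LINT y|push_forward \<Omega> D w. \<omega> y) = (LINT x|lebesgue_on \<Omega>. \<omega> (w x))"
    unfolding push_forward_def by (rule integral_distr[OF wm \<omega>m])
  have "compact (closure D)" using bd by simp
  then have "bounded (\<omega> ` closure D)" by (intro compact_imp_bounded compact_continuous_image[OF \<omega>])
  then obtain B where B: "\<And>y. y \<in> closure D \<Longrightarrow> \<bar>\<omega> y\<bar> \<le> B" by (auto simp: bounded_iff)
  have "(\<lambda>x. \<omega> (w x)) \<in> borel_measurable (lebesgue_on \<Omega>)" by (rule measurable_compose[OF wm \<omega>m])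
  then show "integrable (lebesgue_on \<Omega>) (\<lambda>x. \<omega> (w x))"
    by (intro integrable_const_bound[where B = B] AE_I2) (use B wD in auto)
qed

text \<open>The Fenchel equality at \<open>\<mu>\<close> against the Fenchel inequality at \<open>\<nu>\<close>; the lower bound keeps the
  extended arithmetic away from \<open>-\<infinity>\<close>.\<close>

lemma measure_subdiff_inequality:
  assumes \<omega>: "\<omega> \<in> measure_subdiff X \<Phi> \<mu>" and bd: "\<exists>b::real. \<forall>\<mu>\<in>radon_pos X. ereal b \<le> \<Phi> \<mu>"
    and \<nu>: "\<nu> \<in> radon_pos X"
  obtains r where "\<Phi> \<mu> = ereal r"
    "ereal (r + (LINT y|\<nu>. \<omega> y) - (LINT y|\<mu>. \<omega> y)) \<le> \<Phi> \<nu>"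
proof -
  obtain b :: real where b: "\<And>\<mu>. \<mu> \<in> radon_pos X \<Longrightarrow> ereal b \<le> \<Phi> \<mu>" using bd by blast
  have \<mu>: "\<mu> \<in> radon_pos X" "\<Phi> \<mu> < \<infinity>" and eq: "conjugate X \<Phi> \<omega> = ereal (LINT y|\<mu>. \<omega> y) - \<Phi> \<mu>"
    using \<omega> by (auto simp: measure_subdiff_def)
  obtain r where r: "\<Phi> \<mu> = ereal r" using \<mu>(2) b[OF \<mu>(1)] by (cases "\<Phi> \<mu>") auto
  have "ereal (LINT y|\<nu>. \<omega> y) - \<Phi> \<nu> \<le> conjugate X \<Phi> \<omega>"
    unfolding conjugate_def using \<nu> by (rule SUP_upper)
  then have "ereal (r + (LINT y|\<nu>. \<omega> y) - (LINT y|\<mu>. \<omega> y)) \<le> \<Phi> \<nu>"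
    unfolding eq r using b[OF \<nu>] by (cases "\<Phi> \<nu>") auto
  then show ?thesis using r that by blast
qed

theorem theorem3p4:
  fixes \<Omega> :: "(real^'d) set" and D :: "(real^'k) set"
    and W :: "real^'d \<Rightarrow> real^'d^'k \<Rightarrow> real" and DW :: "real^'d \<Rightarrow> real^'d^'k \<Rightarrow> real^'d^'k"
    and F :: "real^'d \<Rightarrow> real^'k \<Rightarrow> real" and DF :: "real^'d \<Rightarrow> real^'k \<Rightarrow> real^'k"
    and \<Phi> :: "(real^'k) measure \<Rightarrow> ereal"
    and g u :: "real^'d \<Rightarrow> real^'k"
    and \<omega> \<omega>ext :: "real^'k \<Rightarrow> real" and q :: "real^'k \<Rightarrow> real^'k"
    and p \<kappa> \<kappa>\<^sub>W \<kappa>\<^sub>F :: real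
  assumes dom_Omega: "lipschitz_domain \<Omega>" and dom_D: "lipschitz_domain D"
    and p: "p \<ge> 2"
    and W_measurable: "\<And>H. (\<lambda>x. W x H) \<in> borel_measurable (lebesgue_on \<Omega>)"
    and W_continuous: "AE x in lebesgue_on \<Omega>. continuous_on UNIV (W x)"
    and W_growth: "\<exists>C>0. AE x in lebesgue_on \<Omega>. \<forall>H.
        1 / C * (norm H powr p - 1) \<le> W x H \<and> W x H \<le> C * (norm H powr p + 1)"
    and W_convex: "AE x in lebesgue_on \<Omega>. convex_on UNIV (W x)"
    and W_lambda: "AE x in lebesgue_on \<Omega>. lambda_convex \<kappa>\<^sub>W (W x)"
    and W_deriv: "AE x in lebesgue_on \<Omega>. \<forall>H. GDERIV (W x) H :> DW x H"
    and F_measurable: "\<And>y. y \<in> D \<Longrightarrow> (\<lambda>x. F x y) \<in> borel_measurable (lebesgue_on \<Omega>)"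
    and F_continuous: "AE x in lebesgue_on \<Omega>. continuous_on D (F x)"
    and F_integrable: "\<And>w. w \<in> borel_measurable (lebesgue_on \<Omega>) \<Longrightarrow> w ` \<Omega> \<subseteq> D \<Longrightarrow>
        integrable (lebesgue_on \<Omega>) (\<lambda>x. F x (w x))"
    and F_convex: "AE x in lebesgue_on \<Omega>. \<exists>f. convex_on UNIV f \<and> (\<forall>y\<in>D. F x y = f y)"
    and F_lambda: "AE x in lebesgue_on \<Omega>. \<exists>f. lambda_convex \<kappa>\<^sub>F f \<and> (\<forall>y\<in>D. F x y = f y)"
    and F_deriv: "AE x in lebesgue_on \<Omega>. \<forall>y\<in>D. GDERIV (F x) y :> DF x y"
    and g_boundary: "g ` frontier \<Omega> \<subseteq> frontier D" and g_extension: "g ` \<Omega> = D"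
    and Phi_convex: "measure_convex (closure D) \<Phi>"
    and Phi_bounded_below: "\<exists>b::real. \<forall>\<mu>\<in>radon_pos (closure D). ereal b \<le> \<Phi> \<mu>"
    and Phi_lsc: "weak_star_lsc (closure D) \<Phi>"
    and u: "u \<in> sobolev_trace_into \<Omega> D p g"
    and omega: "\<omega> \<in> measure_subdiff (closure D) \<Phi> (push_forward \<Omega> D u)"
    and omega_ext: "\<And>y. y \<in> closure D \<Longrightarrow> \<omega>ext y = \<omega> y"
    and omega_lambda: "lambda_convex \<kappa> \<omega>ext"
    and lambda: "\<kappa> \<ge> - \<kappa>\<^sub>W * first_dirichlet_eigenvalue \<Omega> - \<kappa>\<^sub>F"
    and q_measurable: "q \<in> borel_measurable borel"
    and q_selection: "\<And>y. q y \<in> lambda_subdiff \<kappa> \<omega>ext y"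
    and EL_well_defined: "\<And>v :: real^'d \<Rightarrow> real^'k. v \<in> sobolev_zero \<Omega> p \<Longrightarrow>
        integrable (lebesgue_on \<Omega>)
          (\<lambda>x. weak_grad \<Omega> v x \<bullet> DW x (weak_grad \<Omega> u x) + v x \<bullet> (DF x (u x) + q (u x)))"
    and EL: "\<And>v :: real^'d \<Rightarrow> real^'k. v \<in> sobolev_zero \<Omega> p \<Longrightarrow>
        (LINT x|lebesgue_on \<Omega>.
          weak_grad \<Omega> v x \<bullet> DW x (weak_grad \<Omega> u x) + v x \<bullet> (DF x (u x) + q (u x))) = 0"
  shows "minimizer_over (sobolev_trace_into \<Omega> D p g) (energy \<Omega> D W F \<Phi>) u \<and>
    (\<kappa> > - \<kappa>\<^sub>W * first_dirichlet_eigenvalue \<Omega> - \<kappa>\<^sub>F \<longrightarrow>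
      (\<forall>w. minimizer_over (sobolev_trace_into \<Omega> D p g) (energy \<Omega> D W F \<Phi>) w \<longrightarrow>
        (AE x in lebesgue_on \<Omega>. w x = u x)))"
proof -
  let ?M = "lebesgue_on \<Omega>" and ?lam = "first_dirichlet_eigenvalue \<Omega>"
  have \<Omega>: "open \<Omega>" "bounded \<Omega>" and lip: "lipschitz_boundary \<Omega>"
    and D: "open D" "bounded D" using dom_Omega dom_D by (auto simp: lipschitz_domain_def)
  have \<Omega>s: "\<Omega> \<in> sets lebesgue" using \<Omega> by simp
  have fin: "finite_measure ?M" by (rule finite_measure_lebesgue_on_bounded[OF \<Omega>])
  have p0: "p \<ge> 0" using p by simp
  have \<omega>c: "continuous_on (closure D) \<omega>" using omega by (simp add: measure_subdiff_def)
  let ?S = "sobolev_trace_into \<Omega> D p g" and ?E = "energy \<Omega> D W F \<Phi>"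
  define J where "J w = (LINT x|?M. W x (weak_grad \<Omega> w x) + F x (w x))" for w
  define Q where "Q w = (LINT x|?M. \<omega> (w x))" for w
  have adm: "w \<in> sobolev_trace \<Omega> p g" "w ` \<Omega> \<subseteq> D" "w \<in> borel_measurable ?M"
      "integrable ?M (\<lambda>x. W x (weak_grad \<Omega> w x))" "integrable ?M (\<lambda>x. F x (w x))"
      "integrable ?M (\<lambda>x. \<omega> (w x))" if "w \<in> ?S" for w
  proof -
    show tr: "w \<in> sobolev_trace \<Omega> p g" and im: "w ` \<Omega> \<subseteq> D" using that by (auto simp: sobolev_trace_into_def)
    then have sob: "w \<in> sobolev \<Omega> p" by (simp add: sobolev_trace_def)
    then show m: "w \<in> borel_measurable ?M" by (simp add: sobolev_def Lp_on_def)
    note gr = sobolev_weak_grad(2)[OF \<Omega>(1) sob]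
    show "integrable ?M (\<lambda>x. W x (weak_grad \<Omega> w x))"
      using gr by (intro growth_integrable[OF fin _ W_growth gr]
          caratheodory_measurable[OF \<Omega>s W_measurable W_continuous]) (simp add: Lp_on_def)
    show "integrable ?M (\<lambda>x. F x (w x))" by (rule F_integrable[OF m im])
    show "integrable ?M (\<lambda>x. \<omega> (w x))" by (rule push_forward_props(3)[OF fin m im \<omega>c D(2)])
  qed
  have gap: "J u - Q w + Q u + (\<kappa>\<^sub>W * ?lam + \<kappa>\<^sub>F + \<kappa>) / 2 * nsq ?M (\<lambda>x. w x - u x) \<le> J w" if w: "w \<in> ?S" for w
  proof -
    note aw = adm[OF w] and au = adm[OF u]
    define v where "v x = w x - u x" for x
    define Gv where "Gv = weak_grad \<Omega> v"
    have v0: "v \<in> sobolev_zero \<Omega> p"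
      and Gv: "AE x in ?M. weak_grad \<Omega> w x - weak_grad \<Omega> u x = Gv x"
      unfolding Gv_def v_def[abs_def] by (rule sobolev_trace_diff[OF \<Omega>(1) p0 aw(1) au(1)])+
    have L: "L2 ?M v" "L2 ?M Gv" unfolding Gv_def by (rule sobolev_zero_component[OF \<Omega> lip p v0])+
    define b where "b x = Gv x \<bullet> DW x (weak_grad \<Omega> u x) + v x \<bullet> (DF x (u x) + q (u x))" for x
    have b: "integrable ?M b" "(LINT x|?M. b x) = 0"
      unfolding b_def[abs_def] Gv_def by (rule EL_well_defined[OF v0], rule EL[OF v0])
    \<comment> \<open>A negative modulus is of no use against the Poincare inequality, but \<open>W\<close> is also convex.\<close>
    define k where "k = max \<kappa>\<^sub>W 0"
    have W_k: "AE x in ?M. lambda_convex k (W x)"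
    proof (cases "\<kappa>\<^sub>W \<ge> 0")
      case True then show ?thesis using W_lambda by (simp add: k_def)
    next
      case False then show ?thesis using W_convex by (simp add: k_def lambda_convex_def)
    qed
    have pt: "AE x in ?M. b x + k / 2 * (norm (Gv x))\<^sup>2 + (\<kappa>\<^sub>F + \<kappa>) / 2 * (norm (v x))\<^sup>2
        \<le> (W x (weak_grad \<Omega> w x) + F x (w x) + \<omega> (w x)) - (W x (weak_grad \<Omega> u x) + F x (u x) + \<omega> (u x))"
      using W_k W_deriv F_lambda F_deriv Gv AE_space
    proof eventually_elim
      case (elim x)
      have ux: "u x \<in> D" and wx: "w x \<in> D" using elim(6) aw(2) au(2) by auto
      have "W x (weak_grad \<Omega> u x) + DW x (weak_grad \<Omega> u x) \<bullet> (weak_grad \<Omega> w x - weak_grad \<Omega> u x)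
          + k / 2 * (norm (weak_grad \<Omega> w x - weak_grad \<Omega> u x))\<^sup>2 \<le> W x (weak_grad \<Omega> w x)"
        using elim(2) by (intro lambda_subdiffD lambda_convex_gradient_subdiff[OF elim(1)]) simp
      then have 1: "W x (weak_grad \<Omega> u x) + Gv x \<bullet> DW x (weak_grad \<Omega> u x) + k / 2 * (norm (Gv x))\<^sup>2
          \<le> W x (weak_grad \<Omega> w x)" unfolding elim(5) by (simp add: inner_commute)
      obtain f where f: "lambda_convex \<kappa>\<^sub>F f" "\<forall>y\<in>D. F x y = f y" using elim(3) by (elim exE conjE) (rule that)
      have "GDERIV (F x) (u x) :> DF x (u x)" using elim(4) ux by (rule bspec)
      then have "GDERIV f (u x) :> DF x (u x)"
        by (rule GDERIV_transform_open[OF _ D(1) ux]) (rule bspec[OF f(2)])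
      then have "f (u x) + DF x (u x) \<bullet> (w x - u x) + \<kappa>\<^sub>F / 2 * (norm (w x - u x))\<^sup>2 \<le> f (w x)"
        by (intro lambda_subdiffD lambda_convex_gradient_subdiff[OF f(1)])
      then have 2: "F x (u x) + v x \<bullet> DF x (u x) + \<kappa>\<^sub>F / 2 * (norm (v x))\<^sup>2 \<le> F x (w x)"
        using f(2) ux wx by (simp add: v_def inner_commute)
      have "\<omega>ext (u x) + q (u x) \<bullet> (w x - u x) + \<kappa> / 2 * (norm (w x - u x))\<^sup>2 \<le> \<omega>ext (w x)"
        by (rule lambda_subdiffD[OF q_selection])
      moreover have "\<omega>ext (u x) = \<omega> (u x)" "\<omega>ext (w x) = \<omega> (w x)"
        by (rule omega_ext[OF subsetD[OF closure_subset ux]], rule omega_ext[OF subsetD[OF closure_subset wx]])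
      ultimately have 3: "\<omega> (u x) + v x \<bullet> q (u x) + \<kappa> / 2 * (norm (v x))\<^sup>2 \<le> \<omega> (w x)"
        by (simp add: v_def inner_commute)
      have "(\<kappa>\<^sub>F + \<kappa>) / 2 * (norm (v x))\<^sup>2 = \<kappa>\<^sub>F / 2 * (norm (v x))\<^sup>2 + \<kappa> / 2 * (norm (v x))\<^sup>2"
        by (simp add: add_divide_distrib distrib_right)
      then show ?case using 1 2 3 unfolding b_def inner_add_right by linarith
    qed
    have "(LINT x|?M. b x + k / 2 * (norm (Gv x))\<^sup>2 + (\<kappa>\<^sub>F + \<kappa>) / 2 * (norm (v x))\<^sup>2)
      \<le> (LINT x|?M. (W x (weak_grad \<Omega> w x) + F x (w x) + \<omega> (w x)) - (W x (weak_grad \<Omega> u x) + F x (u x) + \<omega> (u x)))"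
      using b(1) L2_integrable[OF L(1)] L2_integrable[OF L(2)] aw(4-6) au(4-6)
      by (intro integral_mono_AE pt) auto
    also have "\<dots> = (J w + Q w) - (J u + Q u)"
      unfolding J_def Q_def using aw(4-6) au(4-6) by simp
    also have "(LINT x|?M. b x + k / 2 * (norm (Gv x))\<^sup>2 + (\<kappa>\<^sub>F + \<kappa>) / 2 * (norm (v x))\<^sup>2)
      = k / 2 * nsq ?M Gv + (\<kappa>\<^sub>F + \<kappa>) / 2 * nsq ?M v"
      using b L2_integrable[OF L(1)] L2_integrable[OF L(2)] by (simp add: nsq_def)
    finally have *: "k / 2 * nsq ?M Gv + (\<kappa>\<^sub>F + \<kappa>) / 2 * nsq ?M v \<le> (J w + Q w) - (J u + Q u)" .
    \<comment> \<open>For negative \<open>\<kappa>\<^sub>W\<close> the left-hand side is nonpositive, since \<open>\<lambda>\<^sub>1 \<ge> 0\<close> as soon as \<open>v\<close> is not null.\<close>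
    have "\<kappa>\<^sub>W * (?lam * nsq ?M v) \<le> k * nsq ?M Gv"
    proof (cases "\<kappa>\<^sub>W \<ge> 0")
      case True
      then show ?thesis
        unfolding k_def Gv_def using dirichlet_poincare_sobolev_zero(1)[OF \<Omega> lip p v0]
        by (simp add: mult_left_mono)
    next
      case False
      have "0 \<le> ?lam * nsq ?M v"
        using dirichlet_poincare_sobolev_zero(2)[OF \<Omega> lip p v0] by (cases "nsq ?M v = 0") auto
      then have "\<kappa>\<^sub>W * (?lam * nsq ?M v) \<le> 0" using False by (simp add: mult_nonpos_nonneg)
      then show ?thesis using False by (simp add: k_def)
    qed
    moreover have "(\<kappa>\<^sub>W * ?lam + \<kappa>\<^sub>F + \<kappa>) / 2 * nsq ?M v
        = (\<kappa>\<^sub>W * (?lam * nsq ?M v)) / 2 + (\<kappa>\<^sub>F + \<kappa>) / 2 * nsq ?M v"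
      by (simp add: field_simps)
    moreover have "k / 2 * nsq ?M Gv = (k * nsq ?M Gv) / 2" by simp
    ultimately have "J u - Q w + Q u + (\<kappa>\<^sub>W * ?lam + \<kappa>\<^sub>F + \<kappa>) / 2 * nsq ?M v \<le> J w"
      using * by linarith
    then show ?thesis unfolding v_def[abs_def] .
  qed
  have energies: "\<exists>r. \<Phi> (push_forward \<Omega> D u) = ereal r \<and> ereal (r + Q w - Q u) \<le> \<Phi> (push_forward \<Omega> D w)"
    if w: "w \<in> ?S" for w
  proof -
    note pw = push_forward_props[OF fin adm(3)[OF w] adm(2)[OF w] \<omega>c D(2)]
    note pu = push_forward_props[OF fin adm(3)[OF u] adm(2)[OF u] \<omega>c D(2)]
    obtain r where "\<Phi> (push_forward \<Omega> D u) = ereal r"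
      "ereal (r + (LINT y|push_forward \<Omega> D w. \<omega> y) - (LINT y|push_forward \<Omega> D u. \<omega> y)) \<le> \<Phi> (push_forward \<Omega> D w)"
      by (rule measure_subdiff_inequality[OF omega Phi_bounded_below pw(1)])
    then show ?thesis unfolding pw(2) pu(2) Q_def by blast
  qed
  have E_gap: "?E u + ereal ((\<kappa>\<^sub>W * ?lam + \<kappa>\<^sub>F + \<kappa>) / 2 * nsq ?M (\<lambda>x. w x - u x)) \<le> ?E w" if w: "w \<in> ?S" for w
  proof -
    obtain r where r: "\<Phi> (push_forward \<Omega> D u) = ereal r" "ereal (r + Q w - Q u) \<le> \<Phi> (push_forward \<Omega> D w)"
      using energies[OF w] by blast
    have "?E u + ereal ((\<kappa>\<^sub>W * ?lam + \<kappa>\<^sub>F + \<kappa>) / 2 * nsq ?M (\<lambda>x. w x - u x))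
        \<le> ereal (J w) + ereal (r + Q w - Q u)"
      using gap[OF w] by (simp add: energy_def J_def r(1))
    also have "\<dots> \<le> ?E w" unfolding energy_def J_def using r(2) by (rule add_left_mono)
    finally show ?thesis .
  qed
  have fin_E: "\<exists>e. ?E u = ereal e" using energies[OF u] by (auto simp: energy_def)
  then obtain e where e: "?E u = ereal e" by blast
  have min: "minimizer_over ?S ?E u"
    unfolding minimizer_over_def
  proof (intro conjI ballI u)
    fix w assume w: "w \<in> ?S"
    have "0 \<le> (\<kappa>\<^sub>W * ?lam + \<kappa>\<^sub>F + \<kappa>) / 2 * nsq ?M (\<lambda>x. w x - u x)" using lambda by simp
    then have "?E u \<le> ?E u + ereal ((\<kappa>\<^sub>W * ?lam + \<kappa>\<^sub>F + \<kappa>) / 2 * nsq ?M (\<lambda>x. w x - u x))" by (simp add: e)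
    also note E_gap[OF w]
    finally show "?E u \<le> ?E w" .
  qed
  moreover have "AE x in ?M. w x = u x"
    if strict: "\<kappa> > - \<kappa>\<^sub>W * ?lam - \<kappa>\<^sub>F" and w: "minimizer_over ?S ?E w" for w
  proof -
    have wS: "w \<in> ?S" "?E w \<le> ?E u" using w u by (auto simp: minimizer_over_def)
    have "L2 ?M (\<lambda>x. w x - u x)"
      by (rule sobolev_zero_component(1)[OF \<Omega> lip p
            sobolev_trace_diff(1)[OF \<Omega>(1) p0 adm(1)[OF wS(1)] adm(1)[OF u]]])
    moreover have "nsq ?M (\<lambda>x. w x - u x) = 0"
    proof -
      have "(\<kappa>\<^sub>W * ?lam + \<kappa>\<^sub>F + \<kappa>) / 2 * nsq ?M (\<lambda>x. w x - u x) \<le> 0"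
        using order_trans[OF E_gap[OF wS(1)] wS(2)] by (simp add: e)
      moreover have "(\<kappa>\<^sub>W * ?lam + \<kappa>\<^sub>F + \<kappa>) / 2 > 0" using strict by simp
      ultimately have "nsq ?M (\<lambda>x. w x - u x) \<le> 0" by (simp add: mult_le_0_iff)
      then show ?thesis using nsq_nonneg[of ?M "\<lambda>x. w x - u x"] by linarith
    qed
    ultimately have "AE x in ?M. w x - u x = 0" by (rule nsq_eq_0)
    then show ?thesis by eventually_elim simp
  qed
  ultimately show ?thesis by blast
qed

end
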